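(* Let $d\ge3$ and let $C,C_1,C_2,\dots\in\mathcal{C}^d_{ar}$ have generators $\psi,\psi_1,\psi_2,\dots$ with pseudo-inverses $\varphi,\varphi_1,\varphi_2,\dots$. The following are equivalent: (1) $(C_n)$ converges uniformly to $C$; (2) $(\varphi_n)$ converges pointwise to $\varphi$ on $(0,1]$; (3) $(\psi_n)$ converges uniformly to $\psi$ on $[0,\infty)$; (4) $(\psi_n^{(m)})$ converges pointwise to $\psi^{(m)}$ on $(0,\infty)$ for every $m\in\{1,\dots,d-2\}$ and $(D^-\psi_n^{(d-2)})$ converges pointwise to $D^-\psi^{(d-2)}$ on $\mathrm{Cont}(D^-\psi^{(d-2)})$; (5) $(C_n)$ converges weakly conditional to $C$ and $(c_n^{1:d-1})$ converges to $c^{1:d-1}$ $\lambda_{d-1}$-almost everywhere on $\mathbb{I}^{d-1}$.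
   Context: $\mathbb{I}=[0,1]$. An Archimedean generator is a continuous non-increasing $\psi:[0,\infty)\to\mathbb{I}$ with $\psi(0)=1$, $\lim_{z\to\infty}\psi(z)=0$, strictly decreasing on $[0,\inf\{z:\psi(z)=0\}]$; pseudo-inverse $\varphi(y)=\inf\{z\in[0,\infty]:\psi(z)=y\}$. $\psi$ is $d$-monotone if $(-1)^{d-2}\psi^{(d-2)}$ exists on $(0,\infty)$ and is non-negative, non-increasing and convex. $\mathcal{C}^d_{ar}$: copulas $C(\mathbf{u})=\psi(\sum_i\varphi(u_i))$ with $d$-monotone generator, $\psi(1)=1/2$. $D^-$ left-hand derivative; $\mathrm{Cont}(g)$ continuity points. $C^{1:d-1}(\mathbf{x})=C(\mathbf{x},1)$ is absolutely continuous with density $c^{1:d-1}$. $K_C$ denotes the $(d-1)$-Markov kernel of $C$ (regular conditional distribution of the last coordinate given the first $d-1$), in the version $K_C(\mathbf{x},[0,y])=1$ if $\min_i x_i=1$ or $\sum_{i\le d-1}\varphi(x_i)\ge\varphi(0)$; $=0$ if otherwise and $y<\psi(\varphi(0)-\sum_{i\le d-1}\varphi(x_i))$; $=D^-\psi^{(d-2)}(\sum_{i\le d-1}\varphi(x_i)+\varphi(y))/D^-\psi^{(d-2)}(\sum_{i\le d-1}\varphi(x_i))$ otherwise (conventions $\psi(\infty)=0$, $\psi(u)=1$ for $u<0$, $D^-\psi^{(d-2)}(\infty)=0$). $(C_n)$ converges weakly conditional to $C$ if there is Borel $\Lambda\subseteq\mathbb{I}^{d-1}$ with $\mu_{C^{1:d-1}}(\Lambda)=1$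 and $K_{C_n}(\mathbf{x},\cdot)\to K_C(\mathbf{x},\cdot)$ weakly for all $\mathbf{x}\in\Lambda$. *)

theory Defs
  imports "HOL-Analysis.Analysis" "HOL-Probability.Probability"
begin

text \<open>Generators are real functions; only their values on [0,infinity) matter.
  Extension to extended reals with the conventions psi(infinity) = 0 and
  psi(u) = 1 for u < 0.\<close>
definition psi_ext :: "(real \<Rightarrow> real) \<Rightarrow> ereal \<Rightarrow> real" where
  "psi_ext \<psi> z = (if z = \<infinity> then 0 else if z < 0 then 1 else \<psi> (real_of_ereal z))"

definition gen_zero :: "(real \<Rightarrow> real) \<Rightarrow> ereal" where
  "gen_zero \<psi> = Inf {ereal z | z. 0 \<le> z \<and> \<psi> z = 0}"

definition arch_generator :: "(real \<Rightarrow> real) \<Rightarrow> bool" where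
  "arch_generator \<psi> \<longleftrightarrow>
     continuous_on {0..} \<psi> \<and>
     \<psi> ` {0..} \<subseteq> {0..1} \<and>
     antimono_on {0..} \<psi> \<and>
     \<psi> 0 = 1 \<and>
     (\<psi> \<longlongrightarrow> 0) at_top \<and>
     (\<forall>x y. 0 \<le> x \<and> x < y \<and> ereal y \<le> gen_zero \<psi> \<longrightarrow> \<psi> y < \<psi> x)"

definition pseudo_inv :: "(real \<Rightarrow> real) \<Rightarrow> real \<Rightarrow> ereal" where
  "pseudo_inv \<psi> y = Inf {z. 0 \<le> z \<and> psi_ext \<psi> z = y}"

definition d_monotone :: "nat \<Rightarrow> (real \<Rightarrow> real) \<Rightarrow> bool" where
  "d_monotone d \<psi> \<longleftrightarrow>
     (\<forall>k < d - 2. \<forall>x > 0. ((deriv ^^ k) \<psi> has_real_derivative (deriv ^^ Suc k) \<psi> x) (at x)) \<and>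
     (\<forall>x > 0. 0 \<le> (-1) ^ (d - 2) * (deriv ^^ (d - 2)) \<psi> x) \<and>
     antimono_on {0<..} (\<lambda>x. (-1) ^ (d - 2) * (deriv ^^ (d - 2)) \<psi> x) \<and>
     convex_on {0<..} (\<lambda>x. (-1) ^ (d - 2) * (deriv ^^ (d - 2)) \<psi> x)"

definition ar_generator :: "nat \<Rightarrow> (real \<Rightarrow> real) \<Rightarrow> bool" where
  "ar_generator d \<psi> \<longleftrightarrow> arch_generator \<psi> \<and> d_monotone d \<psi> \<and> \<psi> 1 = 1 / 2"

definition cube :: "nat \<Rightarrow> (nat \<Rightarrow> real) set" where
  "cube k = {..<k} \<rightarrow>\<^sub>E {0..1}"

definition arch_copula :: "nat \<Rightarrow> (real \<Rightarrow> real) \<Rightarrow> (nat \<Rightarrow> real) \<Rightarrow> real" where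
  "arch_copula d \<psi> u = psi_ext \<psi> (\<Sum>i<d. pseudo_inv \<psi> (u i))"

abbreviation leb :: "nat \<Rightarrow> (nat \<Rightarrow> real) measure" where
  "leb k \<equiv> Pi\<^sub>M {..<k} (\<lambda>_. lborel)"

definition marginal_density :: "nat \<Rightarrow> ((nat \<Rightarrow> real) \<Rightarrow> real) \<Rightarrow> ((nat \<Rightarrow> real) \<Rightarrow> real) \<Rightarrow> bool" where
  "marginal_density d C c \<longleftrightarrow>
     set_integrable (leb (d - 1)) (cube (d - 1)) c \<and>
     (\<forall>x \<in> cube (d - 1).
        C (x(d - 1 := 1)) = (LINT y : ({..<d - 1} \<rightarrow>\<^sub>E UNIV) \<inter> {y. \<forall>i<d - 1. 0 \<le> y i \<and> y i \<le> x i} | leb (d - 1). c y))"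

definition marginal_measure :: "nat \<Rightarrow> ((nat \<Rightarrow> real) \<Rightarrow> real) \<Rightarrow> (nat \<Rightarrow> real) measure" where
  "marginal_measure d c = density (leb (d - 1)) (\<lambda>x. ennreal (c x) * indicator (cube (d - 1)) x)"

definition left_deriv :: "(real \<Rightarrow> real) \<Rightarrow> real \<Rightarrow> real" where
  "left_deriv f x = Lim (at_left x) (\<lambda>t. (f t - f x) / (t - x))"

definition LD :: "nat \<Rightarrow> (real \<Rightarrow> real) \<Rightarrow> ereal \<Rightarrow> real" where
  "LD d \<psi> z = (if z = \<infinity> then 0 else left_deriv ((deriv ^^ (d - 2)) \<psi>) (real_of_ereal z))"

text \<open>K_C(x,[0,y]) for y in I, in the version fixed in the paper, extended to a
  distribution function on R (0 below 0, 1 from 1 on).\<close>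
definition kernel_cdf :: "nat \<Rightarrow> (real \<Rightarrow> real) \<Rightarrow> (nat \<Rightarrow> real) \<Rightarrow> real \<Rightarrow> real" where
  "kernel_cdf d \<psi> x y =
    (let s = (\<Sum>i<d - 1. pseudo_inv \<psi> (x i)) in
     if y < 0 then 0
     else if 1 \<le> y then 1
     else if Min (x ` {..<d - 1}) = 1 \<or> pseudo_inv \<psi> 0 \<le> s then 1
     else if y < psi_ext \<psi> (pseudo_inv \<psi> 0 - s) then 0
     else LD d \<psi> (s + pseudo_inv \<psi> y) / LD d \<psi> s)"

definition kernel :: "nat \<Rightarrow> (real \<Rightarrow> real) \<Rightarrow> (nat \<Rightarrow> real) \<Rightarrow> real measure" where
  "kernel d \<psi> x = interval_measure (kernel_cdf d \<psi> x)"

definition weak_cond_conv :: "nat \<Rightarrow> (nat \<Rightarrow> real \<Rightarrow> real) \<Rightarrow> (real \<Rightarrow> real) \<Rightarrow> ((nat \<Rightarrow> real) \<Rightarrow> real) \<Rightarrow> bool" where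
  "weak_cond_conv d \<psi>s \<psi> c \<longleftrightarrow>
     (\<exists>\<Lambda> \<in> sets (leb (d - 1)). \<Lambda> \<subseteq> cube (d - 1) \<and>
        emeasure (marginal_measure d c) \<Lambda> = 1 \<and>
        (\<forall>x \<in> \<Lambda>. weak_conv_m (\<lambda>n. kernel d (\<psi>s n) x) (kernel d \<psi> x)))"

definition cont_points :: "(real \<Rightarrow> real) \<Rightarrow> real set" where
  "cont_points g = {x. 0 < x \<and> isCont g x}"

end

(* Write H_k = (-1)^k psi^(k) for k <= d - 2 and H_(d-1) for the corresponding left-hand derivative of
   order d - 1. Each -H_(k+1) is a subgradient of H_k, so pointwise convergence of generators
   propagates to all derivatives, for the last one at continuity points, even along convergent
   arguments. Uniform convergence of the copulas gives convergence of the pseudo-inverses because the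
   k-fold iterates psi (k phi(w)) of the bivariate margin converge and psi 1 = 1/2 fixes the scale;
   conversely a d-monotone generator makes the copula Lipschitz in each coordinate. The (d-1)-margin has
   density H_(d-1) (sum phi(x_i)) prod |phi'(x_i)|, as iterated integration over boxes shows; the
   densities and the kernels therefore converge off the null set where sum phi(x_i) is a discontinuity
   of H_(d-1) or the zero of psi. In the other direction Scheffe's lemma recovers convergence of the
   (d-1)-margins, hence of the bivariate ones, from the densities alone. *)
theory Submission
  imports Defs
begin

section \<open>Subgradients of convex functions\<close>

text \<open>A \<open>d\<close>-monotone generator need not have a derivative of order
  \<open>d - 1\<close>, yet the density and the kernel are built from its left-hand version.
  Subgradients treat this order like the lower ones: monotonicity, the fundamental theorem and the
  passage to limits all follow from one family of linear inequalities. Limits along moving arguments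
  are needed because density and kernel are evaluated at sums of pseudo-inverses, which change with
  \<open>n\<close>. A second obstacle is that an Archimedean copula determines its generator only up
  to a rescaling of the argument, so the normalisation has to enter quantitatively when
  pseudo-inverses are recovered from copulas. Third, \<open>c\<close> and \<open>cs\<close> are
  known only through their integrals over boxes and have to be identified almost everywhere with the
  explicit formula. The condition \<open>3 \<le> d\<close> provides at least one genuine derivative
  and leaves at least two coordinates in the \<open>(d-1)\<close>-margin.\<close>

definition subgradient_on :: "real set \<Rightarrow> (real \<Rightarrow> real) \<Rightarrow> (real \<Rightarrow> real) \<Rightarrow> bool" where
  "subgradient_on S f g \<longleftrightarrow> (\<forall>x\<in>S. \<forall>y\<in>S. f x + g x * (y - x) \<le> f y)"

lemma subgradient_onD:
  "subgradient_on S f g \<Longrightarrow> x \<in> S \<Longrightarrow> y \<in> S \<Longrightarrow> f x + g x * (y - x) \<le> f y"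
  by (simp add: subgradient_on_def)

lemma subgradient_slope_bounds:
  assumes "subgradient_on S f g" "x \<in> S" "y \<in> S" "x < y"
  shows "g x \<le> (f y - f x) / (y - x)" "(f y - f x) / (y - x) \<le> g y"
proof -
  show "g x \<le> (f y - f x) / (y - x)"
    using subgradient_onD[OF assms(1), of x y] assms by (simp add: pos_le_divide_eq)
  show "(f y - f x) / (y - x) \<le> g y"
    using subgradient_onD[OF assms(1), of y x] assms by (simp add: pos_divide_le_eq algebra_simps)
qed

lemma subgradient_mono:
  assumes "subgradient_on S f g" "x \<in> S" "y \<in> S" "x \<le> y"
  shows "g x \<le> g y"
proof (cases "x = y")
  case False
  with assms show ?thesis using subgradient_slope_bounds[OF assms(1-3)] by simp
qed simp

text \<open>Secant slopes depend on function values only, hence converge. By continuity of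
  \<open>g\<close>, a secant of \<open>f\<close> close to \<open>x\<close> on the left has slope
  above a given \<open>a < g x\<close>; the corresponding secant of \<open>fs n\<close> bounds
  \<open>gs n\<close> from below at every point to its right, eventually including
  \<open>X n\<close>. The other side is symmetric.\<close>

lemma subgradient_tendsto:
  assumes S: "open S" "x \<in> S"
    and sgn: "\<And>n. subgradient_on S (fs n) (gs n)" and sg: "subgradient_on S f g"
    and lim: "\<And>y. y \<in> S \<Longrightarrow> (\<lambda>n. fs n y) \<longlonglongrightarrow> f y"
    and c: "isCont g x" and X: "X \<longlonglongrightarrow> x"
  shows "(\<lambda>n. gs n (X n)) \<longlonglongrightarrow> g x"
proof -
  obtain e where e: "e > 0" "\<And>y. \<bar>y - x\<bar> < e \<Longrightarrow> y \<in> S"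
    using S by (auto simp: open_real)
  have evS: "\<forall>\<^sub>F n in sequentially. X n \<in> S"
    using X S topological_tendstoD by blast
  show ?thesis
  proof (rule order_tendstoI)
    fix a assume "a < g x"
    then have "\<forall>\<^sub>F y in at_left x. a < g y"
      using c by (auto simp: isCont_def order_tendsto_iff filterlim_at_split)
    moreover have "\<forall>\<^sub>F y in at_left x. x - e < y \<and> y < x"
      using e eventually_at_left_real[of "x - e" x] by simp
    ultimately have "\<forall>\<^sub>F y in at_left x. a < g y \<and> x - e < y \<and> y < x"
      by eventually_elim auto
    then obtain y where y: "a < g y" "x - e < y" "y < x"
      using eventually_happens'[OF trivial_limit_at_left_real] by blast
    \<comment> \<open>The midpoint leaves a gap between the secant over \<open>[y, z]\<close> and
      \<open>x\<close>, so that \<open>X n\<close> eventually lies beyond \<open>z\<close>.\<close>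
    define z where "z = (x + y) / 2"
    have z: "y < z" "z < x" using y by (auto simp: z_def)
    have yz: "y \<in> S" "z \<in> S" using y z e by auto
    have "(\<lambda>n. (fs n z - fs n y) / (z - y)) \<longlonglongrightarrow> (f z - f y) / (z - y)"
      by (intro tendsto_intros lim yz) (use z in auto)
    moreover have "a < (f z - f y) / (z - y)"
      using y subgradient_slope_bounds(1)[OF sg yz z(1)] by simp
    ultimately have "\<forall>\<^sub>F n in sequentially. a < (fs n z - fs n y) / (z - y)"
      by (rule order_tendstoD)
    moreover have "\<forall>\<^sub>F n in sequentially. z < X n" using X z(2) by (rule order_tendstoD)
    ultimately show "\<forall>\<^sub>F n in sequentially. a < gs n (X n)"
      using evS
    proof eventually_elim
      case (elim n)
      then show ?case using subgradient_slope_bounds(2)[OF sgn[of n] yz z(1)]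
          subgradient_mono[OF sgn[of n] yz(2), of "X n"] by simp
    qed
  next
    fix a assume "g x < a"
    then have "\<forall>\<^sub>F y in at_right x. g y < a"
      using c by (auto simp: isCont_def order_tendsto_iff filterlim_at_split)
    moreover have "\<forall>\<^sub>F y in at_right x. x < y \<and> y < x + e"
      using e eventually_at_right_real[of x "x + e"] by simp
    ultimately have "\<forall>\<^sub>F y in at_right x. g y < a \<and> x < y \<and> y < x + e"
      by eventually_elim auto
    then obtain y where y: "g y < a" "x < y" "y < x + e"
      using eventually_happens'[OF trivial_limit_at_right_real] by blast
    define z where "z = (x + y) / 2"
    have z: "x < z" "z < y" using y by (auto simp: z_def)
    have yz: "z \<in> S" "y \<in> S" using y z e by auto
    have "(\<lambda>n. (fs n y - fs n z) / (y - z)) \<longlonglongrightarrow> (f y - f z) / (y - z)"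
      by (intro tendsto_intros lim yz) (use z in auto)
    moreover have "(f y - f z) / (y - z) < a"
      using y subgradient_slope_bounds(2)[OF sg yz z(2)] by simp
    ultimately have "\<forall>\<^sub>F n in sequentially. (fs n y - fs n z) / (y - z) < a"
      by (rule order_tendstoD)
    moreover have "\<forall>\<^sub>F n in sequentially. X n < z" using X z(1) by (rule order_tendstoD)
    ultimately show "\<forall>\<^sub>F n in sequentially. gs n (X n) < a"
      using evS
    proof eventually_elim
      case (elim n)
      then show ?case using subgradient_slope_bounds(1)[OF sgn[of n] yz z(2)]
          subgradient_mono[OF sgn[of n] _ yz(1), of "X n"] by simp
    qed
  qed
qed

text \<open>Bisection: the difference of the two sides is bounded on \<open>[a, b]\<close> by
  \<open>(g b - g a) (b - a)\<close>, a bound that halves whenever the interval is halved.\<close>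
lemma subgradient_has_integral:
  assumes sg: "subgradient_on S f g" and ab: "a \<le> b" and S: "{a..b} \<subseteq> S"
  shows "(g has_integral (f b - f a)) {a..b}"
proof -
  have int: "g integrable_on {x..y}" if "a \<le> x" "y \<le> b" for x y
    by (rule integrable_on_mono_on, rule mono_onI)
      (use subgradient_mono[OF sg] S that in \<open>auto simp: subset_iff\<close>)
  define D where "D x = integral {a..x} g - f x" for x
  have diff: "D y - D x = integral {x..y} g - (f y - f x)" if "a \<le> x" "x \<le> y" "y \<le> b" for x y
    using Henstock_Kurzweil_Integration.integral_combine[of a x y g] int[of a y] that by (simp add: D_def)
  have bnd: "\<bar>D y - D x\<bar> \<le> (g y - g x) * (y - x)" if "a \<le> x" "x \<le> y" "y \<le> b" for x y
  proof -
    have xy: "x \<in> S" "y \<in> S" using that S by auto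
    have "integral {x..y} (\<lambda>_. g x) \<le> integral {x..y} g"
      by (rule integral_le) (use int that S in \<open>auto intro!: subgradient_mono[OF sg]\<close>)
    moreover have "integral {x..y} g \<le> integral {x..y} (\<lambda>_. g y)"
      by (rule integral_le) (use int that S in \<open>auto intro!: subgradient_mono[OF sg]\<close>)
    ultimately have "g x * (y - x) \<le> integral {x..y} g" "integral {x..y} g \<le> g y * (y - x)"
      using that by (auto simp: mult.commute)
    moreover have "g x * (y - x) \<le> f y - f x" "f y - f x \<le> g y * (y - x)"
      using subgradient_onD[OF sg, of x y] subgradient_onD[OF sg, of y x] xy
      by (auto simp: algebra_simps)
    ultimately show ?thesis unfolding diff[OF that] by (simp add: algebra_simps)
  qed
  have half: "\<bar>D y - D x\<bar> \<le> (g y - g x) * (y - x) / 2 ^ n" if "a \<le> x" "x \<le> y" "y \<le> b" for x y n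
    using that
  proof (induction n arbitrary: x y)
    case (Suc n)
    define m where "m = (x + y) / 2"
    have m: "x \<le> m" "m \<le> y" "m - x = (y - x) / 2" "y - m = (y - x) / 2"
      using Suc by (auto simp: m_def field_simps)
    have "\<bar>D y - D x\<bar> \<le> \<bar>D m - D x\<bar> + \<bar>D y - D m\<bar>" by simp
    also have "\<dots> \<le> (g m - g x) * ((y - x) / 2) / 2 ^ n + (g y - g m) * ((y - x) / 2) / 2 ^ n"
      using Suc.IH[of x m] Suc.IH[of m y] Suc.prems m by simp
    also have "\<dots> = (g y - g x) * (y - x) / 2 ^ Suc n" by (simp add: field_simps)
    finally show ?case .
  qed (use bnd in simp)
  have "(\<lambda>n. (g b - g a) * (b - a) * (1 / 2) ^ n) \<longlonglongrightarrow> (g b - g a) * (b - a) * 0"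
    by (intro tendsto_intros LIMSEQ_power_zero) simp
  then have "\<bar>D b - D a\<bar> \<le> 0"
    using half[OF order_refl ab order_refl]
    by (intro tendsto_lowerbound[of _ 0 sequentially]) (auto simp: power_one_over)
  then have "integral {a..b} g = f b - f a" using diff[of a b] ab by simp
  then show ?thesis using int[of a b] by (metis integrable_integral order_refl)
qed

section \<open>Left-hand derivatives of convex functions\<close>

lemma
  fixes f :: "real \<Rightarrow> real"
  assumes f: "convex_on {a<..} f" and x: "a < x"
  shows left_deriv_tendsto:
      "((\<lambda>t. (f t - f x) / (t - x)) \<longlongrightarrow> left_deriv f x) (at_left x)" (is ?lim)
    and left_deriv_upper: "y > x \<Longrightarrow> left_deriv f x \<le> (f y - f x) / (y - x)"
    and left_deriv_lower: "a < y \<Longrightarrow> y < x \<Longrightarrow> (f y - f x) / (y - x) \<le> left_deriv f x"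
proof -
  let ?s = "\<lambda>t. (f t - f x) / (t - x)"
  have mono: "?s t \<le> ?s u" if "a < t" "u < x" "t \<le> u" for t u
    using convex_on_slope_le(2)[OF f, of t x u] that x by (cases "t = u") auto
  have up: "?s t \<le> (f y - f x) / (y - x)" if "a < t" "t < x" "x < y" for t y
  proof -
    have "(f t - f x) / (t - x) \<le> (f t - f y) / (t - y)" "(f t - f y) / (t - y) \<le> (f x - f y) / (x - y)"
      using convex_on_slope_le[OF f, of t y x] that x by auto
    then show ?thesis by (metis minus_diff_eq minus_divide_divide order_trans)
  qed
  \<comment> \<open>Left difference quotients at \<open>x\<close> are nondecreasing and bounded by
    any slope to the right of \<open>x\<close>, here the one at \<open>x + 1\<close>; hence the
    limit behind \<open>left_deriv\<close> exists.\<close>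
  have "(?s \<longlongrightarrow> Sup (?s ` ({..<x} \<inter> {a<..}))) (at x within ({..<x} \<inter> {a<..}))"
    by (rule Lim_left_bound[where K = "(f (x + 1) - f x) / (x + 1 - x)"])
      (use mono up[of _ "x + 1"] in auto)
  also have "at x within ({..<x} \<inter> {a<..}) = at_left x"
    using x by (intro at_within_nhd[of _ "{a<..}"]) auto
  finally have *: "(?s \<longlongrightarrow> Sup (?s ` ({..<x} \<inter> {a<..}))) (at_left x)" .
  then show lim: ?lim
    unfolding left_deriv_def by (subst tendsto_Lim[OF _ *]) auto
  have ev: "\<forall>\<^sub>F t in at_left x. b < t \<and> t < x" if "b < x" for b
    using eventually_at_left_real[OF that] by simp
  show "left_deriv f x \<le> (f y - f x) / (y - x)" if "y > x" for y
    using ev[OF x] by (intro tendsto_upperbound[OF lim]) (auto elim!: eventually_mono simp: up that)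
  show "(f y - f x) / (y - x) \<le> left_deriv f x" if "a < y" "y < x" for y
    using ev[OF that(2)] by (intro tendsto_lowerbound[OF lim]) (auto elim!: eventually_mono simp: mono that)
qed

lemma left_deriv_subgradient:
  assumes "convex_on {a<..} f"
  shows "subgradient_on {a<..} f (left_deriv f)"
  unfolding subgradient_on_def
proof safe
  fix x y assume "a < x" "a < y"
  consider "y < x" | "y = x" | "x < y" by linarith
  then show "f x + left_deriv f x * (y - x) \<le> f y"
  proof cases
    case 1
    then show ?thesis using left_deriv_lower[OF assms \<open>a < x\<close> \<open>a < y\<close>]
      by (simp add: neg_divide_le_eq)
  next
    case 3
    then show ?thesis using left_deriv_upper[OF assms \<open>a < x\<close>, of y]
      by (simp add: pos_le_divide_eq)
  qed simp
qed

text \<open>From below: a quotient over \<open>[y, x]\<close> that exceeds \<open>b\<close> still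
  exceeds it over \<open>[y, t]\<close> for \<open>t\<close> near \<open>x\<close>, since
  \<open>f\<close> is continuous, and it is a lower bound for \<open>left_deriv f t\<close>. From
  above, monotonicity suffices.\<close>

lemma left_deriv_left_continuous:
  assumes f: "convex_on {a<..} f" and x: "a < x"
  shows "(left_deriv f \<longlongrightarrow> left_deriv f x) (at_left x)"
proof -
  note sg = left_deriv_subgradient[OF f]
  show ?thesis
  proof (rule order_tendstoI)
    fix b assume b: "b < left_deriv f x"
    have "\<forall>\<^sub>F y in at_left x. b < (f y - f x) / (y - x) \<and> y \<in> {a<..<x}"
      using order_tendstoD(1)[OF left_deriv_tendsto[OF f x] b] eventually_at_left_real[OF x]
      by eventually_elim simp
    then obtain y where y: "b < (f y - f x) / (y - x)" "a < y" "y < x"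
      using eventually_happens'[OF trivial_limit_at_left_real] by fastforce
    have "isCont f x"
      using convex_on_continuous[OF _ f] x by (simp add: continuous_on_eq_continuous_at)
    then have "((\<lambda>t. (f y - f t) / (y - t)) \<longlongrightarrow> (f y - f x) / (y - x)) (at_left x)"
      using y by (intro tendsto_intros) (auto simp: isCont_def filterlim_at_split)
    from order_tendstoD(1)[OF this y(1)] eventually_at_left_real[OF y(3)]
    show "\<forall>\<^sub>F t in at_left x. b < left_deriv f t"
    proof eventually_elim
      case (elim t)
      then show ?case using left_deriv_lower[OF f, of t y] y
        by (smt (verit) greaterThanLessThan_iff)
    qed
  next
    fix b assume "left_deriv f x < b"
    then show "\<forall>\<^sub>F t in at_left x. left_deriv f t < b"
      using eventually_at_left_real[OF x]
    proof (elim eventually_mono)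
      fix t assume "t \<in> {a<..<x}" "left_deriv f x < b"
      then show "left_deriv f t < b"
        using subgradient_mono[OF sg, of t x] x by auto
    qed
  qed
qed

text \<open>Existence of the limit is assumed because \<open>Lim\<close> is unspecified for a
  divergent quotient. The lemma carries the sign \<open>(-1) ^ (d - 2)\<close> through
  \<open>left_deriv\<close>.\<close>

lemma left_deriv_cmult:
  assumes "((\<lambda>t. (f t - f x) / (t - x)) \<longlongrightarrow> left_deriv f x) (at_left x)"
  shows "left_deriv (\<lambda>t. c * f t) x = c * left_deriv f x"
proof -
  have "((\<lambda>t. (c * f t - c * f x) / (t - x)) \<longlongrightarrow> c * left_deriv f x) (at_left x)"
    using tendsto_mult_left[OF assms, of c] by (simp add: right_diff_distrib)
  then show ?thesis unfolding left_deriv_def[of "\<lambda>t. c * f t"] by (intro tendsto_Lim) auto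
qed

section \<open>Archimedean generators\<close>

text \<open>Meaningful for \<open>0 < u \<le> 1\<close>, where the pseudo-inverse is finite. An
  infinite value is turned into 0 by \<open>real_of_ereal\<close>, so the point \<open>u = 0\<close>
  has to be kept apart.\<close>

definition rinv :: "(real \<Rightarrow> real) \<Rightarrow> real \<Rightarrow> real" where
  "rinv \<psi> u = real_of_ereal (pseudo_inv \<psi> u)"

text \<open>The case distinction lets one index run through the derivatives and on to the left-hand
  derivative at \<open>d - 1\<close>, so that inductions such as those for \<open>H_bound\<close>
  and \<open>H_pos\<close> reach the last order.\<close>

definition alt_deriv :: "nat \<Rightarrow> (real \<Rightarrow> real) \<Rightarrow> nat \<Rightarrow> real \<Rightarrow> real" where
  "alt_deriv d \<psi> k x =
    (-1) ^ k * (if k < d - 1 then (deriv ^^ k) \<psi> x else left_deriv ((deriv ^^ (d - 2)) \<psi>) x)"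

lemma psi_ext_infty [simp]: "psi_ext \<psi> \<infinity> = 0"
  by (simp add: psi_ext_def)

lemma pseudo_inv_nonneg [simp]: "0 \<le> pseudo_inv \<psi> u"
  unfolding pseudo_inv_def by (rule Inf_greatest) auto

lemma rinv_nonneg [simp]: "0 \<le> rinv \<psi> u"
  by (simp add: rinv_def real_of_ereal_pos)

lemma psi_ext_ereal [simp]: "0 \<le> x \<Longrightarrow> psi_ext \<psi> (ereal x) = \<psi> x"
  by (simp add: psi_ext_def)

locale archimedean =
  fixes \<psi> :: "real \<Rightarrow> real"
  assumes arch: "arch_generator \<psi>"
begin

lemma cont: "continuous_on {0..} \<psi>"
  and at_top: "(\<psi> \<longlongrightarrow> 0) at_top"
  and psi_0 [simp]: "\<psi> 0 = 1"
  using arch by (auto simp: arch_generator_def)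

lemma nonneg: "0 \<le> x \<Longrightarrow> 0 \<le> \<psi> x" and le_1: "0 \<le> x \<Longrightarrow> \<psi> x \<le> 1"
  using arch by (auto simp: arch_generator_def)

lemma antimono: "0 \<le> x \<Longrightarrow> x \<le> y \<Longrightarrow> \<psi> y \<le> \<psi> x"
  using arch by (auto simp: arch_generator_def monotone_on_def)

text \<open>If \<open>\<psi> y\<close> is not zero, every zero lies beyond \<open>y\<close> by
  monotonicity, so \<open>y\<close> is below \<open>gen_zero\<close>. This trades the extended-real
  side condition for positivity of \<open>\<psi> x\<close>.\<close>

lemma strict:
  assumes "0 \<le> x" "x < y" "0 < \<psi> x"
  shows "\<psi> y < \<psi> x"
proof (cases "\<psi> y = 0")
  case False
  have "ereal y \<le> gen_zero \<psi>"
    unfolding gen_zero_def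
  proof (rule Inf_greatest, safe)
    fix z assume "0 \<le> z" "\<psi> z = 0"
    then show "ereal y \<le> ereal z"
      using antimono[of z y] nonneg[of y] False assms by force
  qed
  then show ?thesis using arch assms by (auto simp: arch_generator_def)
qed (use assms in auto)

lemma psi_ext_bounds: "0 \<le> psi_ext \<psi> z" "psi_ext \<psi> z \<le> 1"
  by (cases z; auto simp: psi_ext_def nonneg le_1)+

lemma psi_ext_antimono: "0 \<le> x \<Longrightarrow> x \<le> y \<Longrightarrow> psi_ext \<psi> y \<le> psi_ext \<psi> x"
  by (cases x; cases y) (auto simp: nonneg antimono)

lemma psi_surj:
  assumes "0 < u" "u \<le> 1"
  obtains z where "0 \<le> z" "\<psi> z = u"
proof -
  have "\<forall>\<^sub>F x in at_top. \<psi> x < u \<and> 0 \<le> x"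
    using order_tendstoD(2)[OF at_top assms(1)] eventually_ge_at_top[of 0] by eventually_elim auto
  then obtain B where "\<psi> B < u" "0 \<le> B"
    using eventually_happens'[OF trivial_limit_at_top_linorder] by blast
  then have "\<exists>x\<ge>0. x \<le> B \<and> \<psi> x = u"
    using assms by (intro IVT2') (auto intro: continuous_on_subset[OF cont])
  then show ?thesis using that by blast
qed

lemma pseudo_inv_eq:
  assumes "0 \<le> z" "0 < \<psi> z"
  shows "pseudo_inv \<psi> (\<psi> z) = ereal z"
proof -
  have "x = ereal z" if "0 \<le> x" "psi_ext \<psi> x = \<psi> z" for x
  proof (cases x)
    case (real r)
    then show ?thesis using that assms strict[of r z] strict[of z r] by force
  qed (use that assms in auto)
  then have "{x. 0 \<le> x \<and> psi_ext \<psi> x = \<psi> z} = {ereal z}"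
    using assms by auto
  then show ?thesis by (simp add: pseudo_inv_def)
qed

lemma
  assumes "0 < u" "u \<le> 1"
  shows ereal_rinv: "pseudo_inv \<psi> u = ereal (rinv \<psi> u)"
    and psi_rinv: "\<psi> (rinv \<psi> u) = u"
proof -
  obtain z where z: "0 \<le> z" "\<psi> z = u" using psi_surj[OF assms] .
  then have "pseudo_inv \<psi> u = ereal z" using pseudo_inv_eq[of z] assms by simp
  then show "pseudo_inv \<psi> u = ereal (rinv \<psi> u)" "\<psi> (rinv \<psi> u) = u"
    using z by (auto simp: rinv_def)
qed

lemma rinv_psi: "0 \<le> z \<Longrightarrow> 0 < \<psi> z \<Longrightarrow> rinv \<psi> (\<psi> z) = z"
  by (simp add: rinv_def pseudo_inv_eq)

lemma rinv_1 [simp]: "rinv \<psi> 1 = 0" and pseudo_inv_1 [simp]: "pseudo_inv \<psi> 1 = 0"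
  using rinv_psi[of 0] pseudo_inv_eq[of 0] by (auto simp: zero_ereal_def)

text \<open>The content is that the infimum of the zeros is attained. Otherwise some
  \<open>z\<close> at or beyond it would have a positive value.\<close>

lemma pseudo_inv_0_le:
  assumes "0 \<le> z"
  shows "pseudo_inv \<psi> 0 \<le> z \<longleftrightarrow> psi_ext \<psi> z = 0"
proof
  assume "psi_ext \<psi> z = 0"
  then show "pseudo_inv \<psi> 0 \<le> z"
    unfolding pseudo_inv_def using assms by (intro Inf_lower) auto
next
  assume le: "pseudo_inv \<psi> 0 \<le> z"
  show "psi_ext \<psi> z = 0"
  proof (rule ccontr)
    assume nz: "psi_ext \<psi> z \<noteq> 0"
    then obtain r where r: "z = ereal r" "0 \<le> r" "0 < \<psi> r"
      using assms nonneg by (cases z) force+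
    \<comment> \<open>Half of the value is still positive, so \<open>s\<close> lies strictly beyond
      \<open>r\<close> and below every zero.\<close>
    obtain s where s: "0 \<le> s" "\<psi> s = \<psi> r / 2"
      using psi_surj[of "\<psi> r / 2"] r le_1[of r] by auto
    then have "r < s" using antimono[of s r] r by (cases "s \<le> r") auto
    have "ereal s \<le> pseudo_inv \<psi> 0"
      unfolding pseudo_inv_def
    proof (rule Inf_greatest, safe)
      fix x assume x: "0 \<le> x" "psi_ext \<psi> x = 0"
      show "ereal s \<le> x"
      proof (rule ccontr)
        assume "\<not> ereal s \<le> x"
        then have "psi_ext \<psi> (ereal s) \<le> psi_ext \<psi> x"
          using x by (intro psi_ext_antimono) auto
        then show False using x s r by simp
      qed
    qed
    then have "ereal s \<le> ereal r" using le r order_trans by blast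
    then show False using \<open>r < s\<close> by simp
  qed
qed

lemma pseudo_inv_le_iff:
  assumes "0 \<le> u" "u \<le> 1" "0 \<le> z"
  shows "pseudo_inv \<psi> u \<le> z \<longleftrightarrow> psi_ext \<psi> z \<le> u"
proof (cases "u = 0")
  case True
  then show ?thesis using pseudo_inv_0_le[OF assms(3)] psi_ext_bounds[of z] by auto
next
  case False
  then have u: "pseudo_inv \<psi> u = ereal (rinv \<psi> u)" "\<psi> (rinv \<psi> u) = u"
    using ereal_rinv psi_rinv assms by auto
  show ?thesis
  proof (cases z)
    case (real r)
    then have r: "0 \<le> r" using assms by simp
    have "\<psi> r \<le> u" if "rinv \<psi> u \<le> r" using antimono[OF _ that] u by simp
    moreover have "u < \<psi> r" if "r < rinv \<psi> u"
      using antimono[OF r less_imp_le[OF that]] strict[OF r that] u assms False by force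
    ultimately show ?thesis using u real r by force
  qed (use u assms in auto)
qed

lemma less_pseudo_inv_iff:
  assumes "0 \<le> u" "u \<le> 1" "0 \<le> z"
  shows "z < pseudo_inv \<psi> u \<longleftrightarrow> u < psi_ext \<psi> z"
  using pseudo_inv_le_iff[OF assms] by auto

lemma psi_ext_pseudo_inv:
  assumes "0 \<le> u" "u \<le> 1"
  shows "psi_ext \<psi> (pseudo_inv \<psi> u) = u"
proof (cases "u = 0")
  case True
  then show ?thesis using pseudo_inv_0_le[of "pseudo_inv \<psi> 0"] by auto
qed (use assms ereal_rinv psi_rinv in auto)

text \<open>Beyond a finite zero of the generator the round trip through \<open>pseudo_inv\<close>
  may return a point smaller than \<open>z\<close>, but then both sides are 0. This allows a copula
  value to be inserted again as an argument of the copula.\<close>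

lemma psi_ext_inv_add:
  assumes "0 \<le> z" "0 \<le> t"
  shows "psi_ext \<psi> (pseudo_inv \<psi> (psi_ext \<psi> z) + t) = psi_ext \<psi> (z + t)"
proof (cases "psi_ext \<psi> z = 0")
  case True
  have "z \<le> z + t" using add_left_mono[OF assms(2), of z] by simp
  then have "psi_ext \<psi> (z + t) = 0"
    using psi_ext_antimono[of z "z + t"] psi_ext_bounds[of "z + t"] assms True by simp
  have "pseudo_inv \<psi> 0 \<le> pseudo_inv \<psi> 0 + t"
    using add_left_mono[OF assms(2), of "pseudo_inv \<psi> 0"] by simp
  then have "psi_ext \<psi> (pseudo_inv \<psi> 0 + t) = 0"
    using pseudo_inv_0_le[of "pseudo_inv \<psi> 0 + t"] assms by simp
  with \<open>psi_ext \<psi> (z + t) = 0\<close> True show ?thesis by simp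
next
  case False
  then obtain r where r: "z = ereal r" "0 \<le> r"
    using assms by (cases z) auto
  then show ?thesis using False pseudo_inv_eq[of r] nonneg[of r] by simp
qed

lemma rinv_pos_iff: "0 < u \<Longrightarrow> u \<le> 1 \<Longrightarrow> 0 < rinv \<psi> u \<longleftrightarrow> u < 1"
  using psi_rinv[of u] strict[of 0 "rinv \<psi> u"] rinv_nonneg[of \<psi> u]
  by (cases "rinv \<psi> u = 0") (auto simp: less_le)

lemma rinv_less_iff:
  assumes "0 < u" "u \<le> 1" "0 \<le> z"
  shows "rinv \<psi> u < z \<longleftrightarrow> \<psi> z < u"
  using psi_rinv[OF assms(1,2)] antimono[OF assms(3), of "rinv \<psi> u"]
    strict[of "rinv \<psi> u" z] rinv_nonneg[of \<psi> u] assms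
  by (cases "rinv \<psi> u < z") auto

lemma less_rinv_iff: "0 < u \<Longrightarrow> u \<le> 1 \<Longrightarrow> 0 \<le> z \<Longrightarrow> z < rinv \<psi> u \<longleftrightarrow> u < \<psi> z"
  using less_pseudo_inv_iff[of u "ereal z"] ereal_rinv[of u] by simp

lemma rinv_strict_antimono: "0 < u \<Longrightarrow> u < v \<Longrightarrow> v \<le> 1 \<Longrightarrow> rinv \<psi> v < rinv \<psi> u"
  by (subst rinv_less_iff) (auto simp: psi_rinv)

lemma rinv_antimono: "0 < u \<Longrightarrow> u \<le> v \<Longrightarrow> v \<le> 1 \<Longrightarrow> rinv \<psi> v \<le> rinv \<psi> u"
  using rinv_strict_antimono[of u v] by (cases "u = v") auto

lemma isCont_psi: "0 < x \<Longrightarrow> isCont \<psi> x"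
  using cont continuous_on_interior by fastforce

lemma isCont_rinv:
  assumes "0 < u" "u < 1"
  shows "isCont (rinv \<psi>) u"
  unfolding isCont_def
proof (rule order_tendstoI)
  have near: "\<forall>\<^sub>F v in at u. 0 < v \<and> v < 1"
    using assms by (intro order_tendstoD(1)[OF tendsto_ident_at] order_tendstoD(2)[OF tendsto_ident_at]
        eventually_conj)
  fix a assume a: "a < rinv \<psi> u"
  then have "a < 0 \<or> 0 \<le> a \<and> u < \<psi> a" using less_rinv_iff assms by fastforce
  moreover have "\<forall>\<^sub>F v in at u. v < \<psi> a" if "u < \<psi> a"
    using order_tendstoD(2)[OF tendsto_ident_at that] .
  ultimately show "\<forall>\<^sub>F v in at u. a < rinv \<psi> v"
  proof (elim disjE conjE)
    assume "a < 0"
    then show ?thesis by (intro always_eventually) (auto intro: less_le_trans)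
  next
    assume "0 \<le> a" "u < \<psi> a" "u < \<psi> a \<Longrightarrow> \<forall>\<^sub>F v in at u. v < \<psi> a"
    then have "\<forall>\<^sub>F v in at u. v < \<psi> a" by simp
    with near show ?thesis
      by eventually_elim (simp add: less_rinv_iff \<open>0 \<le> a\<close>)
  qed
next
  have near: "\<forall>\<^sub>F v in at u. 0 < v \<and> v < 1"
    using assms by (intro order_tendstoD(1)[OF tendsto_ident_at] order_tendstoD(2)[OF tendsto_ident_at]
        eventually_conj)
  fix a assume a: "rinv \<psi> u < a"
  then have a0: "0 \<le> a" using rinv_nonneg[of \<psi> u] by linarith
  then have "\<psi> a < u" using a rinv_less_iff assms by auto
  then have "\<forall>\<^sub>F v in at u. \<psi> a < v"
    using order_tendstoD(1)[OF tendsto_ident_at] by blast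
  with near show "\<forall>\<^sub>F v in at u. rinv \<psi> v < a"
    by eventually_elim (simp add: rinv_less_iff a0)
qed

end

section \<open>Sign, convexity and decay of the derivatives of a d-monotone generator\<close>

locale ar_gen =
  fixes d :: nat and \<psi> :: "real \<Rightarrow> real"
  assumes d3: "3 \<le> d" and gen: "ar_generator d \<psi>"

sublocale ar_gen \<subseteq> archimedean
  using gen by unfold_locales (simp add: ar_generator_def)

context ar_gen
begin

abbreviation H :: "nat \<Rightarrow> real \<Rightarrow> real" where
  "H \<equiv> alt_deriv d \<psi>"

lemma psi_1: "\<psi> 1 = 1 / 2" and dmono: "d_monotone d \<psi>"
  using gen by (auto simp: ar_generator_def)

lemma H_0 [simp]: "H 0 = \<psi>"
  using d3 by (auto simp: alt_deriv_def)

lemma H_DERIV: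
  assumes "k < d - 2" "0 < x"
  shows "(H k has_real_derivative - H (Suc k) x) (at x)"
proof -
  have "((deriv ^^ k) \<psi> has_real_derivative (deriv ^^ Suc k) \<psi> x) (at x)"
    using dmono assms by (auto simp: d_monotone_def)
  from DERIV_cmult[OF this, of "(-1) ^ k"]
  have "((\<lambda>x. (-1) ^ k * (deriv ^^ k) \<psi> x) has_real_derivative - H (Suc k) x) (at x)"
    using assms d3 by (simp add: alt_deriv_def less_diff_conv)
  moreover have "H k = (\<lambda>x. (-1) ^ k * (deriv ^^ k) \<psi> x)"
    using assms by (auto simp: alt_deriv_def fun_eq_iff)
  ultimately show ?thesis by simp
qed

lemma H_top: "H (d - 2) = (\<lambda>x. (-1) ^ (d - 2) * (deriv ^^ (d - 2)) \<psi> x)"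
  using d3 by (auto simp: alt_deriv_def fun_eq_iff)

lemma H_top_nonneg: "0 < x \<Longrightarrow> 0 \<le> H (d - 2) x"
  and H_top_antimono: "antimono_on {0<..} (H (d - 2))"
  and H_top_convex: "convex_on {0<..} (H (d - 2))"
  using dmono unfolding H_top by (auto simp: d_monotone_def)

lemma H_last:
  assumes "0 < x"
  shows "H (d - 1) x = - left_deriv (H (d - 2)) x"
proof -
  have "(deriv ^^ (d - 2)) \<psi> = (\<lambda>x. (-1) ^ (d - 2) * H (d - 2) x)"
    unfolding H_top by (simp add: fun_eq_iff)
  then have "left_deriv ((deriv ^^ (d - 2)) \<psi>) x = (-1) ^ (d - 2) * left_deriv (H (d - 2)) x"
    using left_deriv_cmult[OF left_deriv_tendsto[OF H_top_convex assms]] by metis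
  moreover have "d - 1 = Suc (d - 2)" using d3 by simp
  ultimately show ?thesis
    by (simp add: alt_deriv_def[of d \<psi> "Suc (d - 2)"])
qed

text \<open>If \<open>H (Suc k)\<close> stays above \<open>c > 0\<close> near infinity, integration
  drives \<open>H k\<close> to minus infinity, and with reversed signs to plus infinity. Descending
  to the bounded \<open>\<psi>\<close> excludes both; they are stated jointly because each step
  flips the sign.\<close>

lemma H_not_bounded_away:
  assumes "k \<le> d - 2" "0 < c"
  shows "\<not> (\<forall>\<^sub>F x in at_top. c \<le> H k x) \<and> \<not> (\<forall>\<^sub>F x in at_top. H k x \<le> - c)"
  using assms
proof (induction k arbitrary: c)
  case 0
  have small: "\<forall>\<^sub>F x in at_top. \<bar>\<psi> x\<bar> < c"
    using tendstoD[OF at_top 0(2)] by (simp add: dist_norm)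
  show ?case
  proof (intro conjI notI)
    assume "\<forall>\<^sub>F x in at_top. c \<le> H 0 x"
    with small have "\<forall>\<^sub>F x::real in at_top. False" by eventually_elim auto
    then show False by simp
  next
    assume "\<forall>\<^sub>F x in at_top. H 0 x \<le> - c"
    with small have "\<forall>\<^sub>F x::real in at_top. False" by eventually_elim auto
    then show False by simp
  qed
next
  case (Suc k)
  have k: "k < d - 2" using Suc by simp
  \<comment> \<open>Used with \<open>\<sigma>\<close> equal to 1 and to -1, so that one computation
    serves both signs.\<close>
  have *: "\<forall>\<^sub>F x in at_top. \<sigma> * H k x \<le> - 1"
    if ev: "\<forall>\<^sub>F x in at_top. c \<le> \<sigma> * H (Suc k) x" for \<sigma> :: real
  proof -
    obtain B where B: "0 < B" "\<And>x. B \<le> x \<Longrightarrow> c \<le> \<sigma> * H (Suc k) x"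
    proof -
      from ev obtain B where "\<forall>x\<ge>B. c \<le> \<sigma> * H (Suc k) x"
        by (auto simp: eventually_at_top_linorder)
      then show ?thesis using that[of "max B 1"] by simp
    qed
    have le: "\<sigma> * H k x + c * x \<le> \<sigma> * H k B + c * B" if "B \<le> x" for x
    proof (rule DERIV_nonpos_imp_nonincreasing[OF that])
      fix y assume y: "B \<le> y" "y \<le> x"
      have "((\<lambda>x. \<sigma> * H k x + c * x) has_real_derivative \<sigma> * (- H (Suc k) y) + c) (at y)"
        using H_DERIV[OF k, of y] B y by (auto intro!: derivative_eq_intros)
      then show "\<exists>z. ((\<lambda>x. \<sigma> * H k x + c * x) has_real_derivative z) (at y) \<and> z \<le> 0"
        using B(2)[OF y(1)] by (intro exI conjI) auto
    qed
    have "\<forall>\<^sub>F x in at_top. B \<le> x \<and> (\<sigma> * H k B + c * B + 1) / c \<le> x"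
      by (intro eventually_conj eventually_ge_at_top)
    then show ?thesis
      by eventually_elim (use le Suc.prems in \<open>force simp: pos_divide_le_eq mult.commute\<close>)
  qed
  show ?case
  proof (intro conjI notI)
    assume "\<forall>\<^sub>F x in at_top. c \<le> H (Suc k) x"
    then have "\<forall>\<^sub>F x in at_top. H k x \<le> - 1" using *[of 1] by simp
    then show False using Suc.IH[of 1] k by simp
  next
    assume "\<forall>\<^sub>F x in at_top. H (Suc k) x \<le> - c"
    then have "\<forall>\<^sub>F x in at_top. c \<le> (-1) * H (Suc k) x" by eventually_elim simp
    from *[OF this] have "\<forall>\<^sub>F x in at_top. 1 \<le> H k x" by eventually_elim simp
    then show False using Suc.IH[of 1] k by simp
  qed
qed

lemma H_antimono_aux:
  assumes "k < d - 2" "\<And>x. 0 < x \<Longrightarrow> 0 \<le> H (Suc k) x" "0 < x" "x \<le> y"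
  shows "H k y \<le> H k x"
  by (rule DERIV_nonpos_imp_nonincreasing[OF assms(4)])
    (metis H_DERIV assms(1-3) less_le_trans neg_le_0_iff_le)

text \<open>\<open>d_monotone\<close> prescribes the sign at order \<open>d - 2\<close> only. Going
  down, \<open>H (Suc k) \<ge> 0\<close> makes \<open>H k\<close> nonincreasing, so a negative value
  would persist up to infinity, contrary to \<open>H_not_bounded_away\<close>.\<close>

lemma H_nonneg_aux:
  assumes "k \<le> d - 2"
  shows "\<forall>x>0. 0 \<le> H k x"
  using assms
proof (induction k rule: inc_induct)
  case base
  then show ?case using H_top_nonneg by simp
next
  case (step k)
  show ?case
  proof (intro allI impI, rule ccontr)
    fix x :: real assume x: "0 < x" "\<not> 0 \<le> H k x"
    have "\<forall>\<^sub>F y in at_top. H k y \<le> - (- H k x)"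
      using eventually_ge_at_top[of x]
      by eventually_elim (use H_antimono_aux[of k x] step x in auto)
    then show False using H_not_bounded_away[of k "- H k x"] step x by auto
  qed
qed

lemma H_antimono:
  assumes "k \<le> d - 1" "0 < x" "x \<le> y"
  shows "H k y \<le> H k x"
proof -
  consider "k < d - 2" | "k = d - 2" | "k = d - 1" using assms by linarith
  then show ?thesis
  proof cases
    case 1
    then show ?thesis using H_antimono_aux H_nonneg_aux assms by simp
  next
    case 2
    then show ?thesis using H_top_antimono assms by (auto simp: monotone_on_def)
  next
    case 3
    then show ?thesis
      using subgradient_mono[OF left_deriv_subgradient[OF H_top_convex], of x y] assms
      by (simp add: H_last[unfolded One_nat_def])
  qed
qed

lemma H_nonneg:
  assumes "k \<le> d - 1" "0 < x"
  shows "0 \<le> H k x"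
proof (cases "k = d - 1")
  case True
  have "left_deriv (H (d - 2)) x \<le> (H (d - 2) (x + 1) - H (d - 2) x) / (x + 1 - x)"
    using left_deriv_upper[OF H_top_convex assms(2), of "x + 1"] by simp
  also have "\<dots> \<le> 0" using H_antimono[of "d - 2" x "x + 1"] assms by simp
  finally show ?thesis using True assms by (simp add: H_last[unfolded One_nat_def])
next
  case False
  then show ?thesis using H_nonneg_aux[of k] assms by simp
qed

text \<open>For \<open>k < d - 2\<close> the function is convex because its derivative
  \<open>- H (Suc k)\<close> is nondecreasing, and the subgradient is its tangent; at
  \<open>k = d - 2\<close> convexity is given and the left derivative takes over.\<close>

lemma H_subgradient:
  assumes "k < d - 1"
  shows "subgradient_on {0<..} (H k) (\<lambda>x. - H (Suc k) x)"
proof (cases "k = d - 2")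
  case True
  have "Suc (d - 2) = d - 1" using d3 by simp
  then show ?thesis using left_deriv_subgradient[OF H_top_convex] True
    by (simp add: subgradient_on_def H_last[unfolded One_nat_def])
next
  case False
  then have k: "k < d - 2" using assms by simp
  have cvx: "convex_on {0<..} (H k)"
    by (rule convex_on_realI[where f' = "\<lambda>x. - H (Suc k) x"])
      (use k in \<open>auto intro!: H_DERIV H_antimono\<close>)
  show ?thesis
    unfolding subgradient_on_def
  proof safe
    fix x y :: real assume xy: "0 < x" "0 < y"
    show "H k x + - H (Suc k) x * (y - x) \<le> H k y"
      using convex_on_imp_above_tangent[OF cvx, of x y "- H (Suc k) x"] H_DERIV[OF k xy(1)] xy
      by (auto simp: has_field_derivative_at_within interior_open)
  qed
qed

lemma H_isCont:
  assumes "k < d - 1" "0 < x"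
  shows "isCont (H k) x"
proof (cases "k = d - 2")
  case True
  then show ?thesis
    using convex_on_continuous[OF _ H_top_convex] assms by (simp add: continuous_on_eq_continuous_at)
next
  case False
  then show ?thesis using H_DERIV[of k x] DERIV_isCont assms by force
qed

lemma H_left_continuous:
  assumes "0 < x"
  shows "(H (d - 1) \<longlongrightarrow> H (d - 1) x) (at_left x)"
proof -
  have "((\<lambda>x. - left_deriv (H (d - 2)) x) \<longlongrightarrow> - left_deriv (H (d - 2)) x) (at_left x)"
    by (intro tendsto_minus left_deriv_left_continuous[OF H_top_convex assms])
  moreover have "\<forall>\<^sub>F y in at_left x. - left_deriv (H (d - 2)) y = H (d - 1) y"
    using eventually_at_left_real[OF assms] by eventually_elim (simp add: H_last[unfolded One_nat_def])
  ultimately show ?thesis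
    using assms by (simp add: H_last[unfolded One_nat_def] tendsto_cong)
qed

text \<open>Comparing the points \<open>s + t\<close> and \<open>s / 2 + t\<close> in the
  subgradient inequality bounds \<open>H (Suc k) (s + t)\<close> by \<open>2 / s\<close> times
  \<open>H k (s / 2 + t)\<close>; each order thus costs half of the distance \<open>s\<close> to 0.
  All orders therefore vanish wherever \<open>\<psi>\<close> does, in the limit or past a finite
  zero.\<close>

lemma H_bound:
  assumes "k \<le> d - 1" "0 < s"
  shows "\<exists>C. \<forall>t\<ge>0. H k (s + t) \<le> C * \<psi> t"
  using assms
proof (induction k arbitrary: s)
  case 0
  then show ?case using antimono by (intro exI[of _ 1]) simp
next
  case (Suc k)
  then have "\<exists>C. \<forall>t\<ge>0. H k (s / 2 + t) \<le> C * \<psi> t" by simp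
  then obtain C where C: "\<forall>t\<ge>0. H k (s / 2 + t) \<le> C * \<psi> t" by (rule exE)
  have "H (Suc k) (s + t) \<le> (2 * C / s) * \<psi> t" if "t \<ge> 0" for t
  proof -
    have "H k (s + t) + - H (Suc k) (s + t) * (s / 2 + t - (s + t)) \<le> H k (s / 2 + t)"
      by (rule subgradient_onD[OF H_subgradient]) (use Suc.prems that in auto)
    moreover have "0 \<le> H k (s + t)" using Suc.prems that by (intro H_nonneg) auto
    ultimately have "H (Suc k) (s + t) * (s / 2) \<le> C * \<psi> t"
      using C[rule_format, OF that] by (simp add: algebra_simps)
    then show ?thesis using \<open>0 < s\<close> by (simp add: pos_le_divide_eq mult.commute mult.left_commute)
  qed
  then show ?case by blast
qed

lemma H_tendsto_0:
  assumes "k \<le> d - 1" "0 < s"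
    and X: "\<forall>\<^sub>F x in F. 0 \<le> X x" "((\<lambda>x. \<psi> (X x)) \<longlongrightarrow> 0) F"
  shows "((\<lambda>x. H k (s + X x)) \<longlongrightarrow> 0) F"
proof -
  obtain C where C: "\<forall>t\<ge>0. H k (s + t) \<le> C * \<psi> t"
    using H_bound[OF assms(1,2)] by (rule exE)
  have lim: "((\<lambda>x. C * \<psi> (X x)) \<longlongrightarrow> 0) F" using tendsto_mult_left[OF X(2), of C] by simp
  show ?thesis
  proof (rule tendsto_sandwich[OF _ _ tendsto_const lim])
    show "\<forall>\<^sub>F x in F. 0 \<le> H k (s + X x)"
      using X(1) by eventually_elim (rule H_nonneg[OF assms(1)], use assms(2) in simp)
    show "\<forall>\<^sub>F x in F. H k (s + X x) \<le> C * \<psi> (X x)"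
      using X(1) by eventually_elim (use C in simp)
  qed
qed

text \<open>\<open>H_bound\<close> with shift \<open>x - z\<close> and \<open>t = z\<close>. The
  inequality \<open>z < x\<close> must be strict: at the zero itself the left-hand derivative may be
  nonzero.\<close>

lemma H_eq_0:
  assumes "k \<le> d - 1" "0 \<le> z" "\<psi> z = 0" "z < x"
  shows "H k x = 0"
proof -
  have "\<exists>C. \<forall>t\<ge>0. H k (x - z + t) \<le> C * \<psi> t" by (rule H_bound) (use assms in auto)
  then obtain C where "\<forall>t\<ge>0. H k (x - z + t) \<le> C * \<psi> t" by (rule exE)
  from this[rule_format, of z] show ?thesis using assms H_nonneg[of k x] by simp
qed

text \<open>If \<open>H (Suc k) x\<close> were 0, the supporting line of \<open>H k\<close> at
  \<open>x\<close> would be horizontal; as \<open>H k\<close> tends to 0 at infinity,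
  \<open>H k x\<close> could not be positive.\<close>

lemma H_pos:
  assumes "k \<le> d - 1" "0 < x" "0 < \<psi> x"
  shows "0 < H k x"
  using assms
proof (induction k)
  case (Suc k)
  show ?case
  proof (rule ccontr)
    assume "\<not> 0 < H (Suc k) x"
    then have z: "H (Suc k) x = 0" using H_nonneg[of "Suc k" x] Suc.prems by linarith
    have "H k x \<le> H k (x + t)" if "t \<ge> 0" for t
      using subgradient_onD[OF H_subgradient, of k x "x + t"] z Suc.prems that by simp
    then have "H k x \<le> 0"
      using at_top Suc.prems
      by (intro tendsto_lowerbound[OF H_tendsto_0[of k x "\<lambda>t. t" at_top]])
        (auto simp: eventually_ge_at_top intro: eventually_mono[OF eventually_ge_at_top[of 0]])
    then show False using Suc by simp
  qed
qed simp

section \<open>Lipschitz continuity of the copula in each coordinate\<close>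

lemma psi_add_diff_le:
  assumes "0 \<le> a" "0 \<le> x" "x \<le> y"
  shows "\<psi> (a + x) - \<psi> (a + y) \<le> \<psi> x - \<psi> y"
proof -
  have "\<psi> (a + x) - \<psi> x \<le> \<psi> (a + y) - \<psi> y"
  \<comment> \<open>Convexity: the derivative is \<open>H 1 z - H 1 (a + z) \<ge> 0\<close>. The
    rule for open intervals is used because \<open>x\<close> may be 0, where \<open>\<psi>\<close>
    is only known to be continuous.\<close>
  proof (rule DERIV_nonneg_imp_increasing_open[OF assms(3)])
    fix z assume z: "x < z" "z < y"
    have D: "(\<psi> has_real_derivative - H 1 w) (at w)" if "0 < w" for w
      using H_DERIV[of 0 w] that d3 by simp
    have "((\<lambda>z. \<psi> (a + z) - \<psi> z) has_real_derivative - H 1 (a + z) * 1 - - H 1 z) (at z)"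
      by (rule DERIV_diff, rule DERIV_chain'[where f = "\<lambda>z. a + z"])
        (use z assms D in \<open>auto intro!: derivative_eq_intros\<close>)
    moreover have "H 1 (a + z) \<le> H 1 z" using z assms d3 by (intro H_antimono) auto
    ultimately show "\<exists>w. ((\<lambda>z. \<psi> (a + z) - \<psi> z) has_real_derivative w) (at z) \<and> 0 \<le> w"
      by (intro exI conjI) auto
  next
    show "continuous_on {x..y} (\<lambda>x. \<psi> (a + x) - \<psi> x)"
      using assms by (intro continuous_intros continuous_on_compose2[OF cont]) auto
  qed
  then show ?thesis by simp
qed

text \<open>With \<open>x\<close> and \<open>y\<close> the pseudo-inverses of \<open>u\<close> and
  \<open>v\<close>, the right-hand side is the distance of \<open>u\<close> and \<open>v\<close>: a
  copula is 1-Lipschitz in one coordinate.\<close>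

lemma psi_ext_contraction:
  assumes "0 \<le> a" "0 \<le> x" "0 \<le> y"
  shows "\<bar>psi_ext \<psi> (a + x) - psi_ext \<psi> (a + y)\<bar> \<le> \<bar>psi_ext \<psi> x - psi_ext \<psi> y\<bar>"
proof -
  have *: "\<bar>psi_ext \<psi> (a + x) - psi_ext \<psi> (a + y)\<bar> \<le> \<bar>psi_ext \<psi> x - psi_ext \<psi> y\<bar>"
    if "0 \<le> x" "x \<le> y" for x y
  proof -
    have "psi_ext \<psi> (a + x) - psi_ext \<psi> (a + y) \<le> psi_ext \<psi> x - psi_ext \<psi> y"
    proof (cases a)
      case (real r)
      have r: "0 \<le> r" using real assms by simp
      show ?thesis
      proof (cases x)
        case (real s)
        then have s: "0 \<le> s" using that by simp
        show ?thesis
        proof (cases y)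
          case (real t)
          then show ?thesis using \<open>a = ereal r\<close> \<open>x = ereal s\<close> r s that
            by (simp add: psi_add_diff_le)
        qed (use that \<open>a = ereal r\<close> \<open>x = ereal s\<close> r s antimono[of s "r + s"] in auto)
      qed (use that \<open>a = ereal r\<close> in auto)
    qed (use assms that psi_ext_antimono[of x y] in auto)
    moreover have "psi_ext \<psi> (a + y) \<le> psi_ext \<psi> (a + x)" "psi_ext \<psi> y \<le> psi_ext \<psi> x"
      using that assms by (auto intro!: psi_ext_antimono add_left_mono)
    ultimately show ?thesis by simp
  qed
  show ?thesis
    using *[of x y] *[of y x] assms by (cases "x \<le> y") (auto simp: abs_minus_commute)
qed

end

context ar_gen
begin

text \<open>Coordinates are exchanged one at a time; the free offset \<open>a\<close> absorbs those
  that are not being exchanged.\<close>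

lemma psi_ext_sum_lipschitz:
  assumes "finite I" "0 \<le> a" "\<And>i. i \<in> I \<Longrightarrow> 0 \<le> x i" "\<And>i. i \<in> I \<Longrightarrow> 0 \<le> y i"
  shows "\<bar>psi_ext \<psi> (a + (\<Sum>i\<in>I. x i)) - psi_ext \<psi> (a + (\<Sum>i\<in>I. y i))\<bar>
    \<le> (\<Sum>i\<in>I. \<bar>psi_ext \<psi> (x i) - psi_ext \<psi> (y i)\<bar>)"
  using assms
proof (induction I arbitrary: a)
  case (insert j I)
  let ?X = "\<Sum>i\<in>I. x i" and ?Y = "\<Sum>i\<in>I. y i"
  have "\<bar>psi_ext \<psi> (a + x j + ?X) - psi_ext \<psi> (a + x j + ?Y)\<bar>
      \<le> (\<Sum>i\<in>I. \<bar>psi_ext \<psi> (x i) - psi_ext \<psi> (y i)\<bar>)"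
    using insert by (intro insert.IH) auto
  moreover have "\<bar>psi_ext \<psi> (a + ?Y + x j) - psi_ext \<psi> (a + ?Y + y j)\<bar> \<le> \<bar>psi_ext \<psi> (x j) - psi_ext \<psi> (y j)\<bar>"
    using insert.prems by (intro psi_ext_contraction add_nonneg_nonneg sum_nonneg) auto
  moreover have "a + x j + ?Y = a + ?Y + x j" "a + (y j + ?Y) = a + ?Y + y j" "a + (x j + ?X) = a + x j + ?X"
    by (simp_all add: ac_simps)
  ultimately show ?case using insert.hyps by simp
qed simp

end

section \<open>Convergence of generators\<close>

locale ar_seq = lim: ar_gen d \<psi> for d \<psi> +
  fixes \<psi>s :: "nat \<Rightarrow> real \<Rightarrow> real"
  assumes gens: "\<And>n. ar_generator d (\<psi>s n)"

sublocale ar_seq \<subseteq> seq: ar_gen d "\<psi>s n" for n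
  using gens lim.d3 by unfold_locales auto

section \<open>From copulas to pseudo-inverses\<close>

context ar_seq
begin

text \<open>The value for \<open>Suc k\<close> is the bivariate copula at the value for
  \<open>k\<close> and \<open>w\<close>. Its first argument depends on \<open>n\<close>; the
  contraction property replaces it by the limit, after which \<open>pair\<close> applies.\<close>

lemma iterate_tendsto:
  assumes pair: "\<And>u v. u \<in> {0..1} \<Longrightarrow> v \<in> {0..1} \<Longrightarrow>
      (\<lambda>n. psi_ext (\<psi>s n) (pseudo_inv (\<psi>s n) u + pseudo_inv (\<psi>s n) v))
        \<longlonglongrightarrow> psi_ext \<psi> (pseudo_inv \<psi> u + pseudo_inv \<psi> v)"
    and w: "0 < w" "w \<le> 1"
  shows "(\<lambda>n. \<psi>s n (real k * rinv (\<psi>s n) w)) \<longlonglongrightarrow> \<psi> (real k * rinv \<psi> w)"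
proof (induction k)
  case (Suc k)
  have step: "\<theta> (real (Suc k) * rinv \<theta> w) = psi_ext \<theta> (pseudo_inv \<theta> (\<theta> (real k * rinv \<theta> w)) + pseudo_inv \<theta> w)"
    if "archimedean \<theta>" for \<theta>
  proof -
    interpret archimedean \<theta> by fact
    have "psi_ext \<theta> (pseudo_inv \<theta> (psi_ext \<theta> (ereal (real k * rinv \<theta> w))) + ereal (rinv \<theta> w))
      = psi_ext \<theta> (ereal (real k * rinv \<theta> w) + ereal (rinv \<theta> w))"
      by (rule psi_ext_inv_add) auto
    then show ?thesis using ereal_rinv[OF w] by (simp add: algebra_simps)
  qed
  let ?F = "\<lambda>n u. psi_ext (\<psi>s n) (pseudo_inv (\<psi>s n) u + pseudo_inv (\<psi>s n) w)"
  let ?a = "\<lambda>n. \<psi>s n (real k * rinv (\<psi>s n) w)" and ?b = "\<psi> (real k * rinv \<psi> w)"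
  have b: "0 \<le> ?b" "?b \<le> 1" by (auto simp: lim.nonneg lim.le_1)
  have a: "0 \<le> ?a n" "?a n \<le> 1" for n by (auto simp: seq.nonneg seq.le_1)
  have "(\<lambda>n. ?F n (?a n) - ?F n ?b) \<longlonglongrightarrow> 0"
  proof (rule Lim_null_comparison)
    have "\<bar>?F n (?a n) - ?F n ?b\<bar> \<le> \<bar>?a n - ?b\<bar>" for n
    proof -
      have "\<bar>psi_ext (\<psi>s n) (pseudo_inv (\<psi>s n) w + pseudo_inv (\<psi>s n) (?a n))
            - psi_ext (\<psi>s n) (pseudo_inv (\<psi>s n) w + pseudo_inv (\<psi>s n) ?b)\<bar>
        \<le> \<bar>psi_ext (\<psi>s n) (pseudo_inv (\<psi>s n) (?a n)) - psi_ext (\<psi>s n) (pseudo_inv (\<psi>s n) ?b)\<bar>"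
        by (rule seq.psi_ext_contraction) auto
      then show ?thesis using a[of n] b by (simp add: seq.psi_ext_pseudo_inv add.commute)
    qed
    then show "\<forall>\<^sub>F n in sequentially. norm (?F n (?a n) - ?F n ?b) \<le> \<bar>?a n - ?b\<bar>" by simp
    show "(\<lambda>n. \<bar>?a n - ?b\<bar>) \<longlonglongrightarrow> 0"
      using Suc LIM_zero tendsto_rabs_zero by fast
  qed
  from tendsto_add[OF this pair[of ?b w]] b w
  have "(\<lambda>n. ?F n (?a n)) \<longlonglongrightarrow> psi_ext \<psi> (pseudo_inv \<psi> ?b + pseudo_inv \<psi> w)" by simp
  then show ?case
    unfolding step[OF lim.archimedean_axioms] step[OF seq.archimedean_axioms] .
qed simp

text \<open>The normalisation \<open>\<psi> 1 = 1 / 2\<close> fixes the scale: for \<open>w = \<psi> (1 / N)\<close> the convergence of the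
  iterates of the binary copula forces \<open>1 / (N + 1) < rinv (\<psi>s n) w < 1 / (N - 1)\<close> eventually,
  and comparing \<open>y\<close> with the \<open>k\<close>-fold iterates of \<open>w\<close> then locates \<open>rinv (\<psi>s n) y\<close>.\<close>
lemma rinv_tendsto_of_pair:
  assumes pair: "\<And>u v. u \<in> {0..1} \<Longrightarrow> v \<in> {0..1} \<Longrightarrow>
      (\<lambda>n. psi_ext (\<psi>s n) (pseudo_inv (\<psi>s n) u + pseudo_inv (\<psi>s n) v))
        \<longlonglongrightarrow> psi_ext \<psi> (pseudo_inv \<psi> u + pseudo_inv \<psi> v)"
    and y: "0 < y" "y \<le> 1"
  shows "(\<lambda>n. rinv (\<psi>s n) y) \<longlonglongrightarrow> rinv \<psi> y"
proof -
  define r where "r N n = rinv (\<psi>s n) (\<psi> (1 / real N))" for N n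
  have w: "0 < \<psi> (1 / real N)" "\<psi> (1 / real N) \<le> 1" if "N \<ge> 1" for N
    using lim.antimono[of "1 / real N" 1] lim.psi_1 lim.le_1[of "1 / real N"] that by auto
  have iter: "(\<lambda>n. \<psi>s n (real k * r N n)) \<longlonglongrightarrow> \<psi> (real k / real N)" if "N \<ge> 1" for k N
    using iterate_tendsto[OF pair w[OF that], of k] w[OF that] that by (simp add: r_def lim.rinv_psi)
  have r0: "0 \<le> r N n" for N n by (simp add: r_def)
  have upper: "\<forall>\<^sub>F n in sequentially. (real N - 1) * r N n < 1" if N: "N \<ge> 1" for N
  proof -
    \<comment> \<open>The iterate with \<open>N - 1\<close> steps tends to a value above 1/2, which
      is \<open>\<psi>s n 1\<close>; so \<open>(N - 1) * r N n\<close> eventually falls short of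
      1.\<close>
    have "\<psi> 1 < \<psi> (real (N - 1) / real N)"
      using N lim.antimono[of "real (N - 1) / real N" 1] lim.psi_1 by (intro lim.strict) auto
    from order_tendstoD(1)[OF iter[OF N] this[unfolded lim.psi_1]] show ?thesis
    proof eventually_elim
      case (elim n)
      then show ?case
        using seq.antimono[of 1 "real (N - 1) * r N n" n] seq.psi_1[of n] N
        by (cases "real (N - 1) * r N n < 1") (auto simp: of_nat_diff)
    qed
  qed
  have lower: "\<forall>\<^sub>F n in sequentially. 1 < (real N + 1) * r N n" if N: "N \<ge> 1" for N
  proof -
    have "\<psi> (real (N + 1) / real N) < \<psi> 1"
      using N lim.psi_1 by (intro lim.strict) auto
    from order_tendstoD(2)[OF iter[OF N] this[unfolded lim.psi_1]] show ?thesis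
    proof eventually_elim
      case (elim n)
      then show ?case
        using seq.antimono[of "real (N + 1) * r N n" 1 n] seq.psi_1[of n] r0
        by (cases "1 < real (N + 1) * r N n") (auto simp: add.commute)
    qed
  qed
  have dense: "\<exists>p q. 0 < q \<and> a < real p / real q \<and> real p / real q < b" if "0 \<le> a" "a < b" for a b :: real
  proof -
    obtain x where x: "x \<in> \<rat>" "a < x" "x < b" using Rats_dense_in_real[OF \<open>a < b\<close>] by blast
    then obtain m n :: nat where "n \<noteq> 0" "\<bar>x\<bar> = real m / real n" by (metis Rats_abs_nat_div_natE)
    then show ?thesis using x \<open>0 \<le> a\<close> by (intro exI[of _ m] exI[of _ n]) auto
  qed
  show ?thesis
  proof (rule order_tendstoI)
    fix a assume a: "a < rinv \<psi> y"
    show "\<forall>\<^sub>F n in sequentially. a < rinv (\<psi>s n) y"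
    proof (cases "a < 0")
      case True
      then show ?thesis by (intro always_eventually allI less_le_trans[OF _ rinv_nonneg])
    next
      case False
      then obtain p q where pq: "0 < q" "a < real p / real q" "real p / real q < rinv \<psi> y"
        using dense[OF _ a] by auto
      then have "0 < real p - a * real q" by (simp add: pos_less_divide_eq)
      \<comment> \<open>Expanding \<open>p / q\<close> to \<open>(m * p) / (m * q)\<close> keeps the
        fraction and refines the unit \<open>r N\<close>. A large \<open>m\<close> absorbs the error
        of one unit between \<open>N\<close> and \<open>N + 1\<close>, which is the inequality
        \<open>ak\<close>.\<close>
      then obtain m where m: "a < real m * (real p - a * real q)"
        using reals_Archimedean3 by blast
      then have m1: "m \<ge> 1" using False by (cases m) auto
      define k N where "k = m * p" and "N = m * q"
      have N: "N \<ge> 1" using m1 pq by (simp add: N_def Suc_le_eq)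
      have kN: "real k / real N = real p / real q" using m1 by (simp add: k_def N_def)
      have ak: "a * (real N + 1) \<le> real k" using m by (simp add: k_def N_def algebra_simps)
      have "y < \<psi> (real k / real N)" using lim.less_rinv_iff[OF y] pq(3) kN by simp
      from order_tendstoD(1)[OF iter[OF N] this] lower[OF N] show ?thesis
      proof eventually_elim
        case (elim n)
        have "a \<le> a * ((real N + 1) * r N n)"
          using elim(2) False mult_left_mono[of 1 "(real N + 1) * r N n" a] by simp
        also have "\<dots> \<le> real k * r N n"
          using mult_right_mono[OF ak r0[of N n]] by (simp add: mult.assoc)
        also have "\<dots> < rinv (\<psi>s n) y" using elim(1) seq.less_rinv_iff[OF y] r0 by simp
        finally show ?case .
      qed
    qed
  next
    fix a assume a: "rinv \<psi> y < a"
    obtain p q where pq: "0 < q" "rinv \<psi> y < real p / real q" "real p / real q < a"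
      using dense[OF _ a] by auto
    then have "0 < a * real q - real p" by (simp add: pos_divide_less_eq)
    then obtain m where m: "a < real m * (a * real q - real p)"
      using reals_Archimedean3 by blast
    have a0: "0 < a" using a rinv_nonneg[of \<psi> y] by linarith
    then have m1: "m \<ge> 1" using m by (cases m) auto
    define k N where "k = m * p" and "N = m * q"
    have N: "N \<ge> 1" using m1 pq by (simp add: N_def Suc_le_eq)
    have kN: "real k / real N = real p / real q" using m1 by (simp add: k_def N_def)
    have ak: "real k \<le> a * (real N - 1)" using m by (simp add: k_def N_def algebra_simps)
    have "\<psi> (real k / real N) < y" using lim.rinv_less_iff[OF y] pq(2) kN by simp
    from order_tendstoD(2)[OF iter[OF N] this] upper[OF N]
    show "\<forall>\<^sub>F n in sequentially. rinv (\<psi>s n) y < a"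
    proof eventually_elim
      case (elim n)
      have "rinv (\<psi>s n) y < real k * r N n" using elim(1) seq.rinv_less_iff[OF y] r0 by simp
      also have "\<dots> \<le> a * ((real N - 1) * r N n)"
        using mult_right_mono[OF ak r0[of N n]] by (simp add: mult.assoc)
      also have "\<dots> \<le> a" using elim(2) a0 mult_left_mono[of "(real N - 1) * r N n" 1 a] by simp
      finally show ?case .
    qed
  qed
qed

lemma pseudo_inv_tendsto_iff:
  "(\<forall>y\<in>{0<..1}. (\<lambda>n. pseudo_inv (\<psi>s n) y) \<longlonglongrightarrow> pseudo_inv \<psi> y) \<longleftrightarrow>
    (\<forall>y\<in>{0<..1}. (\<lambda>n. rinv (\<psi>s n) y) \<longlonglongrightarrow> rinv \<psi> y)"
  by (intro ball_cong refl) (auto simp: lim.ereal_rinv seq.ereal_rinv)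

section \<open>From pseudo-inverses to generators and back to copulas\<close>

lemma psi_tendsto_of_rinv:
  assumes inv: "\<And>y. 0 < y \<Longrightarrow> y \<le> 1 \<Longrightarrow> (\<lambda>n. rinv (\<psi>s n) y) \<longlonglongrightarrow> rinv \<psi> y" and x: "0 \<le> x"
  shows "(\<lambda>n. \<psi>s n x) \<longlonglongrightarrow> \<psi> x"
proof (rule order_tendstoI)
  fix a assume a: "\<psi> x < a"
  show "\<forall>\<^sub>F n in sequentially. \<psi>s n x < a"
  proof (cases "a \<le> 1")
    case True
    have a0: "0 < a" using a lim.nonneg[OF x] by simp
    \<comment> \<open>\<open>\<psi> x < a\<close> and \<open>rinv \<psi> a < x\<close> are
      equivalent, and the latter is an open condition on the convergent sequence
      \<open>rinv (\<psi>s n) a\<close>.\<close>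
    have "rinv \<psi> a < x" using lim.rinv_less_iff[OF a0 True x] a by simp
    from order_tendstoD(2)[OF inv[OF a0 True] this] show ?thesis
      by eventually_elim (use seq.rinv_less_iff[OF a0 True x] in simp)
  next
    case False
    then have "1 < a" by simp
    then show ?thesis by (intro always_eventually allI le_less_trans[OF seq.le_1[OF x]])
  qed
next
  fix a assume a: "a < \<psi> x"
  \<comment> \<open>A threshold strictly between \<open>a\<close> and \<open>\<psi> x\<close> that
    is positive even for \<open>a = 0\<close>, where the assumption on pseudo-inverses says
    nothing.\<close>
  define b where "b = (max a 0 + \<psi> x) / 2"
  show "\<forall>\<^sub>F n in sequentially. a < \<psi>s n x"
  proof (cases "a < 0")
    case True
    then show ?thesis by (intro always_eventually allI less_le_trans[OF _ seq.nonneg[OF x]])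
  next
    case False
    then have b: "0 < b" "b \<le> 1" "b < \<psi> x" "a < b"
      using a lim.le_1[OF x] by (auto simp: b_def)
    have "x < rinv \<psi> b" using lim.less_rinv_iff[OF b(1,2) x] b by simp
    from order_tendstoD(1)[OF inv[OF b(1,2)] this] show ?thesis
      by eventually_elim (use seq.less_rinv_iff[OF b(1,2) x] b in fastforce)
  qed
qed

text \<open>Polya's argument for monotone functions with a continuous limit: between grid points at
  which \<open>\<psi>\<close> takes consecutive values \<open>j / K\<close>, the error is at most
  \<open>1 / K\<close> from the grid and \<open>1 / K\<close> from convergence on the finite
  grid.\<close>

lemma uniform_limit_of_tendsto:
  assumes pw: "\<And>x. 0 \<le> x \<Longrightarrow> (\<lambda>n. \<psi>s n x) \<longlonglongrightarrow> \<psi> x"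
  shows "uniform_limit {0..} \<psi>s \<psi> sequentially"
proof (rule uniform_limitI)
  fix e :: real assume e: "0 < e"
  obtain K :: nat where K: "2 / e < real K" using reals_Archimedean2 by blast
  have K0: "0 < real K" using e K by (meson divide_pos_pos less_trans zero_less_numeral)
  have Ke: "2 / real K < e" using K K0 e by (simp add: field_simps)
  \<comment> \<open>Only \<open>1 \<le> j \<le> K\<close> is meaningful, since \<open>rinv\<close>
    may be a default value at 0; the lowest strip \<open>j = 0\<close> is settled by
    nonnegativity.\<close>
  define t where "t j = rinv \<psi> (real j / real K)" for j
  have t: "0 \<le> t j" "\<psi> (t j) = real j / real K" if "1 \<le> j" "j \<le> K" for j
    using that K0 by (auto simp: t_def intro!: lim.psi_rinv)
  have "\<forall>\<^sub>F n in sequentially. \<forall>j\<in>{1..K}. dist (\<psi>s n (t j)) (\<psi> (t j)) < 1 / real K"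
    using K0 by (intro eventually_ball_finite ballI tendstoD[OF pw] t(1)) auto
  then show "\<forall>\<^sub>F n in sequentially. \<forall>x\<in>{0..}. dist (\<psi>s n x) (\<psi> x) < e"
  proof eventually_elim
    case (elim n)
    show ?case
    proof
      fix x :: real assume "x \<in> {0..}"
      then have x: "0 \<le> x" by simp
      define j where "j = nat \<lfloor>\<psi> x * real K\<rfloor>"
      have j: "real j \<le> \<psi> x * real K" "\<psi> x * real K < real j + 1"
        using lim.nonneg[OF x] K0 by (auto simp: j_def)
      have "\<psi> x * real K \<le> 1 * real K" using lim.le_1[OF x] K0 by (intro mult_right_mono) auto
      then have jK: "j \<le> K" using j by linarith
      have up: "\<psi>s n x < \<psi> x + 2 / real K"
      \<comment> \<open>\<open>j = K\<close> forces \<open>\<psi> x = 1\<close>, an upper bound for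
        every generator; no grid point \<open>t (K + 1)\<close> exists.\<close>
      proof (cases "j = K")
        case True
        then have "1 \<le> \<psi> x" using j(1) K0 by (simp add: mult_le_cancel_right1)
        then show ?thesis using seq.le_1[OF x, of n] K0 by (smt (verit) divide_pos_pos)
      next
        case False
        then have j1: "1 \<le> j + 1" "j + 1 \<le> K" using jK by auto
        have "\<psi> x < real (j + 1) / real K" using j(2) K0 by (simp add: pos_less_divide_eq add.commute)
        then have "t (j + 1) < x"
          unfolding t_def by (subst lim.rinv_less_iff) (use j1 K0 x in auto)
        then have "\<psi>s n x \<le> \<psi>s n (t (j + 1))" using t[OF j1] by (intro seq.antimono) auto
        also have "\<dots> < \<psi> (t (j + 1)) + 1 / real K" using elim j1 by (force simp: dist_real_def)
        also have "\<dots> = (real j + 2) / real K" using t[OF j1] by (simp add: add_divide_distrib)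
        also have "\<dots> \<le> \<psi> x + 2 / real K" using j(1) K0 by (simp add: field_simps)
        finally show ?thesis .
      qed
      have lo: "\<psi> x - 2 / real K < \<psi>s n x"
      proof (cases "j = 0")
        case True
        then have "\<psi> x < 2 / real K" using j(2) K0 by (simp add: field_simps)
        then show ?thesis using seq.nonneg[OF x, of n] by simp
      next
        case False
        then have j1: "1 \<le> j" "j \<le> K" using jK by auto
        have "real j / real K \<le> \<psi> x" using j(1) K0 by (simp add: pos_divide_le_eq)
        then have "\<not> t j < x"
          unfolding t_def by (subst lim.rinv_less_iff) (use j1 K0 x in auto)
        then have "\<psi>s n (t j) \<le> \<psi>s n x" using x by (intro seq.antimono) auto
        moreover have "\<psi> (t j) - 1 / real K < \<psi>s n (t j)" using elim j1 by (force simp: dist_real_def)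
        moreover have "\<psi> x < \<psi> (t j) + 1 / real K" using t[OF j1] j(2) K0 by (simp add: field_simps)
        ultimately show ?thesis by simp
      qed
      show "dist (\<psi>s n x) (\<psi> x) < e" using up lo Ke by (simp add: dist_real_def)
    qed
  qed
qed

text \<open>Inside \<open>\<psi>s n\<close>, the pseudo-inverses of \<open>\<psi>s n\<close> are
  exchanged for those of \<open>\<psi>\<close>. Since \<open>u i\<close> is the value of either
  generator at its own pseudo-inverse, each exchange costs at most the distance of the generators at
  one point; exchanging the outer generator costs one more.\<close>

lemma copula_uniform_limit:
  assumes unif: "uniform_limit {0..} \<psi>s \<psi> sequentially"
  shows "uniform_limit (cube d) (\<lambda>n. arch_copula d (\<psi>s n)) (arch_copula d \<psi>) sequentially"
proof (rule uniform_limitI)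
  fix e :: real assume e: "0 < e"
  \<comment> \<open>There are \<open>d\<close> exchanges inside and one outside;
    \<open>d + 2\<close> makes the total strictly smaller than \<open>e\<close>.\<close>
  define \<delta> where "\<delta> = e / (real d + 2)"
  have "0 < \<delta>" "(real d + 2) * \<delta> = e" using e by (auto simp: \<delta>_def)
  then have \<delta>: "0 < \<delta>" "(real d + 1) * \<delta> < e" by (auto simp: distrib_right)
  from uniform_limitD[OF unif \<delta>(1)]
  show "\<forall>\<^sub>F n in sequentially. \<forall>u\<in>cube d. dist (arch_copula d (\<psi>s n) u) (arch_copula d \<psi> u) < e"
  proof eventually_elim
    case (elim n)
    have close: "\<bar>psi_ext (\<psi>s n) z - psi_ext \<psi> z\<bar> \<le> \<delta>" if "0 \<le> z" for z
    proof (cases z)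
      case (real r)
      then have "dist (\<psi>s n r) (\<psi> r) < \<delta>" using elim that by auto
      then show ?thesis using real that by (simp add: dist_real_def)
    qed (use that \<delta>(1) in auto)
    show ?case
    proof
      fix u assume u: "u \<in> cube d"
      define t where "t i = pseudo_inv \<psi> (u i)" for i
      have ui: "0 \<le> u i" "u i \<le> 1" if "i < d" for i        using PiE_mem[OF u[unfolded cube_def], of i] that by auto
      have "\<bar>psi_ext (\<psi>s n) (0 + (\<Sum>i<d. pseudo_inv (\<psi>s n) (u i))) - psi_ext (\<psi>s n) (0 + (\<Sum>i<d. t i))\<bar>
          \<le> (\<Sum>i<d. \<bar>psi_ext (\<psi>s n) (pseudo_inv (\<psi>s n) (u i)) - psi_ext (\<psi>s n) (t i)\<bar>)"
        by (rule seq.psi_ext_sum_lipschitz) (auto simp: t_def)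
      also have "\<dots> = (\<Sum>i<d. \<bar>psi_ext \<psi> (t i) - psi_ext (\<psi>s n) (t i)\<bar>)"
        by (intro sum.cong refl) (auto simp: t_def ui seq.psi_ext_pseudo_inv lim.psi_ext_pseudo_inv)
      also have "\<dots> \<le> (\<Sum>i<d. \<delta>)"
        using close by (intro sum_mono) (auto simp: t_def abs_minus_commute)
      finally have "\<bar>arch_copula d (\<psi>s n) u - psi_ext (\<psi>s n) (\<Sum>i<d. t i)\<bar> \<le> real d * \<delta>"
        by (simp add: arch_copula_def)
      moreover have "\<bar>psi_ext (\<psi>s n) (\<Sum>i<d. t i) - arch_copula d \<psi> u\<bar> \<le> \<delta>"
        unfolding arch_copula_def t_def[symmetric] by (intro close sum_nonneg) (simp add: t_def)
      ultimately have "\<bar>arch_copula d (\<psi>s n) u - arch_copula d \<psi> u\<bar> \<le> (real d + 1) * \<delta>"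
        by (simp add: distrib_right)
      then show "dist (arch_copula d (\<psi>s n) u) (arch_copula d \<psi> u) < e"
        using \<delta>(2) by (simp add: dist_real_def)
    qed
  qed
qed

section \<open>Convergence of derivatives\<close>

lemma H_tendsto_aux:
  assumes "k < d - 1" "0 < x" "\<And>y. 0 < y \<Longrightarrow> (\<lambda>n. seq.H n k y) \<longlonglongrightarrow> lim.H k y"
    and "isCont (lim.H (Suc k)) x" "X \<longlonglongrightarrow> x"
  shows "(\<lambda>n. seq.H n (Suc k) (X n)) \<longlonglongrightarrow> lim.H (Suc k) x"
proof -
  have "(\<lambda>n. - seq.H n (Suc k) (X n)) \<longlonglongrightarrow> - lim.H (Suc k) x"
    by (rule subgradient_tendsto[OF _ _ seq.H_subgradient lim.H_subgradient])
      (use assms in \<open>auto intro: continuous_intros\<close>)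
  then show ?thesis by (simp add: tendsto_minus_cancel_left)
qed

lemma H_tendsto:
  assumes pw: "\<And>x. 0 < x \<Longrightarrow> (\<lambda>n. \<psi>s n x) \<longlonglongrightarrow> \<psi> x" and "k < d - 1" "0 < x"
  shows "(\<lambda>n. seq.H n k x) \<longlonglongrightarrow> lim.H k x"
  using assms(2,3)
proof (induction k arbitrary: x)
  case (Suc k)
  then show ?case by (intro H_tendsto_aux lim.H_isCont) auto
qed (use pw in simp)

text \<open>Continuity is demanded of the limit at the single point \<open>x\<close>; it is a
  genuine restriction only for \<open>Suc k = d - 1\<close>. The moving \<open>X\<close> will be a
  sum of values of \<open>rinv (\<psi>s n)\<close>.\<close>

lemma H_tendsto_moving:
  assumes pw: "\<And>x. 0 < x \<Longrightarrow> (\<lambda>n. \<psi>s n x) \<longlonglongrightarrow> \<psi> x" and "k < d - 1" "0 < x"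
    and "isCont (lim.H (Suc k)) x" "X \<longlonglongrightarrow> x"
  shows "(\<lambda>n. seq.H n (Suc k) (X n)) \<longlonglongrightarrow> lim.H (Suc k) x"
  using assms by (intro H_tendsto_aux H_tendsto[OF pw]) auto

lemma deriv_eq_H:
  assumes "k < d - 1" shows "(deriv ^^ k) \<theta> x = (-1) ^ k * alt_deriv d \<theta> k x"
  using assms by (simp add: alt_deriv_def)

lemma left_deriv_eq_H: "left_deriv ((deriv ^^ (d - 2)) \<theta>) x = (-1) ^ (d - 1) * alt_deriv d \<theta> (d - 1) x"
  by (simp add: alt_deriv_def)

lemma derivatives_tendsto_of_psi:
  assumes pw: "\<And>x. 0 < x \<Longrightarrow> (\<lambda>n. \<psi>s n x) \<longlonglongrightarrow> \<psi> x"
  shows "(\<forall>m \<in> {1..d - 2}. \<forall>x > 0. (\<lambda>n. (deriv ^^ m) (\<psi>s n) x) \<longlonglongrightarrow> (deriv ^^ m) \<psi> x) \<and>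
    (\<forall>x \<in> cont_points (left_deriv ((deriv ^^ (d - 2)) \<psi>)).
      (\<lambda>n. left_deriv ((deriv ^^ (d - 2)) (\<psi>s n)) x) \<longlonglongrightarrow> left_deriv ((deriv ^^ (d - 2)) \<psi>) x)"
proof (intro conjI ballI allI impI)
  fix m and x :: real assume "m \<in> {1..d - 2}" "0 < x"
  then have m: "m < d - 1" using lim.d3 by auto
  show "(\<lambda>n. (deriv ^^ m) (\<psi>s n) x) \<longlonglongrightarrow> (deriv ^^ m) \<psi> x"
    unfolding deriv_eq_H[OF m] by (rule tendsto_mult_left[OF H_tendsto[OF pw m \<open>0 < x\<close>]])
next
  fix x assume "x \<in> cont_points (left_deriv ((deriv ^^ (d - 2)) \<psi>))"
  then have x: "0 < x" "isCont (left_deriv ((deriv ^^ (d - 2)) \<psi>)) x"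
    by (auto simp: cont_points_def)
  have "lim.H (d - 1) = (\<lambda>x. (-1) ^ (d - 1) * left_deriv ((deriv ^^ (d - 2)) \<psi>) x)"
    by (simp add: alt_deriv_def fun_eq_iff)
  then have "isCont (lim.H (d - 1)) x" by (simp only: continuous_mult_left x(2))
  moreover have d: "Suc (d - 2) = d - 1" "d - 2 < d - 1" using lim.d3 by auto
  ultimately have "(\<lambda>n. seq.H n (d - 1) x) \<longlonglongrightarrow> lim.H (d - 1) x"
    using H_tendsto_moving[OF pw d(2) x(1) _ tendsto_const] unfolding d(1) by blast
  then show "(\<lambda>n. left_deriv ((deriv ^^ (d - 2)) (\<psi>s n)) x) \<longlonglongrightarrow> left_deriv ((deriv ^^ (d - 2)) \<psi>) x"
    unfolding left_deriv_eq_H by (rule tendsto_mult_left)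
qed

text \<open>Increments are integrals of the derivative, and dominated convergence applies on
  intervals away from 0. The values are anchored at \<open>\<psi> 1 = 1 / 2\<close> and not at 0,
  near which the derivative may be unbounded.\<close>

lemma psi_tendsto_of_deriv:
  assumes der: "\<And>x. 0 < x \<Longrightarrow> (\<lambda>n. deriv (\<psi>s n) x) \<longlonglongrightarrow> deriv \<psi> x" and x: "0 \<le> x"
  shows "(\<lambda>n. \<psi>s n x) \<longlonglongrightarrow> \<psi> x"
proof -
  have "1 < d - 1" using lim.d3 by simp
  then have H1: "alt_deriv d \<theta> 1 x = - deriv \<theta> x" for \<theta> x by (simp add: alt_deriv_def)
  have diff: "(\<lambda>n. \<psi>s n b - \<psi>s n a) \<longlonglongrightarrow> \<psi> b - \<psi> a" if ab: "0 < a" "a \<le> b" for a b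
  proof -
    have I: "((\<lambda>x. - alt_deriv d \<theta> 1 x) has_integral (\<theta> b - \<theta> a)) {a..b}" if "ar_gen d \<theta>" for \<theta>
    proof -
      interpret ar_gen d \<theta> by fact
      show ?thesis
        using subgradient_has_integral[OF H_subgradient[of 0] ab(2)] ab d3
        by (simp add: subset_eq)
    qed
    have In: "((\<lambda>x. - seq.H n 1 x) has_integral (\<psi>s n b - \<psi>s n a)) {a..b}" for n
      by (rule I) unfold_locales
    have Il: "((\<lambda>x. - lim.H 1 x) has_integral (\<psi> b - \<psi> a)) {a..b}"
      by (rule I) unfold_locales
    have "(\<lambda>n. seq.H n 1 a) \<longlonglongrightarrow> lim.H 1 a" unfolding H1 by (intro tendsto_minus der ab)
    then have "Bseq (\<lambda>n. seq.H n 1 a)" by (metis convergentI convergent_imp_Bseq)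
    \<comment> \<open>\<open>H 1\<close> is nonincreasing, so its values at the left end
      \<open>a\<close>, bounded in \<open>n\<close> as a convergent sequence, dominate on
      \<open>[a, b]\<close>.\<close>
    then obtain M where M: "\<And>n. \<bar>seq.H n 1 a\<bar> \<le> M" by (auto simp: Bseq_def)
    have "(\<lambda>n. integral {a..b} (\<lambda>x. - seq.H n 1 x)) \<longlonglongrightarrow> integral {a..b} (\<lambda>x. - lim.H 1 x)"
    proof (rule dominated_convergence(2)[where h = "\<lambda>_. M"])
      show "(\<lambda>x. - seq.H n 1 x) integrable_on {a..b}" for n using In by blast
      show "norm (- seq.H n 1 x) \<le> M" if "x \<in> {a..b}" for n x
        using M[of n] seq.H_antimono[of 1 a x n] seq.H_nonneg[of 1 x n] that ab \<open>1 < d - 1\<close> by auto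
      show "(\<lambda>n. - seq.H n 1 x) \<longlonglongrightarrow> - lim.H 1 x" if "x \<in> {a..b}" for x
        unfolding H1 using that ab by (intro tendsto_minus der) auto
    qed auto
    then show ?thesis unfolding integral_unique[OF In] integral_unique[OF Il] .
  qed
  consider "x = 0" | "0 < x" "x \<le> 1" | "1 \<le> x" using x by linarith
  then show ?thesis
  proof cases
    case 2
    from tendsto_diff[OF tendsto_const[of "1 / 2"] diff[OF 2]] show ?thesis
      by (simp add: seq.psi_1 lim.psi_1)
  next
    case 3
    from tendsto_add[OF tendsto_const[of "1 / 2"] diff[OF _ 3]] show ?thesis
      by (simp add: seq.psi_1 lim.psi_1)
  qed simp
qed

end

section \<open>The density of the lower-dimensional marginal\<close>

text \<open>At \<open>t = 0\<close> only \<open>k = 0\<close> matters, where the value is \<open>\<psi> 0 = 1\<close>.\<close>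
definition ext_deriv :: "nat \<Rightarrow> (real \<Rightarrow> real) \<Rightarrow> nat \<Rightarrow> real \<Rightarrow> real" where
  "ext_deriv d \<psi> k t = (if 0 < t then alt_deriv d \<psi> k t else 1)"

text \<open>A version that is Borel measurable on the whole line; outside \<open>(0, 1)\<close> the
  factor \<open>rinv_weight\<close> makes the density vanish.\<close>

definition ext_rinv :: "(real \<Rightarrow> real) \<Rightarrow> real \<Rightarrow> real" where
  "ext_rinv \<psi> u = (if u \<in> {0<..<1} then rinv \<psi> u else 0)"

text \<open>The absolute derivative of the pseudo-inverse, as given by the inverse function
  rule.\<close>

definition rinv_weight :: "nat \<Rightarrow> (real \<Rightarrow> real) \<Rightarrow> real \<Rightarrow> real" where
  "rinv_weight d \<psi> u = (if u \<in> {0<..<1} then inverse (alt_deriv d \<psi> 1 (rinv \<psi> u)) else 0)"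

definition copula_density :: "nat \<Rightarrow> (real \<Rightarrow> real) \<Rightarrow> (nat \<Rightarrow> real) \<Rightarrow> real" where
  "copula_density d \<psi> y =
    ext_deriv d \<psi> (d - 1) (\<Sum>i<d - 1. ext_rinv \<psi> (y i)) * (\<Prod>i<d - 1. rinv_weight d \<psi> (y i))"

lemma borel_measurable_antimono_on:
  fixes f :: "real \<Rightarrow> real"
  assumes "antimono_on S f" "S \<in> sets borel"
  shows "(\<lambda>x. if x \<in> S then f x else c) \<in> borel_measurable borel"
proof -
  have "mono_on S (\<lambda>x. - f x)" using assms(1) by (auto simp: monotone_on_def)
  from borel_measurable_mono_on_fnc[OF this]
  have "(\<lambda>x. indicator S x *\<^sub>R - f x) \<in> borel_measurable borel"
    using assms(2) by (subst (asm) borel_measurable_restrict_space_iff) auto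
  then have "(\<lambda>x. if x \<in> S then - (indicator S x *\<^sub>R - f x) else c) \<in> borel_measurable borel"
    using assms(2) by (intro measurable_If_set borel_measurable_uminus) auto
  then show ?thesis by (rule measurable_cong[THEN iffD1, rotated]) auto
qed

context archimedean
begin

lemma ext_rinv_nonneg [simp]: "0 \<le> ext_rinv \<psi> u"
  by (simp add: ext_rinv_def)

lemma ext_rinv_eq: "0 < u \<Longrightarrow> u \<le> 1 \<Longrightarrow> ext_rinv \<psi> u = rinv \<psi> u"
  by (auto simp: ext_rinv_def)

lemma rinv_left_continuous:
  assumes "0 < x" "x \<le> 1"
  shows "(rinv \<psi> \<longlongrightarrow> rinv \<psi> x) (at_left x)"
proof (cases "x = 1")
  case True
  have near: "\<forall>\<^sub>F u in at_left 1. 0 < u \<and> u < (1::real)"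
    using eventually_at_left_real[of 0 1] by simp
  have "\<forall>\<^sub>F u in at_left 1. rinv \<psi> u < a" if "0 < a" for a
  proof -
    have "\<psi> a < 1" using strict[of 0 a] that by simp
    then have "\<forall>\<^sub>F u in at_left 1. \<psi> a < u" using eventually_at_left_real[of "\<psi> a" 1] by (auto elim: eventually_mono)
    with near show ?thesis by eventually_elim (use that in \<open>simp add: rinv_less_iff\<close>)
  qed
  then show ?thesis
    using True by (intro order_tendstoI) (auto intro!: always_eventually less_le_trans[OF _ rinv_nonneg])
next
  case False
  then show ?thesis using isCont_rinv[of x] assms by (simp add: isCont_def filterlim_at_split)
qed

end

section \<open>Differentiation of the inverse generator and integration over boxes\<close>

context ar_gen
begin

lemma d1: "1 < d - 1" using d3 by simp

lemma H1_rinv_pos: "0 < u \<Longrightarrow> u < 1 \<Longrightarrow> 0 < H 1 (rinv \<psi> u)"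
  using d1 by (intro H_pos) (auto simp: rinv_pos_iff psi_rinv)

lemma rinv_weight_nonneg [simp]: "0 \<le> rinv_weight d \<psi> u"
  using H1_rinv_pos[of u] by (auto simp: rinv_weight_def less_imp_le)

lemma ext_deriv_nonneg: "k \<le> d - 1 \<Longrightarrow> 0 \<le> ext_deriv d \<psi> k t"
  by (auto simp: ext_deriv_def H_nonneg)

lemma ext_deriv_0: "0 \<le> t \<Longrightarrow> ext_deriv d \<psi> 0 t = \<psi> t"
  by (auto simp: ext_deriv_def less_le)

lemma rinv_DERIV:
  assumes u: "0 < u" "u < 1"
  shows "(rinv \<psi> has_real_derivative - rinv_weight d \<psi> u) (at u)"
proof -
  have "(\<psi> has_real_derivative - H 1 (rinv \<psi> u)) (at (rinv \<psi> u))"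
    using H_DERIV[of 0 "rinv \<psi> u"] d3 u by (simp add: rinv_pos_iff)
  then have "(rinv \<psi> has_real_derivative inverse (- H 1 (rinv \<psi> u))) (at u)"
    using H1_rinv_pos[OF u] u by (intro DERIV_inverse_function[of \<psi> _ _ _ 0 1]) (auto simp: psi_rinv isCont_rinv)
  then show ?thesis using u by (simp add: rinv_weight_def)
qed

lemma isCont_rinv_weight:
  assumes u: "0 < u" "u < 1"
  shows "isCont (rinv_weight d \<psi>) u"
proof -
  have "isCont (\<lambda>u. inverse (H 1 (rinv \<psi> u))) u"
    using H1_rinv_pos[OF u] u d1
    by (intro continuous_intros isCont_o2[OF isCont_rinv H_isCont]) (auto simp: rinv_pos_iff)
  moreover have "\<forall>\<^sub>F v in nhds u. v \<in> {0<..<1}"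
    using u by (intro eventually_nhds_in_open) auto
  then have "\<forall>\<^sub>F v in nhds u. rinv_weight d \<psi> v = inverse (H 1 (rinv \<psi> v))"
    by eventually_elim (simp add: rinv_weight_def)
  ultimately show ?thesis using isCont_cong by fastforce
qed

lemma ext_deriv_measurable [measurable]:
  assumes "k \<le> d - 1" shows "ext_deriv d \<psi> k \<in> borel_measurable borel"
proof -
  have "antimono_on {0<..} (H k)" by (rule monotone_onI) (use H_antimono[OF assms] in auto)
  from borel_measurable_antimono_on[OF this, of 1] show ?thesis
    by (simp add: ext_deriv_def[abs_def])
qed

lemma ext_rinv_measurable [measurable]: "ext_rinv \<psi> \<in> borel_measurable borel"
proof -
  have "antimono_on {0<..<1} (rinv \<psi>)" by (rule monotone_onI) (auto intro: rinv_antimono)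
  from borel_measurable_antimono_on[OF this, of 0] show ?thesis
    by (simp add: ext_rinv_def[abs_def])
qed

lemma rinv_weight_measurable [measurable]: "rinv_weight d \<psi> \<in> borel_measurable borel"
proof -
  have [measurable]: "ext_deriv d \<psi> 1 \<in> borel_measurable borel" using d1 by (intro ext_deriv_measurable) simp
  have "rinv_weight d \<psi> = (\<lambda>u. if u \<in> {0<..<1} then inverse (ext_deriv d \<psi> 1 (ext_rinv \<psi> u)) else 0)"
    by (auto simp: rinv_weight_def ext_deriv_def ext_rinv_def rinv_pos_iff fun_eq_iff)
  also have "\<dots> \<in> borel_measurable borel" by measurable
  finally show ?thesis .
qed

text \<open>Substituting \<open>t = - rinv \<psi> u\<close> leaves the integral of a subgradient,
  which is the increment of \<open>H k\<close> even at the last order, where no derivative need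
  exist. The closed interval stays inside \<open>(0, 1)\<close>, where the weight is
  continuous.\<close>

lemma nn_integral_H_rinv_Icc:
  assumes k: "k < d - 1" and s: "0 \<le> s" and ab: "0 < a" "a \<le> b" "b < 1"
  shows "(\<integral>\<^sup>+u. ennreal (H (Suc k) (s + rinv \<psi> u) * rinv_weight d \<psi> u) * indicator {a..b} u \<partial>lborel)
    = ennreal (H k (s + rinv \<psi> b) - H k (s + rinv \<psi> a))"
proof -
  have rb: "0 < rinv \<psi> b" using ab by (simp add: rinv_pos_iff)
  have rab: "rinv \<psi> b \<le> rinv \<psi> a" using ab by (intro rinv_antimono) auto
  \<comment> \<open>The reflection makes the substitution increasing, with the nonnegative
    derivative \<open>rinv_weight\<close>.\<close>
  have sg: "subgradient_on {..<s} (\<lambda>t. H k (s - t)) (\<lambda>t. H (Suc k) (s - t))"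
    unfolding subgradient_on_def
  proof safe
    fix x y assume "x < s" "y < s"
    then show "H k (s - x) + H (Suc k) (s - x) * (y - x) \<le> H k (s - y)"
      using subgradient_onD[OF H_subgradient[OF k], of "s - x" "s - y"] by (simp add: algebra_simps)
  qed
  have "{- rinv \<psi> a..- rinv \<psi> b} \<subseteq> {..<s}" using rb s by auto
  from subgradient_has_integral[OF sg _ this] rab
  have I: "((\<lambda>t. H (Suc k) (s - t)) has_integral (H k (s + rinv \<psi> b) - H k (s + rinv \<psi> a))) {- rinv \<psi> a..- rinv \<psi> b}"
    by simp
  have nonneg: "0 \<le> H (Suc k) (s - t)" if "t \<in> {- rinv \<psi> a..- rinv \<psi> b}" for t
    using that k rb s by (intro H_nonneg) auto
  have [measurable]: "ext_deriv d \<psi> (Suc k) \<in> borel_measurable borel" using k by (intro ext_deriv_measurable) simp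
  have "(\<integral>\<^sup>+t. ennreal (ext_deriv d \<psi> (Suc k) (s - t) * indicator {- rinv \<psi> a..- rinv \<psi> b} t) \<partial>lborel)
    = (\<integral>\<^sup>+t. ennreal (indicator {- rinv \<psi> a..- rinv \<psi> b} t * H (Suc k) (s - t)) \<partial>lborel)"
    using rb s by (intro nn_integral_cong) (auto simp: indicator_def ext_deriv_def)
  also have "\<dots> = ennreal (H k (s + rinv \<psi> b) - H k (s + rinv \<psi> a))"
    by (rule nn_integral_has_integral_lebesgue[OF nonneg I])
  finally have L: "(\<integral>\<^sup>+t. ennreal (ext_deriv d \<psi> (Suc k) (s - t) * indicator {- rinv \<psi> a..- rinv \<psi> b} t) \<partial>lborel)
    = ennreal (H k (s + rinv \<psi> b) - H k (s + rinv \<psi> a))" .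
  have "(\<integral>\<^sup>+t. ennreal (ext_deriv d \<psi> (Suc k) (s - t) * indicator {- rinv \<psi> a..- rinv \<psi> b} t) \<partial>lborel) =
      (\<integral>\<^sup>+u. ennreal (ext_deriv d \<psi> (Suc k) (s - - rinv \<psi> u) * rinv_weight d \<psi> u * indicator {a..b} u) \<partial>lborel)"
  proof (rule nn_integral_substitution)
    show "set_borel_measurable borel {- rinv \<psi> a..- rinv \<psi> b} (\<lambda>t. ext_deriv d \<psi> (Suc k) (s - t))"
      unfolding set_borel_measurable_def by measurable
    fix u assume u: "u \<in> {a..b}"
    show "((\<lambda>u. - rinv \<psi> u) has_real_derivative rinv_weight d \<psi> u) (at u)"
      using DERIV_minus[OF rinv_DERIV, of u] u ab by simp
    show "0 \<le> rinv_weight d \<psi> u" by simp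
  next
    show "continuous_on {a..b} (rinv_weight d \<psi>)"
      using ab by (intro continuous_at_imp_continuous_on ballI isCont_rinv_weight) auto
  qed (use ab in simp)
  also have "\<dots> = (\<integral>\<^sup>+u. ennreal (H (Suc k) (s + rinv \<psi> u) * rinv_weight d \<psi> u) * indicator {a..b} u \<partial>lborel)"
  proof (intro nn_integral_cong)
    fix u show "ennreal (ext_deriv d \<psi> (Suc k) (s - - rinv \<psi> u) * rinv_weight d \<psi> u * indicator {a..b} u)
      = ennreal (H (Suc k) (s + rinv \<psi> u) * rinv_weight d \<psi> u) * indicator {a..b} u"
      using ab s rinv_pos_iff[of u] by (auto simp: indicator_def ext_deriv_def)
  qed
  finally show ?thesis unfolding L by (rule sym)
qed

text \<open>Exhaustion of \<open>(0, x)\<close> by closed intervals: the upper end gives the stated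
  value, the lower end contributes 0 in the limit because
  \<open>\<psi> (rinv \<psi> (a n)) = a n\<close>. For \<open>s = 0\<close> the order must be
  \<open>k = 0\<close>, since \<open>\<psi>\<close> extends continuously to 0 while its derivatives
  may not.\<close>

lemma nn_integral_ext_deriv:
  assumes k: "k < d - 1" and s: "0 \<le> s" "0 < s \<or> k = 0" and x: "0 < x" "x \<le> 1"
  shows "(\<integral>\<^sup>+u. ennreal (ext_deriv d \<psi> (Suc k) (s + ext_rinv \<psi> u) * rinv_weight d \<psi> u) * indicator {..x} u \<partial>lborel)
    = ennreal (ext_deriv d \<psi> k (s + rinv \<psi> x))"
proof -
  let ?f = "\<lambda>u. ennreal (ext_deriv d \<psi> (Suc k) (s + ext_rinv \<psi> u) * rinv_weight d \<psi> u)"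
  have [measurable]: "ext_deriv d \<psi> (Suc k) \<in> borel_measurable borel" using k by (intro ext_deriv_measurable) simp
  have f [measurable]: "?f \<in> borel_measurable lborel" by measurable
  define M where "M = density lborel ?f"
  \<comment> \<open>The shift by 2 ensures \<open>a n \<le> b n\<close>, with equality at
    \<open>n = 0\<close>.\<close>
  define a b where "a n = x / real (n + 2)" and "b n = x - x / real (n + 2)" for n
  define A where "A n = {a n..b n}" for n
  have ab: "0 < a n" "a n \<le> b n" "b n < x" for n
    using x by (auto simp: a_def b_def field_simps)
  have inv: "(\<lambda>n. x / real (n + 2)) \<longlonglongrightarrow> 0"
    using LIMSEQ_ignore_initial_segment[OF lim_const_over_n[of x], of 2] by simp
  have lims: "a \<longlonglongrightarrow> 0" "b \<longlonglongrightarrow> x"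
    using inv tendsto_diff[OF tendsto_const[of x] inv] by (auto simp: a_def[abs_def] b_def[abs_def])
  have a_Suc: "a (Suc n) \<le> a n" for n
    unfolding a_def using x by (intro divide_left_mono) auto
  then have "b n \<le> b (Suc n)" for n by (simp add: a_def b_def)
  with a_Suc have inc: "incseq A"
    by (intro incseq_SucI) (auto simp: A_def intro: order_trans)
  have U: "(\<Union>n. A n) = {0<..<x}"
  proof safe
    fix u assume "u \<in> {0<..<x}"
    then have "\<forall>\<^sub>F n in sequentially. a n < u \<and> u < b n"
      using lims by (intro eventually_conj order_tendstoD(2)[OF lims(1)] order_tendstoD(1)[OF lims(2)]) auto
    then obtain n where "a n < u" "u < b n" by (auto dest: eventually_happens)
    then show "u \<in> (\<Union>n. A n)" by (auto simp: A_def intro!: exI[of _ n])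
  qed (use ab in \<open>auto simp: A_def intro: less_le_trans le_less_trans\<close>)
  have em: "emeasure M (A n) = ennreal (H k (s + rinv \<psi> (b n)) - H k (s + rinv \<psi> (a n)))" for n
  proof -
    have "emeasure M (A n) = (\<integral>\<^sup>+u. ?f u * indicator {a n..b n} u \<partial>lborel)"
      unfolding M_def A_def by (rule emeasure_density) auto
    also have "\<dots> = (\<integral>\<^sup>+u. ennreal (H (Suc k) (s + rinv \<psi> u) * rinv_weight d \<psi> u) * indicator {a n..b n} u \<partial>lborel)"
    proof (intro nn_integral_cong)
      fix u show "?f u * indicator {a n..b n} u
        = ennreal (H (Suc k) (s + rinv \<psi> u) * rinv_weight d \<psi> u) * indicator {a n..b n} u"
      proof (cases "u \<in> {a n..b n}")
        case True
        then have "0 < u" "u < 1" using ab[of n] x by auto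
        then show ?thesis using s rinv_pos_iff[of u] by (simp add: ext_deriv_def ext_rinv_eq)
      qed simp
    qed
    also have "\<dots> = ennreal (H k (s + rinv \<psi> (b n)) - H k (s + rinv \<psi> (a n)))"
      using ab[of n] x by (intro nn_integral_H_rinv_Icc k s) auto
    finally show ?thesis .
  qed
  have bl: "filterlim b (at_left x) sequentially"
    using ab lims by (auto simp: filterlim_at intro!: always_eventually)
  have rb: "(\<lambda>n. s + rinv \<psi> (b n)) \<longlonglongrightarrow> s + rinv \<psi> x"
    by (intro tendsto_intros filterlim_compose[OF rinv_left_continuous[OF x] bl])
  have Hb: "(\<lambda>n. H k (s + rinv \<psi> (b n))) \<longlonglongrightarrow> ext_deriv d \<psi> k (s + rinv \<psi> x)"
  proof (cases "0 < s + rinv \<psi> x")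
    case True
    then show ?thesis using isCont_tendsto_compose[OF H_isCont[OF k True] rb] by (simp add: ext_deriv_def)
  next
    case False
    \<comment> \<open>Here the argument is 0, and the default value 1 of \<open>ext_deriv\<close> is
      the true value \<open>\<psi> 0\<close>.\<close>
    then have "k = 0" "s + rinv \<psi> x = 0" using s rinv_nonneg[of \<psi> x] by linarith+
    moreover have "(\<lambda>n. \<psi> (s + rinv \<psi> (b n))) \<longlonglongrightarrow> \<psi> (s + rinv \<psi> x)"
      using s by (intro continuous_on_tendsto_compose[OF cont rb] always_eventually) auto
    ultimately show ?thesis by (simp add: ext_deriv_def)
  qed
  have pa: "\<psi> (rinv \<psi> (a n)) = a n" for n using ab[of n] x by (intro psi_rinv) auto
  have Ha: "(\<lambda>n. H k (s + rinv \<psi> (a n))) \<longlonglongrightarrow> 0"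
  proof (cases "0 < s")
    case True
    show ?thesis using k True lims(1) by (intro H_tendsto_0) (auto simp: pa)
  next
    case False
    then show ?thesis using s lims(1) by (simp add: pa)
  qed
  have "(\<lambda>n. emeasure M (A n)) \<longlonglongrightarrow> ennreal (ext_deriv d \<psi> k (s + rinv \<psi> x))"
    unfolding em using tendsto_diff[OF Hb Ha] by (intro tendsto_ennrealI) simp
  moreover have "(\<lambda>n. emeasure M (A n)) \<longlonglongrightarrow> emeasure M {0<..<x}"
    unfolding U[symmetric] by (intro Lim_emeasure_incseq inc) (auto simp: M_def A_def)
  ultimately have "emeasure M {0<..<x} = ennreal (ext_deriv d \<psi> k (s + rinv \<psi> x))"
    using LIMSEQ_unique by blast
  moreover have "emeasure M {0<..<x} = (\<integral>\<^sup>+u. ?f u * indicator {0<..<x} u \<partial>lborel)"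
    unfolding M_def by (rule emeasure_density) auto
  moreover have "(\<integral>\<^sup>+u. ?f u * indicator {0<..<x} u \<partial>lborel) = (\<integral>\<^sup>+u. ?f u * indicator {..x} u \<partial>lborel)"
  proof (rule nn_integral_cong_AE)
    have "AE u in lborel. u \<noteq> x" by (rule AE_lborel_singleton)
    then show "AE u in lborel. ?f u * indicator {0<..<x} u = ?f u * indicator {..x} u"
      by eventually_elim (auto simp: indicator_def rinv_weight_def)
  qed
  ultimately show ?thesis by simp
qed

text \<open>Each integration lowers the order by one. The offset \<open>s\<close> carries the
  contributions of coordinates held fixed; the induction hypothesis is used at order
  \<open>Suc j\<close> with the last coordinate added to \<open>s\<close>, and that coordinate is
  integrated afterwards.\<close>

lemma nn_integral_box_aux:
  assumes "j + k \<le> d - 1" "0 \<le> s" "0 < s \<or> j = 0" "\<And>i. i < k \<Longrightarrow> 0 < x i \<and> x i \<le> 1"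
  shows "(\<integral>\<^sup>+y. ennreal (ext_deriv d \<psi> (j + k) (s + (\<Sum>i<k. ext_rinv \<psi> (y i))) * (\<Prod>i<k. rinv_weight d \<psi> (y i)))
      * indicator {y. \<forall>i<k. y i \<le> x i} y \<partial>leb k) = ennreal (ext_deriv d \<psi> j (s + (\<Sum>i<k. rinv \<psi> (x i))))"
  using assms
proof (induction k arbitrary: j s)
  case 0
  interpret product_sigma_finite "\<lambda>_::nat. lborel :: real measure" ..
  show ?case by (simp add: PiM_empty nn_integral_count_space_finite)
next
  case (Suc k)
  interpret product_sigma_finite "\<lambda>_::nat. lborel :: real measure" ..
  have [measurable]: "ext_deriv d \<psi> (j + Suc k) \<in> borel_measurable borel"
    using Suc.prems by (intro ext_deriv_measurable) simp
  let ?w = "rinv_weight d \<psi>"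
  let ?f = "\<lambda>n s y. ennreal (ext_deriv d \<psi> (j + Suc k) (s + (\<Sum>i<n. ext_rinv \<psi> (y i))) * (\<Prod>i<n. ?w (y i)))
      * indicator {y. \<forall>i<n. y i \<le> x i} y"
  have ins: "{..<Suc k} = insert k {..<k}" by auto
  have meas: "?f n s' \<in> borel_measurable (leb n)" for n s'
  proof -
    have "(\<lambda>y. indicator {y. \<forall>i<n. y i \<le> x i} y :: ennreal) = (\<lambda>y. \<Prod>i<n. indicator {..x i} (y i))"
      by (auto simp: fun_eq_iff indicator_def prod_zero_iff)
    then show ?thesis by (simp only:) measurable
  qed
  have "(\<integral>\<^sup>+y. ?f (Suc k) s y \<partial>leb (Suc k)) = (\<integral>\<^sup>+t. (\<integral>\<^sup>+y. ?f (Suc k) s (y(k := t)) \<partial>leb k) \<partial>lborel)"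
    unfolding ins using meas[where n = "Suc k" and s' = s] ins
    by (intro product_nn_integral_insert_rev) simp_all
  also have "\<dots> = (\<integral>\<^sup>+t. ennreal (ext_deriv d \<psi> (Suc j) (s + (\<Sum>i<k. rinv \<psi> (x i)) + ext_rinv \<psi> t) * ?w t)
      * indicator {..x k} t \<partial>lborel)"
  proof (rule nn_integral_cong)
    fix t :: real
    have eq: "?f (Suc k) s (y(k := t)) = ennreal (?w t) * indicator {..x k} t * ?f k (s + ext_rinv \<psi> t) y" for y
    proof -
      have "(\<Sum>i<k. ext_rinv \<psi> ((y(k := t)) i)) = (\<Sum>i<k. ext_rinv \<psi> (y i))"
        "(\<Prod>i<k. ?w ((y(k := t)) i)) = (\<Prod>i<k. ?w (y i))"
        by (intro sum.cong prod.cong; simp)+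
      moreover have "indicator {y. \<forall>i<Suc k. y i \<le> x i} (y(k := t)) =
          (indicator {..x k} t * indicator {y. \<forall>i<k. y i \<le> x i} y :: ennreal)"
        by (auto simp: indicator_def less_Suc_eq)
      moreover have "0 \<le> (\<Prod>i<k. ?w (y i))" by (intro prod_nonneg) simp
      ultimately show ?thesis
        using Suc.prems(1)
        by (simp add: ennreal_mult ext_deriv_nonneg ac_simps)
    qed
    show "(\<integral>\<^sup>+y. ?f (Suc k) s (y(k := t)) \<partial>leb k) =
        ennreal (ext_deriv d \<psi> (Suc j) (s + (\<Sum>i<k. rinv \<psi> (x i)) + ext_rinv \<psi> t) * ?w t) * indicator {..x k} t"
    proof (cases "t \<in> {0<..<1}")
      case True
      then have "0 < ext_rinv \<psi> t" by (simp add: ext_rinv_def rinv_pos_iff)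
      then have "(\<integral>\<^sup>+y. ?f k (s + ext_rinv \<psi> t) y \<partial>leb k)
          = ennreal (ext_deriv d \<psi> (Suc j) (s + ext_rinv \<psi> t + (\<Sum>i<k. rinv \<psi> (x i))))"
        using Suc.IH[of "Suc j" "s + ext_rinv \<psi> t"] Suc.prems by simp
      then show ?thesis
        unfolding eq using meas[where n = k and s' = "s + ext_rinv \<psi> t"] Suc.prems(1)
        by (simp add: nn_integral_cmult ennreal_mult ext_deriv_nonneg ac_simps)
    next
      case False
      \<comment> \<open>Outside \<open>(0, 1)\<close> the offset need not become positive, as the
        induction hypothesis requires; the zero weight settles this case.\<close>
      then have "?w t = 0" unfolding rinv_weight_def by (rule if_not_P)
      then show ?thesis unfolding eq by simp
    qed
  qed
  also have "\<dots> = ennreal (ext_deriv d \<psi> j (s + (\<Sum>i<k. rinv \<psi> (x i)) + rinv \<psi> (x k)))"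
    using Suc.prems by (intro nn_integral_ext_deriv) (auto intro!: add_nonneg_nonneg add_pos_nonneg sum_nonneg)
  finally show ?case by (simp add: add.assoc)
qed

lemma copula_density_nonneg [simp]: "0 \<le> copula_density d \<psi> y"
  unfolding copula_density_def by (intro mult_nonneg_nonneg prod_nonneg ext_deriv_nonneg) auto

lemma copula_density_measurable [measurable]: "copula_density d \<psi> \<in> borel_measurable (leb (d - 1))"
proof -
  have [measurable]: "ext_deriv d \<psi> (d - 1) \<in> borel_measurable borel" by (rule ext_deriv_measurable) simp
  show ?thesis unfolding copula_density_def[abs_def] by measurable
qed

lemma copula_density_eq_0: "i < d - 1 \<Longrightarrow> y i \<notin> {0<..<1} \<Longrightarrow> copula_density d \<psi> y = 0"
  unfolding copula_density_def by (rule disjI2[THEN mult_eq_0_iff[THEN iffD2]], rule prod_zero)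
    (auto simp: rinv_weight_def)

lemma arch_copula_marginal:
  "arch_copula d \<psi> (x(d - 1 := 1)) = psi_ext \<psi> (\<Sum>i<d - 1. pseudo_inv \<psi> (x i))"
proof -
  have "{..<d} = insert (d - 1) {..<d - 1}" using d3 by auto
  moreover have "(\<Sum>i<d - 1. pseudo_inv \<psi> ((x(d - 1 := 1)) i)) = (\<Sum>i<d - 1. pseudo_inv \<psi> (x i))"
    by (intro sum.cong) auto
  ultimately show ?thesis by (simp add: arch_copula_def)
qed

lemma sum_pseudo_inv:
  assumes "\<And>i. i \<in> I \<Longrightarrow> 0 < x i \<and> x i \<le> 1"
  shows "(\<Sum>i\<in>I. pseudo_inv \<psi> (x i)) = ereal (\<Sum>i\<in>I. rinv \<psi> (x i))"
  using assms by (simp add: ereal_rinv)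

text \<open>The box is unbounded below, but the density vanishes there. A coordinate
  \<open>x i = 0\<close> is treated apart since its pseudo-inverse may be infinite; both sides are
  then 0.\<close>

lemma nn_integral_copula_density:
  assumes x: "\<And>i. i < d - 1 \<Longrightarrow> 0 \<le> x i \<and> x i \<le> 1"
  shows "(\<integral>\<^sup>+y. ennreal (copula_density d \<psi> y) * indicator {y. \<forall>i<d - 1. y i \<le> x i} y \<partial>leb (d - 1))
    = ennreal (arch_copula d \<psi> (x(d - 1 := 1)))"
proof (cases "\<forall>i<d - 1. 0 < x i")
  case True
  then have x': "\<And>i. i < d - 1 \<Longrightarrow> 0 < x i \<and> x i \<le> 1" using x by auto
  have "(\<Sum>i<d - 1. pseudo_inv \<psi> (x i)) = ereal (\<Sum>i<d - 1. rinv \<psi> (x i))"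
    using x' by (intro sum_pseudo_inv) auto
  then have "arch_copula d \<psi> (x(d - 1 := 1)) = ext_deriv d \<psi> 0 (\<Sum>i<d - 1. rinv \<psi> (x i))"
    unfolding arch_copula_marginal by (simp add: ext_deriv_0 sum_nonneg)
  then show ?thesis
    using nn_integral_box_aux[of 0 "d - 1" 0 x, OF _ _ _ x'] by (simp add: copula_density_def)
next
  case False
  then obtain i where i: "i < d - 1" "x i = 0" using x by force
  have zero: "ennreal (copula_density d \<psi> y) * indicator {y. \<forall>i<d - 1. y i \<le> x i} y = 0" for y
    using copula_density_eq_0[OF i(1), of y] i by (auto simp: indicator_def)
  have "pseudo_inv \<psi> (x i) \<le> (\<Sum>i<d - 1. pseudo_inv \<psi> (x i))"
    using i sum_mono2[of "{..<d - 1}" "{i}" "\<lambda>i. pseudo_inv \<psi> (x i)"] by simp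
  then have "psi_ext \<psi> (\<Sum>i<d - 1. pseudo_inv \<psi> (x i)) = 0"
    using i by (simp add: pseudo_inv_0_le sum_nonneg)
  then show ?thesis unfolding arch_copula_marginal zero by simp
qed

lemma arch_copula_marginal_1: "arch_copula d \<psi> ((\<lambda>_. 1)(d - 1 := 1)) = 1"
  unfolding arch_copula_marginal by (simp add: psi_ext_def)

lemma nn_integral_copula_density_UNIV: "(\<integral>\<^sup>+y. ennreal (copula_density d \<psi> y) \<partial>leb (d - 1)) = 1"
proof -
  have "copula_density d \<psi> y = 0" if "\<not> (\<forall>i<d - 1. y i \<le> 1)" for y
    using that copula_density_eq_0 by auto
  then have "(\<integral>\<^sup>+y. ennreal (copula_density d \<psi> y) \<partial>leb (d - 1)) =
      (\<integral>\<^sup>+y. ennreal (copula_density d \<psi> y) * indicator {y. \<forall>i<d - 1. y i \<le> 1} y \<partial>leb (d - 1))"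
    by (intro nn_integral_cong) (auto simp: indicator_def)
  then show ?thesis using nn_integral_copula_density[of "\<lambda>_. 1"] arch_copula_marginal_1 by simp
qed

lemma copula_density_integrable: "integrable (leb (d - 1)) (copula_density d \<psi>)"
  by (rule integrableI_nonneg[OF copula_density_measurable])
    (simp_all add: nn_integral_copula_density_UNIV del: One_nat_def)

end

section \<open>Uniqueness of densities with given integrals over boxes\<close>

lemma sets_leb_eq_boxes:
  "sets (leb k) = sigma_sets ({..<k} \<rightarrow>\<^sub>E UNIV) (range (\<lambda>a. ({..<k} \<rightarrow>\<^sub>E UNIV) \<inter> {y. \<forall>i<k. y i \<le> a i}))"
proof -
  let ?E = "range (\<lambda>a::real. {..a})"
  have "sets (leb k) = sets (PiM {..<k} (\<lambda>_. sigma UNIV ?E))"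
    using borel_eq_atMost[where 'a = real] by (intro sets_PiM_cong refl) simp
  also have "\<dots> = sets (sigma ({..<k} \<rightarrow>\<^sub>E UNIV)
      {{f \<in> {..<k} \<rightarrow>\<^sub>E UNIV. \<forall>i\<in>j. f i \<in> A i} | A j. j \<in> {{..<k}} \<and> A \<in> j \<rightarrow> ?E})"
  proof (rule sets_PiM_sigma)
    have "(UNIV :: real set) = \<Union> (range (\<lambda>n. {..real n}))"
      using real_arch_simple by auto
    then show "\<exists>S\<subseteq>?E. countable S \<and> (UNIV :: real set) = \<Union>S" if "i \<in> {..<k}" for i
      by (intro exI[of _ "range (\<lambda>n. {..real n})"]) auto
  qed auto
  also have "{{f \<in> {..<k} \<rightarrow>\<^sub>E UNIV. \<forall>i\<in>j. f i \<in> A i} | A j. j \<in> {{..<k}} \<and> A \<in> j \<rightarrow> ?E}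
      = range (\<lambda>a. ({..<k} \<rightarrow>\<^sub>E UNIV) \<inter> {y. \<forall>i<k. y i \<le> a i})" (is "?L = ?R")
  proof safe
    fix A :: "nat \<Rightarrow> real set" assume "A \<in> {..<k} \<rightarrow> ?E"
    then have "\<forall>i\<in>{..<k}. \<exists>a. A i = {..a}" by blast
    then obtain a where "\<forall>i\<in>{..<k}. A i = {..a i}" by metis
    then show "{f \<in> {..<k} \<rightarrow>\<^sub>E UNIV. \<forall>i\<in>{..<k}. f i \<in> A i} \<in> ?R"
      by (intro image_eqI[of _ _ a]) auto
  next
    fix a :: "nat \<Rightarrow> real"
    have "({..<k} \<rightarrow>\<^sub>E UNIV) \<inter> {y. \<forall>i<k. y i \<le> a i} = {f \<in> {..<k} \<rightarrow>\<^sub>E UNIV. \<forall>i\<in>{..<k}. f i \<in> {..a i}}"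
      by auto
    then show "\<exists>A j. ({..<k} \<rightarrow>\<^sub>E UNIV) \<inter> {y. \<forall>i<k. y i \<le> a i} = {f \<in> {..<k} \<rightarrow>\<^sub>E UNIV. \<forall>i\<in>j. f i \<in> A i} \<and>
        j \<in> {{..<k}} \<and> A \<in> j \<rightarrow> ?E"
      by (intro exI[of _ "\<lambda>i. {..a i}"] exI[of _ "{..<k}"]) auto
  qed
  finally show ?thesis by (simp add: sets_measure_of_conv PiE_def Pow_def subset_eq)
qed

text \<open>The box is a set of arbitrary functions; its trace on the extensional functions of the
  product space is what is measurable.\<close>

lemma box_indicator_measurable:
  "indicat_real {y. \<forall>i<k. y i \<le> a i} \<in> borel_measurable (leb k)"
proof -
  have "{y. \<forall>i<k. y i \<le> a i} \<inter> space (leb k) \<in> sets (leb k)"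
    unfolding sets_leb_eq_boxes space_PiM by (auto simp: Int_commute)
  then show ?thesis unfolding borel_measurable_indicator_iff .
qed

text \<open>Uniqueness on an intersection-stable generator concerns measures, so the signed
  difference \<open>g\<close> is split: its positive and negative parts are densities of two
  measures that agree on boxes, hence they agree almost everywhere, which forces
  \<open>g = 0\<close>.\<close>

lemma AE_eq_of_box_integrals:
  fixes c e :: "(nat \<Rightarrow> real) \<Rightarrow> real"
  assumes c: "integrable (leb k) c" and e: "integrable (leb k) e"
    and eq: "\<And>a. (\<integral>y. indicator {y. \<forall>i<k. y i \<le> a i} y * c y \<partial>leb k) =
      (\<integral>y. indicator {y. \<forall>i<k. y i \<le> a i} y * e y \<partial>leb k)"
  shows "AE y in leb k. c y = e y"
proof -
  interpret product_sigma_finite "\<lambda>_::nat. lborel :: real measure" ..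
  interpret L: sigma_finite_measure "leb k" by (rule sigma_finite) simp
  define g where "g y = c y - e y" for y
  have g: "integrable (leb k) g" unfolding g_def using c e by simp
  then have [measurable]: "g \<in> borel_measurable (leb k)" by simp
  have fin: "(\<integral>\<^sup>+y. ennreal (g y) \<partial>leb k) < \<infinity>" "(\<integral>\<^sup>+y. ennreal (- g y) \<partial>leb k) < \<infinity>"
    using g by (auto simp: real_integrable_def less_top)
  define B where "B a = ({..<k} \<rightarrow>\<^sub>E UNIV) \<inter> {y :: nat \<Rightarrow> real. \<forall>i<k. y i \<le> a i}" for a
  have setsB: "B a \<in> sets (leb k)" for a unfolding sets_leb_eq_boxes B_def by auto
  \<comment> \<open>\<open>ennreal\<close> truncates negative reals to 0, so these are the positive
    and the negative part of \<open>g\<close>.\<close>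
  have "density (leb k) (\<lambda>y. ennreal (g y)) = density (leb k) (\<lambda>y. ennreal (- g y))"
  proof (rule measure_eqI_generator_eq)
    show "Int_stable (range B)"
    proof (rule Int_stableI_image)
      fix a b :: "nat \<Rightarrow> real"
      have "B a \<inter> B b = B (\<lambda>i. min (a i) (b i))" by (auto simp: B_def)
      then show "\<exists>c\<in>UNIV. B a \<inter> B b = B c" by auto
    qed
    show "range B \<subseteq> Pow ({..<k} \<rightarrow>\<^sub>E UNIV)" by (auto simp: B_def)
    show "sets (density (leb k) (\<lambda>y. ennreal (g y))) = sigma_sets ({..<k} \<rightarrow>\<^sub>E UNIV) (range B)"
      "sets (density (leb k) (\<lambda>y. ennreal (- g y))) = sigma_sets ({..<k} \<rightarrow>\<^sub>E UNIV) (range B)"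
      unfolding sets_density by (simp_all only: sets_leb_eq_boxes B_def[abs_def])
    show "range (\<lambda>n. B (\<lambda>_. real n)) \<subseteq> range B" by auto
    show "(\<Union>n. B (\<lambda>_. real n)) = {..<k} \<rightarrow>\<^sub>E UNIV"
    proof safe
      fix y :: "nat \<Rightarrow> real" assume y: "y \<in> {..<k} \<rightarrow>\<^sub>E UNIV"
      obtain n where n: "(\<Sum>i<k. \<bar>y i\<bar>) \<le> real n" using real_arch_simple by blast
      have "y i \<le> real n" if "i < k" for i
        using member_le_sum[of i "{..<k}" "\<lambda>i. \<bar>y i\<bar>"] that n by simp
      then show "y \<in> (\<Union>n. B (\<lambda>_. real n))" using y by (auto simp: B_def)
    qed (auto simp: B_def)
    show "emeasure (density (leb k) (\<lambda>y. ennreal (g y))) (B (\<lambda>_. real n)) \<noteq> \<infinity>" for n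
    proof -
      have "emeasure (density (leb k) (\<lambda>y. ennreal (g y))) (B (\<lambda>_. real n)) \<le> (\<integral>\<^sup>+y. ennreal (g y) \<partial>leb k)"
        by (subst emeasure_density[OF _ setsB]) (auto intro!: nn_integral_mono simp: indicator_def)
      then show ?thesis using fin by (auto simp: top_unique)
    qed
    fix X assume "X \<in> range B"
    then obtain a where X: "X = B a" by blast
    have [measurable]: "X \<in> sets (leb k)" using setsB X by simp
    let ?h = "\<lambda>y. indicator X y * g y"
    have h: "integrable (leb k) ?h"
      using integrable_mult_indicator[OF _ g, of X] by simp
    have ind: "indicat_real X y = indicat_real {y. \<forall>i<k. y i \<le> a i} y" if "y \<in> space (leb k)" for y
      using that by (auto simp: indicator_def X B_def space_PiM)
    have split: "?h y = indicator X y * c y - indicator X y * e y" for y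
      by (simp add: g_def right_diff_distrib)
    have "integral\<^sup>L (leb k) ?h = (\<integral>y. indicator X y * c y \<partial>leb k) - (\<integral>y. indicator X y * e y \<partial>leb k)"
      unfolding split using integrable_mult_indicator[OF _ c, of X] integrable_mult_indicator[OF _ e, of X]
      by (intro Bochner_Integration.integral_diff) simp_all
    also have "\<dots> = 0"
      using eq[of a] ind by (simp cong: Bochner_Integration.integral_cong)
    finally have 0: "enn2real (\<integral>\<^sup>+y. ennreal (?h y) \<partial>leb k) = enn2real (\<integral>\<^sup>+y. ennreal (- ?h y) \<partial>leb k)"
      using real_lebesgue_integral_def[OF h] by simp
    \<comment> \<open>Integrability makes both integrals finite, so equality of their real values
      lifts back to \<open>ennreal\<close>.\<close>
    have "(\<integral>\<^sup>+y. ennreal (?h y) \<partial>leb k) = (\<integral>\<^sup>+y. ennreal (- ?h y) \<partial>leb k)"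
      using 0 h by (auto simp: real_integrable_def ennreal_enn2real_if less_top[symmetric]
          dest: arg_cong[of "enn2real _" _ ennreal])
    moreover have "ennreal (?h y) = ennreal (g y) * indicator X y"
      "ennreal (- ?h y) = ennreal (- g y) * indicator X y" for y
      by (auto simp: indicator_def)
    ultimately show "emeasure (density (leb k) (\<lambda>y. ennreal (g y))) X =
        emeasure (density (leb k) (\<lambda>y. ennreal (- g y))) X"
      by (simp add: emeasure_density)
  qed
  then have "AE y in leb k. ennreal (g y) = ennreal (- g y)"
    by (subst (asm) L.density_unique_iff) auto
  then show ?thesis
  proof eventually_elim
    case (elim y)
    then have "g y = 0"
      by (cases "0 \<le> g y") (auto simp: ennreal_neg ennreal_eq_0_iff dest: sym)
    then show ?case by (simp add: g_def)
  qed
qed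

context ar_gen
begin

lemma integral_copula_density:
  assumes x: "\<And>i. i < d - 1 \<Longrightarrow> 0 \<le> x i \<and> x i \<le> 1"
  shows "(\<integral>y. indicator {y. \<forall>i<d - 1. y i \<le> x i} y * copula_density d \<psi> y \<partial>leb (d - 1))
    = arch_copula d \<psi> (x(d - 1 := 1))"
proof (rule integral_eq_nn_integral[THEN trans])
  have "0 \<le> arch_copula d \<psi> (x(d - 1 := 1))" unfolding arch_copula_marginal by (rule psi_ext_bounds)
  moreover have "(\<integral>\<^sup>+y. ennreal (indicat_real {y. \<forall>i<d - 1. y i \<le> x i} y * copula_density d \<psi> y) \<partial>leb (d - 1))
      = ennreal (arch_copula d \<psi> (x(d - 1 := 1)))"
    by (rule trans[OF nn_integral_cong nn_integral_copula_density[OF x]]) (auto simp: indicator_def)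
  ultimately show "enn2real (\<integral>\<^sup>+y. ennreal (indicat_real {y. \<forall>i<d - 1. y i \<le> x i} y * copula_density d \<psi> y) \<partial>leb (d - 1))
      = arch_copula d \<psi> (x(d - 1 := 1))" by simp
  show "(\<lambda>y. indicator {y. \<forall>i<d - 1. y i \<le> x i} y * copula_density d \<psi> y) \<in> borel_measurable (leb (d - 1))"
    by (rule borel_measurable_times[OF box_indicator_measurable copula_density_measurable])
qed simp

text \<open>\<open>marginal_density\<close> speaks only of boxes with corner in the cube. For any
  other corner, a negative coordinate makes both integrals 0, and coordinates above 1 can be cut
  down to 1 because both integrands vanish outside the cube.\<close>

lemma marginal_density_AE_eq:
  assumes c: "marginal_density d (arch_copula d \<psi>) c"
  shows "AE y in leb (d - 1). y \<in> cube (d - 1) \<longrightarrow> c y = copula_density d \<psi> y"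
proof -
  let ?I = "\<lambda>a. {y :: nat \<Rightarrow> real. \<forall>i<d - 1. y i \<le> a i}"
  let ?c = "\<lambda>y. indicator (cube (d - 1)) y * c y"
  have int: "integrable (leb (d - 1)) ?c"
    using c by (simp add: marginal_density_def set_integrable_def)
  have "AE y in leb (d - 1). ?c y = copula_density d \<psi> y"
  proof (rule AE_eq_of_box_integrals[OF int copula_density_integrable])
    fix a :: "nat \<Rightarrow> real"
    show "(\<integral>y. indicator (?I a) y * ?c y \<partial>leb (d - 1)) =
        (\<integral>y. indicator (?I a) y * copula_density d \<psi> y \<partial>leb (d - 1))"
    proof (cases "\<exists>i<d - 1. a i < 0")
      case True
      then obtain i where i: "i < d - 1" "a i < 0" by blast
      have "indicator (?I a) y * ?c y = 0" for y
        using i PiE_mem[of y "{..<d - 1}" "\<lambda>_. {0..1}" i] by (force simp: indicator_def cube_def)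
      moreover have "indicator (?I a) y * copula_density d \<psi> y = 0" for y
        using i copula_density_eq_0[of i y] by (force simp: indicator_def)
      ultimately show ?thesis by (simp only:)
    next
      case False
      \<comment> \<open>The restriction makes the clipped corner extensional, as membership in
        \<open>cube\<close> demands.\<close>
      define x where "x = restrict (\<lambda>i. min (a i) 1) {..<d - 1}"
      have a: "\<And>i. i < d - 1 \<Longrightarrow> 0 \<le> a i" using False not_less by blast
      then have x: "x \<in> cube (d - 1)" by (simp add: x_def cube_def del: One_nat_def)
      have xi: "x i = min (a i) 1" if "i < d - 1" for i using that by (simp add: x_def)
      have x01: "0 \<le> x i \<and> x i \<le> 1" if "i < d - 1" for i using xi[OF that] a[OF that] by simp
      have "(\<integral>y. indicator (?I a) y * ?c y \<partial>leb (d - 1)) =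
          (LINT y : ({..<d - 1} \<rightarrow>\<^sub>E UNIV) \<inter> {y. \<forall>i<d - 1. 0 \<le> y i \<and> y i \<le> x i} | leb (d - 1). c y)"
        unfolding set_lebesgue_integral_def
      proof (rule Bochner_Integration.integral_cong[OF refl])
        fix y assume "y \<in> space (leb (d - 1))"
        then have y: "y \<in> {..<d - 1} \<rightarrow>\<^sub>E UNIV" by (simp add: space_PiM)
        then have "y \<in> cube (d - 1) \<longleftrightarrow> (\<forall>i<d - 1. 0 \<le> y i \<and> y i \<le> 1)"
          by (auto simp: cube_def PiE_iff)
        then have "y \<in> ?I a \<inter> cube (d - 1) \<longleftrightarrow> y \<in> ({..<d - 1} \<rightarrow>\<^sub>E UNIV) \<inter> {y. \<forall>i<d - 1. 0 \<le> y i \<and> y i \<le> x i}"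
          using y xi by auto
        then show "indicator (?I a) y * ?c y =
            indicator (({..<d - 1} \<rightarrow>\<^sub>E UNIV) \<inter> {y. \<forall>i<d - 1. 0 \<le> y i \<and> y i \<le> x i}) y *\<^sub>R c y"
          by (auto simp: indicator_def split: if_splits)
      qed
      also have "\<dots> = arch_copula d \<psi> (x(d - 1 := 1))"
        using c x by (simp add: marginal_density_def)
      also have "\<dots> = (\<integral>y. indicator (?I x) y * copula_density d \<psi> y \<partial>leb (d - 1))"
        by (rule integral_copula_density[OF x01, symmetric])
      also have "\<dots> = (\<integral>y. indicator (?I a) y * copula_density d \<psi> y \<partial>leb (d - 1))"
      proof (rule Bochner_Integration.integral_cong[OF refl])
        fix y
        show "indicator (?I x) y * copula_density d \<psi> y = indicator (?I a) y * copula_density d \<psi> y"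
        proof (cases "\<forall>i<d - 1. y i < 1")
          case True
          then have "y \<in> ?I a \<longleftrightarrow> y \<in> ?I x" using xi by (auto simp: less_imp_le)
          then show ?thesis by (auto simp: indicator_def)
        next
          case False
          then have "copula_density d \<psi> y = 0" using copula_density_eq_0[of _ y] by auto
          then show ?thesis by simp
        qed
      qed
      finally show ?thesis .
    qed
  qed
  then show ?thesis by eventually_elim auto
qed

end

section \<open>Kernels\<close>

context ar_gen
begin

lemma sum_rinv_pos:
  assumes x: "\<And>i. i < d - 1 \<Longrightarrow> x i \<in> {0<..<1}"
  shows "0 < (\<Sum>i<d - 1. rinv \<psi> (x i))"
proof (rule sum_pos)
  fix i assume "i \<in> {..<d - 1}"
  then show "0 < rinv \<psi> (x i)" using x[of i] rinv_pos_iff[of "x i"] by simp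
qed (use d1 in auto)

lemma LD_infty: "LD d \<psi> \<infinity> = 0"
  by (simp add: LD_def)

lemma LD_ereal: "LD d \<psi> (ereal t) = (-1) ^ (d - 1) * H (d - 1) t"
  by (simp add: LD_def alt_deriv_def)

text \<open>The signs in \<open>LD\<close> cancel in the quotient. The threshold case of the
  definition merges with it: for \<open>0 < y < \<psi> (z - s)\<close>, with \<open>z\<close> the
  first zero, the numerator is evaluated beyond \<open>z\<close> and is 0. Only \<open>y = 0\<close>
  stays separate, because \<open>rinv \<psi> 0\<close> may be a default value.\<close>

lemma kernel_cdf_interior:
  assumes x: "\<And>i. i < d - 1 \<Longrightarrow> x i \<in> {0<..<1}"
  defines "s \<equiv> \<Sum>i<d - 1. rinv \<psi> (x i)"
  shows "kernel_cdf d \<psi> x y =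
    (if y < 0 then 0 else if 1 \<le> y \<or> \<psi> s = 0 then 1 else if y = 0 then 0
     else H (d - 1) (s + rinv \<psi> y) / H (d - 1) s)"
proof -
  have ne: "{..<d - 1} \<noteq> {}" using d1 by auto
  have s: "0 < s" unfolding s_def by (rule sum_rinv_pos[OF x])
  have sum: "(\<Sum>i<d - 1. pseudo_inv \<psi> (x i)) = ereal s"
    unfolding s_def using x by (intro sum_pseudo_inv) (auto simp: less_imp_le)
  have "Min (x ` {..<d - 1}) \<in> x ` {..<d - 1}" using ne by (intro Min_in) auto
  then have Min: "Min (x ` {..<d - 1}) \<noteq> 1" using x by fastforce
  have zero: "pseudo_inv \<psi> 0 \<le> ereal s \<longleftrightarrow> \<psi> s = 0" using pseudo_inv_0_le[of "ereal s"] s by simp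
  have ratio: "kernel_cdf d \<psi> x y = (if y = 0 then 0 else H (d - 1) (s + rinv \<psi> y) / H (d - 1) s)"
    if y: "0 \<le> y" "y < 1" and nz: "\<psi> s \<noteq> 0"
  proof -
    have k: "kernel_cdf d \<psi> x y = (if y < psi_ext \<psi> (pseudo_inv \<psi> 0 - ereal s) then 0
        else LD d \<psi> (ereal s + pseudo_inv \<psi> y) / LD d \<psi> (ereal s))"
      using y nz Min zero unfolding kernel_cdf_def sum Let_def by simp
    show ?thesis
    proof (cases "pseudo_inv \<psi> 0")
      case (real z)
      have z: "0 \<le> z" using pseudo_inv_nonneg[of \<psi> 0] real by simp
      have pz: "\<psi> z = 0" using pseudo_inv_0_le[of "ereal z"] real z by simp
      have sz: "s < z" using nz antimono[of z s] nonneg[of s] z s pz by (cases "s < z") auto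
      have "\<not> pseudo_inv \<psi> 0 \<le> ereal (z - s)" using real s by simp
      then have pos: "0 < \<psi> (z - s)"
        using pseudo_inv_0_le[of "ereal (z - s)"] sz nonneg[of "z - s"] by simp
      show ?thesis
      proof (cases "y < \<psi> (z - s)")
        case True
        have "H (d - 1) (s + rinv \<psi> y) = 0" if "y \<noteq> 0"
        proof (rule H_eq_0[OF _ z pz])
          show "z < s + rinv \<psi> y"
            using less_rinv_iff[of y "z - s"] True y that sz by simp
        qed simp
        then show ?thesis using True k real sz by auto
      next
        case False
        then have "y \<noteq> 0" using pos by auto
        then show ?thesis using False k real sz y by (simp add: ereal_rinv LD_ereal)
      qed
    next
      case PInf
      then show ?thesis using y k by (simp add: ereal_rinv LD_ereal LD_infty)
    next
      case MInf
      then show ?thesis using pseudo_inv_nonneg[of \<psi> 0] by simp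
    qed
  qed
  consider "y < 0" | "1 \<le> y" | "0 \<le> y" "y < 1" "\<psi> s = 0" | "0 \<le> y" "y < 1" "\<psi> s \<noteq> 0" by linarith
  then show ?thesis
  proof cases
    case 3
    then show ?thesis using zero unfolding kernel_cdf_def sum Let_def by simp
  qed (use ratio in \<open>auto simp: kernel_cdf_def Let_def\<close>)
qed

text \<open>Right continuity is the delicate hypothesis: since \<open>rinv\<close> decreases,
  approaching \<open>a\<close> from the right means approaching \<open>s + rinv \<psi> a\<close>
  from the left, where left derivatives are left continuous. At \<open>a = 0\<close> the decay of
  \<open>H (d - 1)\<close> takes over.\<close>

lemma cdf_kernel:
  assumes x: "\<And>i. i < d - 1 \<Longrightarrow> x i \<in> {0<..<1}"
  shows "cdf (kernel d \<psi> x) = kernel_cdf d \<psi> x"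
  unfolding kernel_def
proof (rule cdf_interval_measure)
  let ?F = "kernel_cdf d \<psi> x"
  define s where "s = (\<Sum>i<d - 1. rinv \<psi> (x i))"
  have F: "?F y = (if y < 0 then 0 else if 1 \<le> y \<or> \<psi> s = 0 then 1 else if y = 0 then 0
     else H (d - 1) (s + rinv \<psi> y) / H (d - 1) s)" for y
    unfolding s_def by (rule kernel_cdf_interior[OF x])
  have s: "0 < s" unfolding s_def by (rule sum_rinv_pos[OF x])
  have Hs: "0 < H (d - 1) s" if "\<psi> s \<noteq> 0"
    using that nonneg[of s] s by (intro H_pos) auto
  have Hn: "0 \<le> H (d - 1) (s + rinv \<psi> y)" for y
    using s by (intro H_nonneg) (auto intro: add_pos_nonneg)
  show "?F y \<le> ?F z" if "y \<le> z" for y z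
  proof -
    have "H (d - 1) (s + rinv \<psi> y) \<le> H (d - 1) (s + rinv \<psi> z)" if "0 < y" "z < 1"
      using that \<open>y \<le> z\<close> s by (intro H_antimono) (auto intro: rinv_antimono add_pos_nonneg)
    moreover have "H (d - 1) (s + rinv \<psi> y) \<le> H (d - 1) s"
      using s by (intro H_antimono) auto
    ultimately show ?thesis
      using that Hn Hs unfolding F by (auto simp: divide_right_mono less_imp_le divide_le_eq)
  qed
  show "continuous (at_right a) ?F" for a
    unfolding continuous_within
  proof -
    have ev: "\<forall>\<^sub>F y in at_right a. a < y \<and> y < b" if "a < b" for b
      using eventually_at_right_real[OF that] by simp
    consider "a < 0" | "1 \<le> a \<or> 0 \<le> a \<and> \<psi> s = 0" | "a = 0" "\<psi> s \<noteq> 0" | "0 < a" "a < 1" "\<psi> s \<noteq> 0"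
      by linarith
    then show "(?F \<longlongrightarrow> ?F a) (at_right a)"
    proof cases
      case 1
      then have "\<forall>\<^sub>F y in at_right a. ?F y = ?F a"
        using ev[of 0] by (auto elim!: eventually_mono simp: F)
      then show ?thesis by (rule tendsto_eventually)
    next
      case 2
      then have "\<forall>\<^sub>F y in at_right a. ?F y = ?F a"
        using ev[of "a + 1"] by (auto elim!: eventually_mono simp: F)
      then show ?thesis by (rule tendsto_eventually)
    next
      case 3
      have pos: "\<forall>\<^sub>F y in at_right 0. 0 < y \<and> y < (1::real)"
        using ev[of 1] 3 by simp
      have "((\<lambda>y. H (d - 1) (s + rinv \<psi> y)) \<longlongrightarrow> 0) (at_right 0)"
      proof (rule H_tendsto_0[OF order_refl s])
        have "\<forall>\<^sub>F y in at_right 0. y = \<psi> (rinv \<psi> y)"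
          using pos by eventually_elim (simp add: psi_rinv)
        then show "((\<lambda>y. \<psi> (rinv \<psi> y)) \<longlongrightarrow> 0) (at_right 0)"
          using tendsto_cong[THEN iffD1, OF _ tendsto_ident_at] by fast
      qed simp
      from tendsto_divide[OF this tendsto_const[of "H (d - 1) s"]] Hs 3
      have "((\<lambda>y. H (d - 1) (s + rinv \<psi> y) / H (d - 1) s) \<longlongrightarrow> ?F a) (at_right a)"
        by (simp add: F)
      moreover have "\<forall>\<^sub>F y in at_right a. H (d - 1) (s + rinv \<psi> y) / H (d - 1) s = ?F y"
        using pos 3 by (auto elim!: eventually_mono simp: F)
      ultimately show ?thesis using tendsto_cong by fast
    next
      case 4
      have near: "\<forall>\<^sub>F y in at_right a. a < y \<and> y < 1" using ev 4 by simp
      \<comment> \<open>Strict monotonicity of \<open>rinv\<close> keeps the argument strictly to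
        the left of \<open>s + rinv \<psi> a\<close>.\<close>
      have "filterlim (\<lambda>y. s + rinv \<psi> y) (at_left (s + rinv \<psi> a)) (at_right a)"
        unfolding filterlim_at
      proof
        show "\<forall>\<^sub>F y in at_right a. s + rinv \<psi> y \<in> {..<s + rinv \<psi> a} \<and> s + rinv \<psi> y \<noteq> s + rinv \<psi> a"
          using near
        proof eventually_elim
          case (elim y)
          then show ?case using rinv_strict_antimono[of a y] 4 by simp
        qed
        show "((\<lambda>y. s + rinv \<psi> y) \<longlongrightarrow> s + rinv \<psi> a) (at_right a)"
          using isCont_rinv[of a] 4 by (intro tendsto_intros) (auto simp: isCont_def filterlim_at_split)
      qed
      moreover have "0 < s + rinv \<psi> a" using s by (intro add_pos_nonneg) auto
      ultimately have "((\<lambda>y. H (d - 1) (s + rinv \<psi> y)) \<longlongrightarrow> H (d - 1) (s + rinv \<psi> a)) (at_right a)"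
        using filterlim_compose[OF H_left_continuous] by blast
      from tendsto_divide[OF this tendsto_const[of "H (d - 1) s"]] Hs 4
      have "((\<lambda>y. H (d - 1) (s + rinv \<psi> y) / H (d - 1) s) \<longlongrightarrow> ?F a) (at_right a)"
        by (simp add: F)
      moreover have "\<forall>\<^sub>F y in at_right a. H (d - 1) (s + rinv \<psi> y) / H (d - 1) s = ?F y"
        using near by eventually_elim (use 4 in \<open>simp add: F\<close>)
      ultimately show ?thesis using tendsto_cong by fast
    qed
  qed
  have "\<forall>\<^sub>F y in at_bot. ?F y = 0"
    using eventually_at_bot_dense[of "\<lambda>y. ?F y = 0"] by (auto simp: F)
  then show "(?F \<longlongrightarrow> 0) at_bot" by (rule tendsto_eventually)
qed

end

section \<open>Weak convergence of the kernels\<close>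

context ar_seq
begin

text \<open>Both parts of the quotient converge along moving arguments. For the denominator,
  continuity at the limit is the hypothesis \<open>cont\<close>; for the numerator it is derived
  from \<open>y\<close> being a continuity point of the limiting distribution function.\<close>

lemma kernel_weak_conv:
  assumes inv: "\<And>y. 0 < y \<Longrightarrow> y \<le> 1 \<Longrightarrow> (\<lambda>n. rinv (\<psi>s n) y) \<longlonglongrightarrow> rinv \<psi> y"
    and x: "\<And>i. i < d - 1 \<Longrightarrow> x i \<in> {0<..<1}"
    and pos: "0 < \<psi> (\<Sum>i<d - 1. rinv \<psi> (x i))"
    and cont: "isCont (lim.H (d - 1)) (\<Sum>i<d - 1. rinv \<psi> (x i))"
  shows "weak_conv_m (\<lambda>n. kernel d (\<psi>s n) x) (kernel d \<psi> x)"
  unfolding weak_conv_m_def weak_conv_def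
proof (intro allI impI)
  define s where "s = (\<Sum>i<d - 1. rinv \<psi> (x i))"
  define sn where "sn n = (\<Sum>i<d - 1. rinv (\<psi>s n) (x i))" for n
  have F: "kernel_cdf d \<psi> x y = (if y < 0 then 0 else if 1 \<le> y \<or> \<psi> s = 0 then 1 else if y = 0 then 0
     else lim.H (d - 1) (s + rinv \<psi> y) / lim.H (d - 1) s)" for y
    unfolding s_def by (rule lim.kernel_cdf_interior[OF x])
  have Fn: "kernel_cdf d (\<psi>s n) x y = (if y < 0 then 0 else if 1 \<le> y \<or> \<psi>s n (sn n) = 0 then 1
     else if y = 0 then 0 else seq.H n (d - 1) (sn n + rinv (\<psi>s n) y) / seq.H n (d - 1) (sn n))" for n y
    unfolding sn_def by (rule seq.kernel_cdf_interior[OF x])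
  have pw: "(\<lambda>n. \<psi>s n x) \<longlonglongrightarrow> \<psi> x" if "0 < x" for x using psi_tendsto_of_rinv[OF inv] that by simp
  have s: "0 < s" unfolding s_def by (rule lim.sum_rinv_pos[OF x])
  have ps: "0 < \<psi> s" using pos by (simp add: s_def)
  have Hs: "0 < lim.H (d - 1) s" using s ps by (intro lim.H_pos) auto
  have sn: "sn \<longlonglongrightarrow> s"
    unfolding sn_def s_def using x by (intro tendsto_sum inv) (auto simp: less_imp_le)
  have d: "d - 2 < d - 1" "Suc (d - 2) = d - 1" using lim.d3 by auto
  have moving: "(\<lambda>n. seq.H n (d - 1) (X n)) \<longlonglongrightarrow> lim.H (d - 1) z"
    if "0 < z" "isCont (lim.H (d - 1)) z" "X \<longlonglongrightarrow> z" for X z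
    using H_tendsto_moving[OF pw d(1) that(1) _ that(3)] that(2) unfolding d(2) by blast
  have evpos: "\<forall>\<^sub>F n in sequentially. \<psi>s n (sn n) \<noteq> 0"
  proof -
    \<comment> \<open>A point with half the value of \<open>\<psi>\<close> at \<open>s\<close> lies
      beyond \<open>s\<close>, hence eventually beyond \<open>sn n\<close>; positivity of
      \<open>\<psi>s n\<close> there passes to \<open>sn n\<close> by monotonicity.\<close>
    have half: "0 < \<psi> s / 2" "\<psi> s / 2 \<le> 1" using ps lim.le_1[of s] s by auto
    have "s < rinv \<psi> (\<psi> s / 2)" using lim.less_rinv_iff[OF half, of s] s ps by simp
    then have lt: "\<forall>\<^sub>F n in sequentially. sn n < rinv \<psi> (\<psi> s / 2)" using sn order_tendstoD(2) by blast
    have r: "0 < rinv \<psi> (\<psi> s / 2)" using s \<open>s < rinv \<psi> (\<psi> s / 2)\<close> by simp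
    have "0 < \<psi> (rinv \<psi> (\<psi> s / 2))" using lim.psi_rinv[OF half] half by simp
    from order_tendstoD(1)[OF pw[OF r] this] lt show ?thesis
    proof eventually_elim
      case (elim n)
      have "\<psi>s n (rinv \<psi> (\<psi> s / 2)) \<le> \<psi>s n (sn n)"
        using elim by (intro seq.antimono) (auto simp: sn_def intro!: sum_nonneg)
      then show ?case using elim by simp
    qed
  qed
  fix y assume "isCont (cdf (kernel d \<psi> x)) y"
  then have c: "isCont (kernel_cdf d \<psi> x) y" by (simp only: lim.cdf_kernel[OF x])
  have "(\<lambda>n. kernel_cdf d (\<psi>s n) x y) \<longlonglongrightarrow> kernel_cdf d \<psi> x y"
  proof (cases "0 < y \<and> y < 1")
    \<comment> \<open>Outside \<open>(0, 1)\<close> the values agree exactly; \<open>evpos\<close>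
      matters at \<open>y = 0\<close>, where \<open>kernel_cdf\<close> would be 1 if the generator
      vanished at the sum.\<close>
    case False
    have "\<forall>\<^sub>F n in sequentially. kernel_cdf d (\<psi>s n) x y = kernel_cdf d \<psi> x y"
      using evpos by eventually_elim (use False ps in \<open>auto simp: F Fn\<close>)
    then show ?thesis by (rule tendsto_eventually)
  next
    case True
    let ?z = "s + rinv \<psi> y"
    have z: "0 < ?z" using s by (intro add_pos_nonneg) auto
    have r: "0 < rinv \<psi> y" "\<psi> (rinv \<psi> y) = y" using True by (auto simp: lim.rinv_pos_iff lim.psi_rinv)
    \<comment> \<open>The substitution \<open>y = \<psi> (z - s)\<close> transports continuity of
      the distribution function at \<open>y\<close> to continuity of \<open>lim.H (d - 1)\<close> at
      \<open>?z\<close>.\<close>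
    have "isCont (\<lambda>z. z - s) ?z" by (intro continuous_intros)
    moreover have "isCont \<psi> (?z - s)" using lim.isCont_psi[OF r(1)] by simp
    ultimately have cpsi: "isCont (\<lambda>z. \<psi> (z - s)) ?z" by (rule isCont_o2)
    moreover have "isCont (kernel_cdf d \<psi> x) (\<psi> (?z - s))" using c r by simp
    ultimately have "isCont (\<lambda>z. kernel_cdf d \<psi> x (\<psi> (z - s))) ?z" by (rule isCont_o2)
    then have cz: "isCont (\<lambda>z. lim.H (d - 1) s * kernel_cdf d \<psi> x (\<psi> (z - s))) ?z"
      by (rule isCont_mult[OF continuous_const])
    have "\<forall>\<^sub>F z in nhds ?z. s < z \<and> 0 < \<psi> (z - s)"
    proof (rule eventually_conj)
      show "\<forall>\<^sub>F z in nhds ?z. s < z" by (rule order_tendstoD(1)[OF filterlim_ident]) (use r in simp)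
      have "((\<lambda>z. \<psi> (z - s)) \<longlongrightarrow> \<psi> (?z - s)) (nhds ?z)"
        using cpsi tendsto_at_iff_tendsto_nhds[of "\<lambda>z. \<psi> (z - s)" ?z] by (simp add: isCont_def)
      then show "\<forall>\<^sub>F z in nhds ?z. 0 < \<psi> (z - s)"
        by (rule order_tendstoD(1)) (use r True in simp)
    qed
    then have "\<forall>\<^sub>F z in nhds ?z. lim.H (d - 1) s * kernel_cdf d \<psi> x (\<psi> (z - s)) = lim.H (d - 1) z"
    proof eventually_elim
      case (elim z)
      have "\<psi> (z - s) < 1" using lim.strict[of 0 "z - s"] elim by simp
      then show ?case using elim Hs ps lim.rinv_psi[of "z - s"] by (simp add: F)
    qed
    then have "isCont (lim.H (d - 1)) ?z" using cz isCont_cong by fast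
    moreover have "(\<lambda>n. sn n + rinv (\<psi>s n) y) \<longlonglongrightarrow> ?z" using True by (intro tendsto_intros sn inv) auto
    ultimately have "(\<lambda>n. seq.H n (d - 1) (sn n + rinv (\<psi>s n) y)) \<longlonglongrightarrow> lim.H (d - 1) ?z"
      by (rule moving[OF z])
    moreover have "(\<lambda>n. seq.H n (d - 1) (sn n)) \<longlonglongrightarrow> lim.H (d - 1) s"
      by (rule moving[OF s _ sn]) (use cont in \<open>simp add: s_def\<close>)
    ultimately have "(\<lambda>n. seq.H n (d - 1) (sn n + rinv (\<psi>s n) y) / seq.H n (d - 1) (sn n))
        \<longlonglongrightarrow> lim.H (d - 1) ?z / lim.H (d - 1) s"
      using Hs by (intro tendsto_divide) auto
    moreover have "\<forall>\<^sub>F n in sequentially.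
        seq.H n (d - 1) (sn n + rinv (\<psi>s n) y) / seq.H n (d - 1) (sn n) = kernel_cdf d (\<psi>s n) x y"
      using evpos by eventually_elim (use True in \<open>simp add: Fn\<close>)
    ultimately show ?thesis using True ps by (simp add: F tendsto_cong)
  qed
  then show "(\<lambda>n. cdf (kernel d (\<psi>s n) x) y) \<longlonglongrightarrow> cdf (kernel d \<psi> x) y"
    by (simp only: lim.cdf_kernel[OF x] seq.cdf_kernel[OF x])
qed

end

section \<open>Almost everywhere convergence of densities\<close>

context ar_gen
begin

text \<open>Fubini in the last coordinate: with the others fixed, the pseudo-inverse is injective
  and meets the level \<open>r\<close> in at most one point.\<close>

lemma AE_sum_ext_rinv_neq:
  assumes "0 < k"
  shows "AE y in leb k. (\<forall>i<k. y i \<in> {0<..<1}) \<longrightarrow> (\<Sum>i<k. ext_rinv \<psi> (y i)) \<noteq> r"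
proof -
  interpret product_sigma_finite "\<lambda>_::nat. lborel :: real measure" ..
  obtain m where k: "k = Suc m" using assms by (cases k) auto
  have ins: "{..<k} = insert m {..<m}" using k by auto
  define A where "A = {y \<in> space (leb k). y m \<in> {0<..<1} \<and> (\<Sum>i<k. ext_rinv \<psi> (y i)) \<in> {r}}"
  have S: "(\<lambda>y. \<Sum>i<k. ext_rinv \<psi> (y i)) \<in> borel_measurable (leb k)" by measurable
  have m: "(\<lambda>y. y m) \<in> borel_measurable (leb k)"
    using measurable_component_singleton[of m "{..<k}" "\<lambda>_. lborel :: real measure"] k by simp
  have A [measurable]: "A \<in> sets (leb k)" unfolding A_def
    by (intro sets.sets_Collect_conj measurable_sets_Collect[OF S] measurable_sets_Collect[OF m]) simp_all
  have "(\<integral>\<^sup>+y. indicator A y \<partial>leb k) = (\<integral>\<^sup>+y. (\<integral>\<^sup>+t. indicator A (y(m := t)) \<partial>lborel) \<partial>leb m)"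
    using A unfolding ins by (intro product_nn_integral_insert) auto
  also have "\<dots> = (\<integral>\<^sup>+y. 0 \<partial>leb m)"
  proof (rule nn_integral_cong)
    fix y assume "y \<in> space (leb m)"
    \<comment> \<open>The only candidate for the last coordinate, found by solving the level
      equation for it.\<close>
    define v where "v = \<psi> (r - (\<Sum>i<m. ext_rinv \<psi> (y i)))"
    have "t = v" if "y(m := t) \<in> A" for t
    proof -
      have t: "0 < t" "t < 1" "(\<Sum>i<k. ext_rinv \<psi> ((y(m := t)) i)) = r" using that by (auto simp: A_def)
      have "(\<Sum>i<k. ext_rinv \<psi> ((y(m := t)) i)) = rinv \<psi> t + (\<Sum>i<m. ext_rinv \<psi> (y i))"
        unfolding ins using t(1,2) by (simp add: ext_rinv_eq)
      then have "r - (\<Sum>i<m. ext_rinv \<psi> (y i)) = rinv \<psi> t" using t(3) by simp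
      then show ?thesis using t psi_rinv[of t] by (simp add: v_def)
    qed
    then have "indicator A (y(m := t)) \<le> (indicator {v} t :: ennreal)" for t
      by (auto simp: indicator_def)
    then have "(\<integral>\<^sup>+t. indicator A (y(m := t)) \<partial>lborel) \<le> (\<integral>\<^sup>+t. indicator {v} t \<partial>lborel)"
      by (rule nn_integral_mono)
    then show "(\<integral>\<^sup>+t. indicator A (y(m := t)) \<partial>lborel) = 0" by simp
  qed
  finally have "emeasure (leb k) A = 0" using A by simp
  then have "AE y in leb k. y \<notin> A" using A by (intro AE_not_in null_setsI)
  moreover have "AE y in leb k. y \<in> space (leb k)" by (rule AE_space)
  ultimately show ?thesis by eventually_elim (use k in \<open>auto simp: A_def\<close>)
qed

lemma countable_discontinuities: "countable {s \<in> {0<..}. \<not> isCont (H (d - 1)) s}"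
proof -
  have "mono_on {0<..} (\<lambda>x. - H (d - 1) x)" by (rule mono_onI) (use H_antimono in auto)
  then have "countable {s \<in> {0<..}. \<not> isCont (\<lambda>x. - H (d - 1) x) s}"
    by (intro mono_on_ctble_discont_open) auto
  moreover have "isCont (\<lambda>x. - H (d - 1) x) s \<longleftrightarrow> isCont (H (d - 1)) s" for s
    using continuous_minus[of "at s" "H (d - 1)"] continuous_minus[of "at s" "\<lambda>x. - H (d - 1) x"] by auto
  ultimately show ?thesis by simp
qed

lemma AE_sum_ext_rinv_isCont:
  "AE y in leb (d - 1). (\<forall>i<d - 1. y i \<in> {0<..<1}) \<longrightarrow> isCont (H (d - 1)) (\<Sum>i<d - 1. ext_rinv \<psi> (y i))"
proof -
  have "AE y in leb (d - 1). \<forall>r\<in>{s \<in> {0<..}. \<not> isCont (H (d - 1)) s}.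
      (\<forall>i<d - 1. y i \<in> {0<..<1}) \<longrightarrow> (\<Sum>i<d - 1. ext_rinv \<psi> (y i)) \<noteq> r"
    using d1 by (subst AE_ball_countable[OF countable_discontinuities]) (intro ballI AE_sum_ext_rinv_neq, simp)
  then show ?thesis
  proof eventually_elim
    case (elim y)
    show ?case
    proof
      assume y: "\<forall>i<d - 1. y i \<in> {0<..<1}"
      have "(\<Sum>i<d - 1. ext_rinv \<psi> (y i)) = (\<Sum>i<d - 1. rinv \<psi> (y i))"
        using y by (intro sum.cong) (auto simp: ext_rinv_def)
      then have "0 < (\<Sum>i<d - 1. ext_rinv \<psi> (y i))" using sum_rinv_pos[of y] y by simp
      then show "isCont (H (d - 1)) (\<Sum>i<d - 1. ext_rinv \<psi> (y i))" using elim y by auto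
    qed
  qed
qed

text \<open>Beyond the zero of \<open>\<psi>\<close> the density vanishes, and the zero itself is a single level of the sum.\<close>
lemma AE_copula_density_zero:
  "AE y in leb (d - 1). \<psi> (\<Sum>i<d - 1. ext_rinv \<psi> (y i)) = 0 \<longrightarrow> copula_density d \<psi> y = 0"
proof -
  \<comment> \<open>For an infinite pseudo-inverse this is the default 0; \<open>le\<close> below
    excludes that case.\<close>
  let ?z = "real_of_ereal (pseudo_inv \<psi> 0)"
  have "AE y in leb (d - 1). (\<forall>i<d - 1. y i \<in> {0<..<1}) \<longrightarrow> (\<Sum>i<d - 1. ext_rinv \<psi> (y i)) \<noteq> ?z"
    using d1 by (intro AE_sum_ext_rinv_neq) simp
  then show ?thesis
  proof eventually_elim
    case (elim y)
    show ?case
    proof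
      assume zero: "\<psi> (\<Sum>i<d - 1. ext_rinv \<psi> (y i)) = 0"
      show "copula_density d \<psi> y = 0"
      proof (cases "\<forall>i<d - 1. y i \<in> {0<..<1}")
        case True
        let ?s = "\<Sum>i<d - 1. ext_rinv \<psi> (y i)"
        have s: "0 \<le> ?s" by (intro sum_nonneg) simp
        have le: "pseudo_inv \<psi> 0 \<le> ereal ?s" using pseudo_inv_0_le[of "ereal ?s"] s zero by simp
        then obtain z where z: "pseudo_inv \<psi> 0 = ereal z" "0 \<le> z"
          using pseudo_inv_nonneg[of \<psi> 0] by (cases "pseudo_inv \<psi> 0") auto
        have "\<psi> z = 0" using pseudo_inv_0_le[of "ereal z"] z by simp
        moreover have "z < ?s" using le z elim True by auto
        ultimately have "H (d - 1) ?s = 0" using z by (intro H_eq_0) auto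
        moreover have "0 < ?s" using z \<open>z < ?s\<close> by simp
        ultimately show ?thesis by (simp add: copula_density_def ext_deriv_def)
      next
        case False
        then show ?thesis using copula_density_eq_0[of _ y] by blast
      qed
    qed
  qed
qed

text \<open>The set \<open>\<Lambda>\<close> for weak conditional convergence: its conditions are
  what \<open>kernel_weak_conv\<close> asks of a point, written with the measurable
  \<open>ext_rinv\<close>.\<close>

definition regular_points :: "(nat \<Rightarrow> real) set" where
  "regular_points = {y \<in> space (leb (d - 1)). (\<forall>i<d - 1. y i \<in> {0<..<1}) \<and>
    0 < \<psi> (\<Sum>i<d - 1. ext_rinv \<psi> (y i)) \<and> isCont (H (d - 1)) (\<Sum>i<d - 1. ext_rinv \<psi> (y i))}"

lemma regular_points_subset: "regular_points \<subseteq> cube (d - 1)"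
proof
  fix y assume "y \<in> regular_points"
  then have "y \<in> {..<d - 1} \<rightarrow>\<^sub>E UNIV" "\<forall>i<d - 1. y i \<in> {0<..<1}"
    by (auto simp: regular_points_def space_PiM)
  then show "y \<in> cube (d - 1)"
    unfolding cube_def PiE_iff by (metis UNIV_I atLeastAtMost_iff greaterThanLessThan_iff lessThan_iff less_imp_le)
qed

text \<open>Measurability of \<open>\<psi>\<close> is not known on negative arguments, so it is
  replaced by \<open>ext_deriv\<close> at order 0; continuity becomes avoidance of the countable set
  \<open>D\<close>.\<close>

lemma regular_points_sets: "regular_points \<in> sets (leb (d - 1))"
proof -
  define D where "D = {s \<in> {0<..}. \<not> isCont (H (d - 1)) s}"
  have D [measurable]: "D \<in> sets borel"
    unfolding D_def by (rule sets.countable[OF _ countable_discontinuities]) simp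
  have [measurable]: "ext_deriv d \<psi> 0 \<in> borel_measurable borel" by (rule ext_deriv_measurable) simp
  have "y \<in> regular_points \<longleftrightarrow> (\<forall>i\<in>{..<d - 1}. y i \<in> {0<..<1}) \<and>
      0 < ext_deriv d \<psi> 0 (\<Sum>i<d - 1. ext_rinv \<psi> (y i)) \<and> (\<Sum>i<d - 1. ext_rinv \<psi> (y i)) \<notin> D"
    if "y \<in> space (leb (d - 1))" for y
  proof (cases "\<forall>i<d - 1. y i \<in> {0<..<1}")
    case True
    have "(\<Sum>i<d - 1. ext_rinv \<psi> (y i)) = (\<Sum>i<d - 1. rinv \<psi> (y i))"
      using True by (intro sum.cong) (auto simp: ext_rinv_def)
    then have "0 < (\<Sum>i<d - 1. ext_rinv \<psi> (y i))" using sum_rinv_pos[of y] True by simp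
    then show ?thesis using that True by (simp add: regular_points_def D_def ext_deriv_def)
  next
    case False
    then show ?thesis by (auto simp: regular_points_def)
  qed
  then have "regular_points = {y \<in> space (leb (d - 1)). (\<forall>i\<in>{..<d - 1}. y i \<in> {0<..<1}) \<and>
      0 < ext_deriv d \<psi> 0 (\<Sum>i<d - 1. ext_rinv \<psi> (y i)) \<and> (\<Sum>i<d - 1. ext_rinv \<psi> (y i)) \<notin> D}"
    unfolding regular_points_def by blast
  also have "\<dots> \<in> sets (leb (d - 1))" by measurable
  finally show ?thesis .
qed

text \<open>A point of the open cube that is not regular either lies in the null set of
  discontinuities or has generator value 0, where the density vanishes almost everywhere. So the
  regular points carry the whole mass.\<close>

lemma emeasure_regular_points:
  assumes c: "marginal_density d (arch_copula d \<psi>) c"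
  shows "emeasure (marginal_measure d c) regular_points = 1"
proof -
  let ?C = "cube (d - 1)"
  have "integrable (leb (d - 1)) (\<lambda>y. indicator ?C y *\<^sub>R c y)"
    using c unfolding marginal_density_def set_integrable_def by blast
  \<comment> \<open>Integrability on the cube gives measurability of the product of \<open>c\<close>
    with the indicator, not of \<open>c\<close> alone.\<close>
  then have "(\<lambda>y. ennreal (indicator ?C y *\<^sub>R c y)) \<in> borel_measurable (leb (d - 1))"
    by (intro measurable_compose[OF borel_measurable_integrable measurable_ennreal])
  moreover have eq: "ennreal (indicator ?C y *\<^sub>R c y) = ennreal (c y) * indicator ?C y" for y
    by (simp add: indicator_def)
  ultimately have "(\<lambda>y. ennreal (c y) * indicator ?C y) \<in> borel_measurable (leb (d - 1))"
    by (simp only: eq)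
  then have "emeasure (marginal_measure d c) regular_points =
      (\<integral>\<^sup>+y. ennreal (c y) * indicator ?C y * indicator regular_points y \<partial>leb (d - 1))"
    unfolding marginal_measure_def by (rule emeasure_density) (rule regular_points_sets)
  also have "\<dots> = (\<integral>\<^sup>+y. ennreal (copula_density d \<psi> y) \<partial>leb (d - 1))"
  proof (rule nn_integral_cong_AE)
    have "AE y in leb (d - 1). y \<in> space (leb (d - 1))" by (rule AE_space)
    then show "AE y in leb (d - 1). ennreal (c y) * indicator ?C y * indicator regular_points y =
        ennreal (copula_density d \<psi> y)"
      using marginal_density_AE_eq[OF c] AE_sum_ext_rinv_isCont AE_copula_density_zero
    proof eventually_elim
      case (elim y)
      show ?case
      proof (cases "y \<in> regular_points")
        case True
        then have "y \<in> ?C" using regular_points_subset by blast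
        then show ?thesis using elim True by simp
      next
        case False
        have "copula_density d \<psi> y = 0"
        proof (cases "\<forall>i<d - 1. y i \<in> {0<..<1}")
          case True
          have "0 \<le> \<psi> (\<Sum>i<d - 1. ext_rinv \<psi> (y i))" by (intro nonneg sum_nonneg) simp
          moreover have "\<not> 0 < \<psi> (\<Sum>i<d - 1. ext_rinv \<psi> (y i))"
            using False True elim by (auto simp: regular_points_def)
          ultimately show ?thesis using elim(4) by simp
        next
          case False
          then show ?thesis using copula_density_eq_0[of _ y] by blast
        qed
        then show ?thesis using False by simp
      qed
    qed
  qed
  finally show ?thesis by (simp only: nn_integral_copula_density_UNIV)
qed

text \<open>Coordinates equal to 1 contribute 0, which yields the bivariate margin. The number
  \<open>m\<close> is free since it becomes \<open>d\<close> for the copula and \<open>d - 1\<close>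
  for its margin.\<close>

lemma sum_pseudo_inv_pair:
  fixes m :: nat
  assumes x: "\<And>i. i < m \<Longrightarrow> x i = (if i = 0 then u else if i = 1 then v else 1)" and m: "2 \<le> m"
  shows "(\<Sum>i<m. pseudo_inv \<psi> (x i)) = pseudo_inv \<psi> u + pseudo_inv \<psi> v"
proof -
  have "(\<Sum>i<m. pseudo_inv \<psi> (x i)) = (\<Sum>i\<in>{0, 1}. pseudo_inv \<psi> (x i))"
    using m x by (intro sum.mono_neutral_right) (auto simp: pseudo_inv_1)
  then show ?thesis using m x by simp
qed

end

section \<open>Convergence of the marginal densities and its consequences\<close>

context ar_seq
begin

text \<open>The factor \<open>H (d - 1)\<close> converges when the sum is a continuity point, thus
  almost everywhere. The weights involve \<open>H 1\<close>, which is continuous on the positive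
  half-line because \<open>1 < d - 1\<close>, so they converge at every interior point.\<close>

lemma copula_density_tendsto:
  assumes inv: "\<And>y. 0 < y \<Longrightarrow> y \<le> 1 \<Longrightarrow> (\<lambda>n. rinv (\<psi>s n) y) \<longlonglongrightarrow> rinv \<psi> y"
  shows "AE y in leb (d - 1). (\<lambda>n. copula_density d (\<psi>s n) y) \<longlonglongrightarrow> copula_density d \<psi> y"
  using lim.AE_sum_ext_rinv_isCont
proof eventually_elim
  case (elim y)
  have pw: "(\<lambda>n. \<psi>s n x) \<longlonglongrightarrow> \<psi> x" if "0 < x" for x using psi_tendsto_of_rinv[OF inv] that by simp
  show ?case
  proof (cases "\<forall>i<d - 1. y i \<in> {0<..<1}")
    case True
    let ?s = "\<Sum>i<d - 1. rinv \<psi> (y i)" and ?sn = "\<lambda>n. \<Sum>i<d - 1. rinv (\<psi>s n) (y i)"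
    have y: "0 < y i" "y i < 1" if "i < d - 1" for i using True that by auto
    have ext: "(\<Sum>i<d - 1. ext_rinv \<theta> (y i)) = (\<Sum>i<d - 1. rinv \<theta> (y i))" for \<theta>
      using y by (intro sum.cong) (auto simp: ext_rinv_def)
    have s: "0 < ?s" "0 < ?sn n" for n
      using lim.sum_rinv_pos[of y] seq.sum_rinv_pos[of y n] True by auto
    have d: "d - 2 < d - 1" "Suc (d - 2) = d - 1" "0 < d - 1" using lim.d3 by auto
    have "isCont (lim.H (d - 1)) ?s" using elim True ext by simp
    moreover have "?sn \<longlonglongrightarrow> ?s" using y by (intro tendsto_sum inv) (auto simp: less_imp_le)
    ultimately have "(\<lambda>n. seq.H n (d - 1) (?sn n)) \<longlonglongrightarrow> lim.H (d - 1) ?s"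
      using H_tendsto_moving[OF pw d(1) s(1), of ?sn] unfolding d(2) by blast
    then have "(\<lambda>n. ext_deriv d (\<psi>s n) (d - 1) (?sn n)) \<longlonglongrightarrow> ext_deriv d \<psi> (d - 1) ?s"
      using s by (simp add: ext_deriv_def)
    moreover have "(\<lambda>n. rinv_weight d (\<psi>s n) u) \<longlonglongrightarrow> rinv_weight d \<psi> u" if u: "0 < u" "u < 1" for u
    proof -
      have r: "0 < rinv \<psi> u" using lim.rinv_pos_iff[of u] u by simp
      have "isCont (lim.H (Suc 0)) (rinv \<psi> u)" using lim.H_isCont[OF lim.d1 r] by simp
      moreover have "(\<lambda>n. rinv (\<psi>s n) u) \<longlonglongrightarrow> rinv \<psi> u" using u by (intro inv) auto
      ultimately have "(\<lambda>n. seq.H n (Suc 0) (rinv (\<psi>s n) u)) \<longlonglongrightarrow> lim.H (Suc 0) (rinv \<psi> u)"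
        using H_tendsto_moving[OF pw d(3) r, of "\<lambda>n. rinv (\<psi>s n) u"] by blast
      then show ?thesis
        using lim.H1_rinv_pos[OF u] u unfolding rinv_weight_def by (auto intro!: tendsto_inverse)
    qed
    ultimately show ?thesis
      unfolding copula_density_def ext using y by (intro tendsto_mult tendsto_prod) auto
  next
    case False
    then obtain i where "i < d - 1" "y i \<notin> {0<..<1}" by blast
    then show ?thesis using lim.copula_density_eq_0 seq.copula_density_eq_0 by simp
  qed
qed

lemma weak_cond_conv_of_rinv:
  assumes inv: "\<And>y. 0 < y \<Longrightarrow> y \<le> 1 \<Longrightarrow> (\<lambda>n. rinv (\<psi>s n) y) \<longlonglongrightarrow> rinv \<psi> y"
    and c: "marginal_density d (arch_copula d \<psi>) c"
  shows "weak_cond_conv d \<psi>s \<psi> c"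
  unfolding weak_cond_conv_def
proof (intro bexI conjI ballI)
  fix y assume "y \<in> lim.regular_points"
  then have y: "\<And>i. i < d - 1 \<Longrightarrow> y i \<in> {0<..<1}"
    and *: "0 < \<psi> (\<Sum>i<d - 1. ext_rinv \<psi> (y i))" "isCont (lim.H (d - 1)) (\<Sum>i<d - 1. ext_rinv \<psi> (y i))"
    by (auto simp: lim.regular_points_def)
  have "(\<Sum>i<d - 1. ext_rinv \<psi> (y i)) = (\<Sum>i<d - 1. rinv \<psi> (y i))"
    using y by (intro sum.cong) (auto simp: ext_rinv_def)
  then show "weak_conv_m (\<lambda>n. kernel d (\<psi>s n) y) (kernel d \<psi> y)"
    using * by (intro kernel_weak_conv inv y) simp_all
qed (use lim.regular_points_sets lim.regular_points_subset lim.emeasure_regular_points[OF c] in auto)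

lemma AE_densities_eq:
  assumes c: "marginal_density d (arch_copula d \<psi>) c"
    and cs: "\<And>n. marginal_density d (arch_copula d (\<psi>s n)) (cs n)"
  shows "AE y in leb (d - 1). y \<in> cube (d - 1) \<longrightarrow>
    c y = copula_density d \<psi> y \<and> (\<forall>n. cs n y = copula_density d (\<psi>s n) y)"
proof -
  have "AE y in leb (d - 1). \<forall>n. y \<in> cube (d - 1) \<longrightarrow> cs n y = copula_density d (\<psi>s n) y"
    unfolding AE_all_countable using seq.marginal_density_AE_eq[OF cs] by blast
  with lim.marginal_density_AE_eq[OF c] show ?thesis by eventually_elim auto
qed

text \<open>All densities have total mass 1, so Scheffe's lemma turns almost everywhere convergence
  into convergence in \<open>L1\<close>, and restriction to a box can only decrease the
  \<open>L1\<close> distance.\<close>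

lemma marginal_tendsto_of_densities:
  assumes lim: "AE y in leb (d - 1). (\<lambda>n. copula_density d (\<psi>s n) y) \<longlonglongrightarrow> copula_density d \<psi> y"
    and x: "\<And>i. i < d - 1 \<Longrightarrow> 0 \<le> x i \<and> x i \<le> 1"
  shows "(\<lambda>n. arch_copula d (\<psi>s n) (x(d - 1 := 1))) \<longlonglongrightarrow> arch_copula d \<psi> (x(d - 1 := 1))"
proof -
  let ?M = "leb (d - 1)"
  let ?I = "\<lambda>y. indicat_real {y. \<forall>i<d - 1. y i \<le> x i} y"
  have L1: "(\<lambda>n. \<integral>\<^sup>+y. norm (copula_density d (\<psi>s n) y - copula_density d \<psi> y) \<partial>?M) \<longlonglongrightarrow> 0"
    by (rule Scheffe_lemma2[OF seq.copula_density_measurable lim.copula_density_integrable lim])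
      (simp add: lim.nn_integral_copula_density_UNIV seq.nn_integral_copula_density_UNIV del: One_nat_def)
  have int: "integrable ?M (\<lambda>y. ?I y * f y)" if "integrable ?M f" for f
  proof (rule Bochner_Integration.integrable_bound[OF that])
    show "(\<lambda>y. ?I y * f y) \<in> borel_measurable ?M"
      using that by (intro borel_measurable_times box_indicator_measurable) simp
  qed (auto simp: indicator_def)
  have "(\<lambda>n. \<integral>y. ?I y * copula_density d (\<psi>s n) y \<partial>?M) \<longlonglongrightarrow> (\<integral>y. ?I y * copula_density d \<psi> y \<partial>?M)"
  proof (rule tendsto_L1_int)
    show "integrable ?M (\<lambda>y. ?I y * copula_density d (\<psi>s n) y)" for n
      by (rule int[OF seq.copula_density_integrable])
    show "integrable ?M (\<lambda>y. ?I y * copula_density d \<psi> y)"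
      by (rule int[OF lim.copula_density_integrable])
    show "(\<lambda>n. \<integral>\<^sup>+y. norm (?I y * copula_density d (\<psi>s n) y - ?I y * copula_density d \<psi> y) \<partial>?M) \<longlonglongrightarrow> 0"
    proof (rule tendsto_sandwich[OF _ _ tendsto_const L1])
      show "\<forall>\<^sub>F n in sequentially. (\<integral>\<^sup>+y. norm (?I y * copula_density d (\<psi>s n) y - ?I y * copula_density d \<psi> y) \<partial>?M)
          \<le> (\<integral>\<^sup>+y. norm (copula_density d (\<psi>s n) y - copula_density d \<psi> y) \<partial>?M)"
        by (intro always_eventually allI nn_integral_mono) (auto simp: indicator_def)
    qed simp
  qed
  then show ?thesis by (simp only: lim.integral_copula_density[OF x] seq.integral_copula_density[OF x])
qed

end

section \<open>Equivalence of the five modes of convergence\<close>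

theorem theorem4p9:
  fixes d :: nat and \<psi> :: "real \<Rightarrow> real" and \<psi>s :: "nat \<Rightarrow> real \<Rightarrow> real"
    and c :: "(nat \<Rightarrow> real) \<Rightarrow> real" and cs :: "nat \<Rightarrow> (nat \<Rightarrow> real) \<Rightarrow> real"
  assumes d: "3 \<le> d"
    and gen: "ar_generator d \<psi>"
    and gens: "\<And>n. ar_generator d (\<psi>s n)"
    and dens: "marginal_density d (arch_copula d \<psi>) c"
    and denss: "\<And>n. marginal_density d (arch_copula d (\<psi>s n)) (cs n)"
  shows
    "let P1 = uniform_limit (cube d) (\<lambda>n. arch_copula d (\<psi>s n)) (arch_copula d \<psi>) sequentially;
         P2 = (\<forall>y \<in> {0<..1}. (\<lambda>n. pseudo_inv (\<psi>s n) y) \<longlonglongrightarrow> pseudo_inv \<psi> y);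
         P3 = uniform_limit {0..} \<psi>s \<psi> sequentially;
         P4 = ((\<forall>m \<in> {1..d - 2}. \<forall>x > 0. (\<lambda>n. (deriv ^^ m) (\<psi>s n) x) \<longlonglongrightarrow> (deriv ^^ m) \<psi> x) \<and>
               (\<forall>x \<in> cont_points (left_deriv ((deriv ^^ (d - 2)) \<psi>)).
                  (\<lambda>n. left_deriv ((deriv ^^ (d - 2)) (\<psi>s n)) x) \<longlonglongrightarrow> left_deriv ((deriv ^^ (d - 2)) \<psi>) x));
         P5 = (weak_cond_conv d \<psi>s \<psi> c \<and>
               (AE x in leb (d - 1). x \<in> cube (d - 1) \<longrightarrow> (\<lambda>n. cs n x) \<longlonglongrightarrow> c x))
     in (P1 \<longleftrightarrow> P2) \<and> (P1 \<longleftrightarrow> P3) \<and> (P1 \<longleftrightarrow> P4) \<and> (P1 \<longleftrightarrow> P5)"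
proof -
  interpret ar_seq d \<psi> \<psi>s
    using d gen gens by unfold_locales
  \<comment> \<open>\<open>?inv\<close> is the hub of the implications; \<open>?pair\<close>,
    convergence of the bivariate margins, is the common route to it from the copulas and from the
    densities.\<close>
  let ?inv = "\<forall>y\<in>{0<..1}. (\<lambda>n. rinv (\<psi>s n) y) \<longlonglongrightarrow> rinv \<psi> y"
  let ?pair = "\<forall>u\<in>{0..1}. \<forall>v\<in>{0..1}.
      (\<lambda>n. psi_ext (\<psi>s n) (pseudo_inv (\<psi>s n) u + pseudo_inv (\<psi>s n) v))
        \<longlonglongrightarrow> psi_ext \<psi> (pseudo_inv \<psi> u + pseudo_inv \<psi> v)"
  let ?P1 = "uniform_limit (cube d) (\<lambda>n. arch_copula d (\<psi>s n)) (arch_copula d \<psi>) sequentially"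
  let ?P2 = "\<forall>y \<in> {0<..1}. (\<lambda>n. pseudo_inv (\<psi>s n) y) \<longlonglongrightarrow> pseudo_inv \<psi> y"
  let ?P3 = "uniform_limit {0..} \<psi>s \<psi> sequentially"
  let ?P4 = "(\<forall>m \<in> {1..d - 2}. \<forall>x > 0. (\<lambda>n. (deriv ^^ m) (\<psi>s n) x) \<longlonglongrightarrow> (deriv ^^ m) \<psi> x) \<and>
    (\<forall>x \<in> cont_points (left_deriv ((deriv ^^ (d - 2)) \<psi>)).
      (\<lambda>n. left_deriv ((deriv ^^ (d - 2)) (\<psi>s n)) x) \<longlonglongrightarrow> left_deriv ((deriv ^^ (d - 2)) \<psi>) x)"
  let ?P5 = "weak_cond_conv d \<psi>s \<psi> c \<and>
    (AE x in leb (d - 1). x \<in> cube (d - 1) \<longrightarrow> (\<lambda>n. cs n x) \<longlonglongrightarrow> c x)"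
  have pair_inv: ?inv if ?pair
    using that rinv_tendsto_of_pair by auto
  have P1_inv: ?inv if ?P1
  proof (rule pair_inv, intro ballI)
    fix u v :: real assume uv: "u \<in> {0..1}" "v \<in> {0..1}"
    define X where "X = restrict (\<lambda>i. if i = 0 then u else if i = 1 then v else 1) {..<d}"
    have X: "X i = (if i = 0 then u else if i = 1 then v else 1)" if "i < d" for i
      using that by (simp add: X_def)
    have "X \<in> cube d" using uv by (auto simp: X_def cube_def)
    then have "(\<lambda>n. arch_copula d (\<psi>s n) X) \<longlonglongrightarrow> arch_copula d \<psi> X"
      using that by (rule tendsto_uniform_limitI[rotated])
    then show "(\<lambda>n. psi_ext (\<psi>s n) (pseudo_inv (\<psi>s n) u + pseudo_inv (\<psi>s n) v))
        \<longlonglongrightarrow> psi_ext \<psi> (pseudo_inv \<psi> u + pseudo_inv \<psi> v)"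
      using d by (simp add: arch_copula_def lim.sum_pseudo_inv_pair[OF X] seq.sum_pseudo_inv_pair[OF X])
  qed
  have inv_pw: "(\<lambda>n. \<psi>s n x) \<longlonglongrightarrow> \<psi> x" if ?inv "0 \<le> x" for x
    using psi_tendsto_of_rinv that by simp
  have inv_P3: ?P3 if ?inv using uniform_limit_of_tendsto inv_pw[OF that] by blast
  have P3_P1: ?P1 if ?P3 using that by (rule copula_uniform_limit)
  have P3_P4: ?P4 if ?P3
    using tendsto_uniform_limitI[OF that] by (intro derivatives_tendsto_of_psi) auto
  have P4_P3: ?P3 if P4: ?P4
  proof -
    have "1 \<in> {1..d - 2}" using d by simp
    with P4 have "(\<lambda>n. (deriv ^^ 1) (\<psi>s n) x) \<longlonglongrightarrow> (deriv ^^ 1) \<psi> x" if "0 < x" for x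
      using that by blast
    then show ?thesis by (intro uniform_limit_of_tendsto psi_tendsto_of_deriv) simp_all
  qed
  have inv_P5: ?P5 if inv: ?inv
  proof
    have inv': "(\<lambda>n. rinv (\<psi>s n) y) \<longlonglongrightarrow> rinv \<psi> y" if "0 < y" "y \<le> 1" for y
      using inv that by simp
    show "weak_cond_conv d \<psi>s \<psi> c" by (rule weak_cond_conv_of_rinv[OF inv' dens])
    have "AE x in leb (d - 1). (\<lambda>n. copula_density d (\<psi>s n) x) \<longlonglongrightarrow> copula_density d \<psi> x"
      by (rule copula_density_tendsto) (rule inv')
    then show "AE x in leb (d - 1). x \<in> cube (d - 1) \<longrightarrow> (\<lambda>n. cs n x) \<longlonglongrightarrow> c x"
      using AE_densities_eq[OF dens denss] by eventually_elim auto
  qed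
  have P5_inv: ?inv if P5: ?P5
  proof (rule pair_inv, intro ballI)
    fix u v :: real assume uv: "u \<in> {0..1}" "v \<in> {0..1}"
    have conv: "AE y in leb (d - 1). y \<in> cube (d - 1) \<longrightarrow> (\<lambda>n. cs n y) \<longlonglongrightarrow> c y" using P5 by blast
    have sp: "AE y in leb (d - 1). y \<in> space (leb (d - 1))" by (rule AE_space)
    have AE: "AE y in leb (d - 1). (\<lambda>n. copula_density d (\<psi>s n) y) \<longlonglongrightarrow> copula_density d \<psi> y"
      using conv AE_densities_eq[OF dens denss] sp
    proof eventually_elim
      case (elim y)
      show ?case
      proof (cases "y \<in> cube (d - 1)")
        case False
        \<comment> \<open>The assumption covers the cube only; outside it all the explicit densities
          vanish.\<close>
        then obtain i where "i < d - 1" "y i \<notin> {0<..<1}"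
          using elim(3) by (fastforce simp: cube_def space_PiM PiE_iff)
        then show ?thesis using lim.copula_density_eq_0 seq.copula_density_eq_0 by simp
      qed (use elim in simp)
    qed
    let ?x = "\<lambda>i::nat. if i = 0 then u else if i = 1 then v else 1"
    have "(\<lambda>n. arch_copula d (\<psi>s n) (?x(d - 1 := 1))) \<longlonglongrightarrow> arch_copula d \<psi> (?x(d - 1 := 1))"
      by (rule marginal_tendsto_of_densities[OF AE]) (use uv in auto)
    \<comment> \<open>Here \<open>3 \<le> d\<close> guarantees that the bivariate margin can be read
      off the \<open>(d-1)\<close>-margin.\<close>
    moreover have "2 \<le> d - 1" using d by simp
    ultimately show "(\<lambda>n. psi_ext (\<psi>s n) (pseudo_inv (\<psi>s n) u + pseudo_inv (\<psi>s n) v))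
        \<longlonglongrightarrow> psi_ext \<psi> (pseudo_inv \<psi> u + pseudo_inv \<psi> v)"
      by (simp only: lim.arch_copula_marginal seq.arch_copula_marginal
          lim.sum_pseudo_inv_pair[OF refl] seq.sum_pseudo_inv_pair[OF refl])
  qed
  have "?P2 \<longleftrightarrow> ?inv" by (rule pseudo_inv_tendsto_iff)
  then show ?thesis
    unfolding Let_def using P1_inv inv_P3 P3_P1 P3_P4 P4_P3 inv_P5 P5_inv by blast
qed

end
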